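(* The following problem is (Turing) decidable. INSTANCE: $\ell$-group terms $t_1,\ldots,t_n$ in the same variables $X_1,\ldots,X_m$. QUESTION: Is the $\ell$-subgroup of $\mathcal A_m$ generated by $\hat t_1,\ldots,\hat t_n$ $\ell$-isomorphic to $\mathcal A_n$?
   Context: All $\ell$-groups (lattice-ordered groups) are abelian. An $\ell$-group term in the variables $X_1,\ldots,X_m$ is a finite string built from $X_1,\ldots,X_m$ and the constant $0$ by the operation symbols $+,-,\vee,\wedge$. Every term $t(X_1,\ldots,X_m)$ is interpreted as a piecewise homogeneous linear function $\hat t\colon\mathbb R^m\to\mathbb R$: $\widehat{X_i}=\pi_i$ is the $i$th coordinate function, $0$ is the constant zero function, and $\vee,\wedge,+,-$ act as pointwise max, min, sum and subtraction. For $k=1,2,\ldots$, $\mathcal A_k$ denotes the free abelian $\ell$-group over the free generating set $\pi_1,\ldots,\pi_k$; concretely, $\mathcal A_k$ is the $\ell$-group, under pointwise operations, of all functions $\mathbb R^k\to\mathbb R$ of the form $\hat t$ for $t$ an $\ell$-group term in $X_1,\ldots,X_k$. Equivalently, it consists of all continuous functions $f\colon\mathbb R^k\to\mathbb R$ for which there are finitely many homogeneous linear functions $l_1,\ldots,l_r$ with integer coefficients such that for each $x$ there is $j$ with $f(x)=l_j(x)$. An $\ell$-isomorphism is an isomorphism of $\ell$-groups (a group and lattice isomorphism). The integers $m,n\ge 1$ are part of the instance. *)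

theory Defs
  imports Complex_Main "HOL-Library.FuncSet" "HOL-Algebra.Group"
begin

section \<open>Turing machines and decidable languages\<close>

text \<open>
  Deterministic machines with finitely many two-way infinite tapes, over the finite input
  alphabet \<open>'a\<close>. The tape alphabet of a machine is a finite set of cells; the symbols
  \<open>Work i\<close> provide arbitrarily many auxiliary tape symbols.
\<close>

datatype 'a cell = Blank | Input 'a | Work nat

datatype move = Left | Right | Stay

record 'a tm =
  tapes :: nat
  states :: "nat set"
  symbols :: "'a cell set"
  start :: nat
  accept :: nat
  reject :: nat
  trans_fun :: "nat \<Rightarrow> 'a cell list \<Rightarrow> nat \<times> ('a cell \<times> move) list"

text \<open>
  The last conjunct makes the transition function, restricted to the finitely many states and
  tuples of scanned symbols, a finite table; its values elsewhere are never consulted in a run.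
\<close>

definition tm :: "'a tm \<Rightarrow> bool" where
  "tm M \<longleftrightarrow>
     tapes M \<ge> 1 \<and>
     finite (states M) \<and> start M \<in> states M \<and> accept M \<in> states M \<and> reject M \<in> states M \<and>
     accept M \<noteq> reject M \<and>
     finite (symbols M) \<and> Blank \<in> symbols M \<and> range Input \<subseteq> symbols M \<and>
     (\<forall>q\<in>states M. \<forall>ss. length ss = tapes M \<and> set ss \<subseteq> symbols M \<longrightarrow>
        (case trans_fun M q ss of (q', as) \<Rightarrow>
           q' \<in> states M \<and> length as = tapes M \<and> fst ` set as \<subseteq> symbols M))"

type_synonym 'a tape = "(int \<Rightarrow> 'a cell) \<times> int"  (* contents and head position *)

type_synonym 'a config = "nat \<times> 'a tape list"

fun shift :: "move \<Rightarrow> int \<Rightarrow> int" where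
  "shift Left p = p - 1"
| "shift Right p = p + 1"
| "shift Stay p = p"

fun scan :: "'a tape \<Rightarrow> 'a cell" where
  "scan (c, p) = c p"

fun act :: "'a cell \<times> move \<Rightarrow> 'a tape \<Rightarrow> 'a tape" where
  "act (s, d) (c, p) = (c(p := s), shift d p)"

fun step :: "'a tm \<Rightarrow> 'a config \<Rightarrow> 'a config" where
  "step M (q, tps) =
     (if q = accept M \<or> q = reject M then (q, tps)
      else let (q', as) = trans_fun M q (map scan tps) in (q', map2 act as tps))"

definition input_tape :: "'a list \<Rightarrow> 'a tape" where
  "input_tape w = ((\<lambda>i. if 0 \<le> i \<and> i < int (length w) then Input (w ! nat i) else Blank), 0)"

definition initial :: "'a tm \<Rightarrow> 'a list \<Rightarrow> 'a config" where
  "initial M w = (start M, input_tape w # replicate (tapes M - 1) (\<lambda>_. Blank, 0))"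

definition reaches :: "'a tm \<Rightarrow> 'a list \<Rightarrow> nat \<Rightarrow> bool" where
  "reaches M w q \<longleftrightarrow> (\<exists>n. fst ((step M ^^ n) (initial M w)) = q)"

definition decides :: "'a tm \<Rightarrow> 'a list set \<Rightarrow> bool" where
  "decides M L \<longleftrightarrow>
     (\<forall>w. (w \<in> L \<longrightarrow> reaches M w (accept M)) \<and> (w \<notin> L \<longrightarrow> reaches M w (reject M)))"

definition turing_decidable :: "('a::finite) list set \<Rightarrow> bool" where
  "turing_decidable L \<longleftrightarrow> (\<exists>M. tm M \<and> decides M L)"


section \<open>Terms and their encoding as words\<close>

datatype lterm =
    Var nat
  | Zero
  | Plus lterm lterm
  | Minus lterm lterm
  | Join lterm lterm
  | Meet lterm lterm

primrec vars :: "lterm \<Rightarrow> nat set" where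
  "vars (Var i) = {i}"
| "vars Zero = {}"
| "vars (Plus s t) = vars s \<union> vars t"
| "vars (Minus s t) = vars s \<union> vars t"
| "vars (Join s t) = vars s \<union> vars t"
| "vars (Meet s t) = vars s \<union> vars t"

datatype letter =
  Letter_X | Stroke | Letter_0 | Sym_plus | Sym_minus | Sym_join | Sym_meet | Separator

instance letter :: finite
proof
  have "(UNIV :: letter set) =
      {Letter_X, Stroke, Letter_0, Sym_plus, Sym_minus, Sym_join, Sym_meet, Separator}"
    using letter.exhaust by blast
  then show "finite (UNIV :: letter set)"
    by (metis finite.emptyI finite.insertI)
qed

text \<open>Polish notation, with the index of a variable in unary.\<close>

primrec encode_term :: "lterm \<Rightarrow> letter list" where
  "encode_term (Var i) = Letter_X # replicate i Stroke"
| "encode_term Zero = [Letter_0]"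
| "encode_term (Plus s t) = Sym_plus # encode_term s @ encode_term t"
| "encode_term (Minus s t) = Sym_minus # encode_term s @ encode_term t"
| "encode_term (Join s t) = Sym_join # encode_term s @ encode_term t"
| "encode_term (Meet s t) = Sym_meet # encode_term s @ encode_term t"

definition encode_instance :: "nat \<Rightarrow> lterm list \<Rightarrow> letter list" where
  "encode_instance m ts = replicate m Stroke @ concat (map (\<lambda>t. Separator # encode_term t) ts)"

lemma replicate_stroke_cancel:
  assumes "replicate i Stroke @ u = replicate j Stroke @ v"
    and "u = [] \<or> hd u \<noteq> Stroke" and "v = [] \<or> hd v \<noteq> Stroke"
  shows "i = j \<and> u = v"
  using assms
proof (induction i arbitrary: j)
  case 0
  then show ?case by (cases j) auto
next
  case (Suc i)
  then show ?case by (cases j) auto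
qed

lemma encode_term_hd: "encode_term t @ u = [] \<or> hd (encode_term t @ u) \<noteq> Stroke"
  by (cases t) auto

lemma encode_term_cancel:
  assumes "encode_term s @ u = encode_term t @ v"
    and "u = [] \<or> hd u \<noteq> Stroke" and "v = [] \<or> hd v \<noteq> Stroke"
  shows "s = t \<and> u = v"
  using assms
proof (induction s arbitrary: t u v)
  case (Var i)
  then show ?case by (cases t) (auto dest: replicate_stroke_cancel)
next
  case Zero
  then show ?case by (cases t) auto
next
  case (Plus s1 s2)
  obtain t1 t2 where t: "t = Plus t1 t2" using Plus.prems(1) by (cases t) auto
  have "encode_term s1 @ encode_term s2 @ u = encode_term t1 @ encode_term t2 @ v"
    using Plus.prems(1) t by simp
  then have 1: "s1 = t1 \<and> encode_term s2 @ u = encode_term t2 @ v"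
    by (rule Plus.IH(1)[OF _ encode_term_hd encode_term_hd])
  have "s2 = t2 \<and> u = v"
    by (rule Plus.IH(2)[OF conjunct2[OF 1] Plus.prems(2,3)])
  then show ?case using 1 t by simp
next
  case (Minus s1 s2)
  obtain t1 t2 where t: "t = Minus t1 t2" using Minus.prems(1) by (cases t) auto
  have "encode_term s1 @ encode_term s2 @ u = encode_term t1 @ encode_term t2 @ v"
    using Minus.prems(1) t by simp
  then have 1: "s1 = t1 \<and> encode_term s2 @ u = encode_term t2 @ v"
    by (rule Minus.IH(1)[OF _ encode_term_hd encode_term_hd])
  have "s2 = t2 \<and> u = v"
    by (rule Minus.IH(2)[OF conjunct2[OF 1] Minus.prems(2,3)])
  then show ?case using 1 t by simp
next
  case (Join s1 s2)
  obtain t1 t2 where t: "t = Join t1 t2" using Join.prems(1) by (cases t) auto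
  have "encode_term s1 @ encode_term s2 @ u = encode_term t1 @ encode_term t2 @ v"
    using Join.prems(1) t by simp
  then have 1: "s1 = t1 \<and> encode_term s2 @ u = encode_term t2 @ v"
    by (rule Join.IH(1)[OF _ encode_term_hd encode_term_hd])
  have "s2 = t2 \<and> u = v"
    by (rule Join.IH(2)[OF conjunct2[OF 1] Join.prems(2,3)])
  then show ?case using 1 t by simp
next
  case (Meet s1 s2)
  obtain t1 t2 where t: "t = Meet t1 t2" using Meet.prems(1) by (cases t) auto
  have "encode_term s1 @ encode_term s2 @ u = encode_term t1 @ encode_term t2 @ v"
    using Meet.prems(1) t by simp
  then have 1: "s1 = t1 \<and> encode_term s2 @ u = encode_term t2 @ v"
    by (rule Meet.IH(1)[OF _ encode_term_hd encode_term_hd])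
  have "s2 = t2 \<and> u = v"
    by (rule Meet.IH(2)[OF conjunct2[OF 1] Meet.prems(2,3)])
  then show ?case using 1 t by simp
qed

lemma concat_separator_hd:
  "concat (map (\<lambda>t. Separator # encode_term t) ts) = [] \<or>
   hd (concat (map (\<lambda>t. Separator # encode_term t) ts)) \<noteq> Stroke"
  by (cases ts) auto

lemma encode_terms_inject:
  "concat (map (\<lambda>t. Separator # encode_term t) ss) = concat (map (\<lambda>t. Separator # encode_term t) ts)
    \<Longrightarrow> ss = ts"
proof (induction ss arbitrary: ts)
  case Nil
  then show ?case by (cases ts) auto
next
  case (Cons s ss)
  obtain t ts' where ts: "ts = t # ts'" using Cons.prems by (cases ts) auto
  have "s = t \<and> concat (map (\<lambda>t. Separator # encode_term t) ss) =
      concat (map (\<lambda>t. Separator # encode_term t) ts')"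
    by (rule encode_term_cancel) (use Cons.prems ts concat_separator_hd in auto)
  then show ?case using Cons.IH ts by auto
qed

lemma encode_instance_inject:
  assumes "encode_instance m ss = encode_instance n ts"
  shows "m = n \<and> ss = ts"
proof -
  have "m = n \<and> concat (map (\<lambda>t. Separator # encode_term t) ss) =
      concat (map (\<lambda>t. Separator # encode_term t) ts)"
    by (rule replicate_stroke_cancel)
       (use assms concat_separator_hd in \<open>auto simp: encode_instance_def\<close>)
  then show ?thesis using encode_terms_inject by blast
qed


section \<open>Abelian lattice-ordered groups\<close>

text \<open>
  Groups are the library's, so the group operation, written additively in the mathematics, is
  the field \<open>mult\<close>, and zero is the field \<open>one\<close>.
\<close>

record 'a lgroup = "'a monoid" +
  ljoin :: "'a \<Rightarrow> 'a \<Rightarrow> 'a"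
  lmeet :: "'a \<Rightarrow> 'a \<Rightarrow> 'a"

definition l_subgroup :: "'a set \<Rightarrow> 'a lgroup \<Rightarrow> bool" where
  "l_subgroup H G \<longleftrightarrow>
     subgroup H G \<and> (\<forall>x\<in>H. \<forall>y\<in>H. ljoin G x y \<in> H \<and> lmeet G x y \<in> H)"

definition l_generated :: "'a lgroup \<Rightarrow> 'a set \<Rightarrow> 'a lgroup" where
  "l_generated G S = G\<lparr>carrier := \<Inter>{H. l_subgroup H G \<and> S \<subseteq> H}\<rparr>"

definition l_iso :: "'a lgroup \<Rightarrow> 'b lgroup \<Rightarrow> ('a \<Rightarrow> 'b) set" where
  "l_iso G H = {h \<in> iso G H. \<forall>x\<in>carrier G. \<forall>y\<in>carrier G.
     h (ljoin G x y) = ljoin H (h x) (h y) \<and> h (lmeet G x y) = lmeet H (h x) (h y)}"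

definition l_isomorphic :: "'a lgroup \<Rightarrow> 'b lgroup \<Rightarrow> bool" where
  "l_isomorphic G H \<longleftrightarrow> l_iso G H \<noteq> {}"


section \<open>Term functions and the free abelian lattice-ordered groups\<close>

text \<open>
  A point of \<open>\<real>\<^sup>k\<close> is a real family indexed by \<open>{1..k}\<close>; families, and functions on
  \<open>\<real>\<^sup>k\<close>, take the value \<^const>\<open>undefined\<close> off their domain, so that equality of
  functions on \<open>\<real>\<^sup>k\<close> is equality in HOL.
\<close>

definition Rn :: "nat \<Rightarrow> (nat \<Rightarrow> real) set" where
  "Rn k = {1..k} \<rightarrow>\<^sub>E UNIV"

primrec eval_term :: "lterm \<Rightarrow> (nat \<Rightarrow> real) \<Rightarrow> real" where
  "eval_term (Var i) x = x i"
| "eval_term Zero x = 0"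
| "eval_term (Plus s t) x = eval_term s x + eval_term t x"
| "eval_term (Minus s t) x = eval_term s x - eval_term t x"
| "eval_term (Join s t) x = max (eval_term s x) (eval_term t x)"
| "eval_term (Meet s t) x = min (eval_term s x) (eval_term t x)"

definition term_fun :: "nat \<Rightarrow> lterm \<Rightarrow> (nat \<Rightarrow> real) \<Rightarrow> real" where
  "term_fun k t = (\<lambda>x\<in>Rn k. eval_term t x)"

definition free_lgroup :: "nat \<Rightarrow> ((nat \<Rightarrow> real) \<Rightarrow> real) lgroup" where
  "free_lgroup k =
     \<lparr>carrier = {term_fun k t | t. vars t \<subseteq> {1..k}},
      mult = (\<lambda>f g. \<lambda>x\<in>Rn k. f x + g x),
      one = (\<lambda>x\<in>Rn k. 0),
      ljoin = (\<lambda>f g. \<lambda>x\<in>Rn k. max (f x) (g x)),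
      lmeet = (\<lambda>f g. \<lambda>x\<in>Rn k. min (f x) (g x))\<rparr>"

lemma term_fun_closed: "vars t \<subseteq> {1..k} \<Longrightarrow> term_fun k t \<in> carrier (free_lgroup k)"
  by (auto simp: free_lgroup_def)

lemma free_lgroup_term_fun:
  "term_fun k s \<otimes>\<^bsub>free_lgroup k\<^esub> term_fun k t = term_fun k (Plus s t)"
  "\<one>\<^bsub>free_lgroup k\<^esub> = term_fun k Zero"
  "ljoin (free_lgroup k) (term_fun k s) (term_fun k t) = term_fun k (Join s t)"
  "lmeet (free_lgroup k) (term_fun k s) (term_fun k t) = term_fun k (Meet s t)"
  by (auto simp: free_lgroup_def term_fun_def)

lemma free_lgroup_cases:
  assumes "f \<in> carrier (free_lgroup k)"
  obtains t where "f = term_fun k t" "vars t \<subseteq> {1..k}"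
  using assms by (auto simp: free_lgroup_def)

lemma comm_group_free_lgroup: "comm_group (free_lgroup k)"
proof (rule comm_groupI)
  fix f g assume "f \<in> carrier (free_lgroup k)" "g \<in> carrier (free_lgroup k)"
  then obtain s t where "f = term_fun k s" "g = term_fun k t" "vars s \<subseteq> {1..k}" "vars t \<subseteq> {1..k}"
    by (metis free_lgroup_cases)
  then show "f \<otimes>\<^bsub>free_lgroup k\<^esub> g \<in> carrier (free_lgroup k)"
    by (simp add: free_lgroup_term_fun term_fun_closed)
next
  show "\<one>\<^bsub>free_lgroup k\<^esub> \<in> carrier (free_lgroup k)"
    by (simp add: free_lgroup_term_fun term_fun_closed)
next
  fix f assume "f \<in> carrier (free_lgroup k)"
  then obtain t where t: "f = term_fun k t" "vars t \<subseteq> {1..k}"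
    by (rule free_lgroup_cases)
  show "\<exists>g\<in>carrier (free_lgroup k). g \<otimes>\<^bsub>free_lgroup k\<^esub> f = \<one>\<^bsub>free_lgroup k\<^esub>"
  proof
    show "term_fun k (Minus Zero t) \<otimes>\<^bsub>free_lgroup k\<^esub> f = \<one>\<^bsub>free_lgroup k\<^esub>"
      unfolding t(1) free_lgroup_term_fun by (simp add: term_fun_def)
    show "term_fun k (Minus Zero t) \<in> carrier (free_lgroup k)"
      using t(2) by (intro term_fun_closed) simp
  qed
qed (auto simp: free_lgroup_def term_fun_def add_ac restrict_def)

lemma l_subgroup_carrier_free_lgroup: "l_subgroup (carrier (free_lgroup k)) (free_lgroup k)"
proof -
  interpret comm_group "free_lgroup k" by (rule comm_group_free_lgroup)
  have "ljoin (free_lgroup k) f g \<in> carrier (free_lgroup k) \<and>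
        lmeet (free_lgroup k) f g \<in> carrier (free_lgroup k)"
    if fg: "f \<in> carrier (free_lgroup k)" "g \<in> carrier (free_lgroup k)" for f g
  proof -
    obtain s t where "f = term_fun k s" "g = term_fun k t" "vars s \<subseteq> {1..k}" "vars t \<subseteq> {1..k}"
      using fg by (metis free_lgroup_cases)
    then show ?thesis by (simp add: free_lgroup_term_fun term_fun_closed)
  qed
  then show ?thesis by (simp add: l_subgroup_def subgroup_self)
qed

end

theory Submission
  imports Defs "HOL-Library.Nat_Bijection" "HOL-Homology.Invariance_of_Domain"
begin

text \<open>
  Let \<open>T : \<real>\<^sup>m \<rightarrow> \<real>\<^sup>n\<close> be the map whose components are the term functions of the instance. The
  generated subgroup consists of the functions \<open>s \<circ> T\<close>, for terms \<open>s\<close> in \<open>n\<close> variables, and it is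
  isomorphic to the free group on \<open>n\<close> generators if and only if \<open>T\<close> is onto
  (\<open>isomorphic_iff_onto\<close>). If \<open>T\<close> is onto, \<open>s \<circ> T\<close> determines \<open>s\<close>. Conversely, an isomorphism
  carries the components of \<open>T\<close> to functions \<open>g\<^sub>1, \<dots>, g\<^sub>n\<close> that generate the free group, so that the
  map \<open>G = (g\<^sub>1, \<dots>, g\<^sub>n)\<close> has a left inverse. It is therefore injective, and by invariance of domain
  its image is open; since it contains \<open>0\<close> and is closed under positive scaling, it is all of
  \<open>\<real>\<^sup>n\<close>. Now if \<open>T\<close> missed a point \<open>y\<close>, some term \<open>s\<close> would vanish on the range of \<open>T\<close> but not at
  \<open>y\<close> (\<open>separating_term\<close>); the isomorphism turns \<open>s \<circ> T = 0\<close> into \<open>s \<circ> G = 0\<close>, whence \<open>s = 0\<close>.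

  It remains to decide whether \<open>T\<close> is onto. Only finitely many integer linear forms matter. Say that
  \<open>z'\<close> specializes \<open>z\<close> at level \<open>C\<close> if every inequality \<open>a \<bullet> z \<le> 0\<close> with integer coefficients of
  absolute value at most \<open>C\<close> is inherited by \<open>z'\<close>. At every point a term agrees with one of finitely
  many linear forms, and which one is decided by such inequalities; so for suitable \<open>C\<close> the relation
  \<open>T x = y\<close> is inherited by specializations of \<open>(y, x)\<close>. One step of Fourier-Motzkin elimination
  shows that a specialization at level \<open>2 C\<^sup>2\<close> can be extended by a coordinate to one at level \<open>C\<close>,
  whichever of the two points the new coordinate is prescribed for, and that the coordinate found
  can be a fraction of controlled height (\<open>specializes_extend_right\<close>, \<open>specializes_extend_left\<close>). This
  has three consequences: the range of \<open>T\<close> is closed under specialization, which gives the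
  separating terms; if a point is missed, then so is an integer point of bounded size, because
  every point specializes one of these; and an integer point \<open>y\<close> in the range satisfies
  \<open>T x = d y\<close> for an integer point \<open>x\<close> and an integer \<open>d \<ge> 1\<close> of bounded size. So \<open>T\<close> is onto if and only
  if a finite search succeeds, whose bounds are computed from the instance.

  For Turing machines, structured programs over several tapes are translated to machines, a number
  being stored on a tape as the position of the head. Functions on numbers that such programs
  realize are closed under composition, Cantor pairing and iteration, hence under all that the
  search needs; the terms are evaluated by a stack machine that reads the Polish notation from right
  to left.
\<close>


section \<open>Structured programs on tapes\<close>

text \<open>
  Programs, unlike transition tables, can be composed, and their tapes can be renamed. A loop
  \<open>Until i a c\<close> repeats \<open>c\<close> as long as tape \<open>i\<close> does not scan \<open>a\<close>.
\<close>

datatype 'a prog =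
    Skip
  | Move nat move
  | Write nat "'a cell"
  | Seq "'a prog" "'a prog"
  | Branch nat "'a cell" "'a prog" "'a prog"
  | Until nat "'a cell" "'a prog"

type_synonym 'a store = "nat \<Rightarrow> 'a tape"

definition stay :: "(nat \<Rightarrow> 'a cell) \<Rightarrow> nat \<Rightarrow> 'a cell \<times> move" where
  "stay ss = (\<lambda>i. (ss i, Stay))"

text \<open>
  A single step depends on the scanned symbols only, and it results in an action on every tape and
  in the program that is left to be run; the latter plays the part of the state of a machine.
\<close>

primrec advance ::
  "'a prog \<Rightarrow> (nat \<Rightarrow> 'a cell) \<Rightarrow> 'a prog \<times> (nat \<Rightarrow> 'a cell \<times> move)" where
  "advance Skip ss = (Skip, stay ss)"
| "advance (Move i d) ss = (Skip, (stay ss)(i := (ss i, d)))"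
| "advance (Write i a) ss = (Skip, (stay ss)(i := (a, Stay)))"
| "advance (Seq c d) ss =
     (if c = Skip then (d, stay ss) else (Seq (fst (advance c ss)) d, snd (advance c ss)))"
| "advance (Branch i a c d) ss = (if ss i = a then c else d, stay ss)"
| "advance (Until i a c) ss = (if ss i = a then Skip else Seq c (Until i a c), stay ss)"

definition small_step :: "'a prog \<times> 'a store \<Rightarrow> 'a prog \<times> 'a store" where
  "small_step = (\<lambda>(c, s). (fst (advance c (\<lambda>i. scan (s i))),
      \<lambda>i. act (snd (advance c (\<lambda>i. scan (s i))) i) (s i)))"

definition runs :: "'a prog \<Rightarrow> 'a store \<Rightarrow> 'a store \<Rightarrow> bool" where
  "runs c s t \<longleftrightarrow> (\<exists>n. (small_step ^^ n) (c, s) = (Skip, t))"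

lemma act_stay [simp]: "act (scan t, Stay) t = t"
  by (cases t) simp

lemma act_stay' [simp]: "act (stay (\<lambda>i. scan (s i)) i) (s i) = s i"
  by (simp add: stay_def)

lemma small_step_Skip [simp]: "small_step (Skip, s) = (Skip, s)"
  by (simp add: small_step_def)

lemma funpow_small_step_Skip [simp]: "(small_step ^^ n) (Skip, s) = (Skip, s)"
  by (induction n) auto

lemma runs_step: "small_step (c, s) = (c', s') \<Longrightarrow> runs c' s' t \<Longrightarrow> runs c s t"
  unfolding runs_def by (metis comp_apply funpow_Suc_right)

lemma runs_Skip: "runs Skip s s"
  unfolding runs_def by (rule exI[of _ 0]) simp

lemma runs_Move: "runs (Move i d) s (s(i := (fst (s i), shift d (snd (s i)))))"
  by (rule runs_step[OF _ runs_Skip])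
     (auto simp: small_step_def fun_eq_iff stay_def split_beta intro: prod_eqI split: prod.splits,
      (metis act.simps fun_upd_triv prod.collapse scan.simps)+)

lemma runs_Write: "runs (Write i a) s (s(i := ((fst (s i))(snd (s i) := a), snd (s i))))"
  by (rule runs_step[OF _ runs_Skip])
     (auto simp: small_step_def fun_eq_iff stay_def,
      (metis act.simps shift.simps(3) prod.collapse fun_upd_apply)+)

lemma runs_Seq:
  assumes "runs c s t" "runs d t u"
  shows "runs (Seq c d) s u"
proof -
  have "(small_step ^^ n) (c, s) = (Skip, t) \<Longrightarrow> runs (Seq c d) s u" for n
  proof (induction n arbitrary: c s)
    case 0
    then show ?case using assms(2) by (intro runs_step[of "Seq c d" s d s]) (auto simp: small_step_def)
  next
    case (Suc n)
    show ?case
    proof (cases "c = Skip")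
      case True
      with Suc.prems have "s = t" by (simp del: funpow.simps)
      with True show ?thesis
        using assms(2) by (intro runs_step[of "Seq c d" s d s]) (auto simp: small_step_def)
    next
      case False
      obtain c' s' where cs: "small_step (c, s) = (c', s')" by fastforce
      with Suc.prems have "(small_step ^^ n) (c', s') = (Skip, t)"
        by (simp add: funpow_swap1)
      then have "runs (Seq c' d) s' u" by (rule Suc.IH)
      moreover have "small_step (Seq c d, s) = (Seq c' d, s')"
        using cs False by (auto simp: small_step_def)
      ultimately show ?thesis by (rule runs_step[rotated])
    qed
  qed
  then show ?thesis using assms(1) unfolding runs_def by blast
qed

lemma runs_Branch:
  assumes "scan (s i) = a \<Longrightarrow> runs c s t" "scan (s i) \<noteq> a \<Longrightarrow> runs d s t"
  shows "runs (Branch i a c d) s t"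
  by (rule runs_step[of _ _ "if scan (s i) = a then c else d" s])
     (use assms in \<open>auto simp: small_step_def\<close>)

lemma runs_Until_stop: "scan (s i) = a \<Longrightarrow> runs (Until i a c) s s"
  by (rule runs_step[OF _ runs_Skip]) (auto simp: small_step_def)

lemma runs_Until_step:
  assumes "scan (s i) \<noteq> a" "runs c s t" "runs (Until i a c) t u"
  shows "runs (Until i a c) s u"
  by (rule runs_step[OF _ runs_Seq[OF assms(2,3)]]) (use assms(1) in \<open>auto simp: small_step_def\<close>)

lemma runs_Until_iterate:
  assumes "\<And>j. j < n \<Longrightarrow> scan (S j i) \<noteq> a \<and> runs c (S j) (S (Suc j))" "scan (S n i) = a"
  shows "runs (Until i a c) (S (0::nat)) (S n)"
proof -
  have "j \<le> n \<Longrightarrow> runs (Until i a c) (S (n - j)) (S n)" for j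
  proof (induction j)
    case 0
    then show ?case using assms(2) by (simp add: runs_Until_stop)
  next
    case (Suc j)
    then have "Suc (n - Suc j) = n - j" "n - Suc j < n" by auto
    with Suc show ?case using assms(1)[of "n - Suc j"] by (auto intro: runs_Until_step)
  qed
  from this[of n] show ?thesis by simp
qed


subsection \<open>Renaming tapes\<close>

primrec rename :: "(nat \<Rightarrow> nat) \<Rightarrow> 'a prog \<Rightarrow> 'a prog" where
  "rename r Skip = Skip"
| "rename r (Move i d) = Move (r i) d"
| "rename r (Write i a) = Write (r i) a"
| "rename r (Seq c d) = Seq (rename r c) (rename r d)"
| "rename r (Branch i a c d) = Branch (r i) a (rename r c) (rename r d)"
| "rename r (Until i a c) = Until (r i) a (rename r c)"

lemma rename_eq_Skip [simp]: "rename r c = Skip \<longleftrightarrow> c = Skip"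
  by (cases c) auto

lemma advance_rename:
  assumes "inj r"
  shows "fst (advance (rename r c) ss) = rename r (fst (advance c (ss \<circ> r)))"
    and "snd (advance (rename r c) ss) (r i) = snd (advance c (ss \<circ> r)) i"
    and "j \<notin> range r \<Longrightarrow> snd (advance (rename r c) ss) j = (ss j, Stay)"
  using assms by (induction c) (auto simp: stay_def inj_eq comp_def)

text \<open>
  A program can neither see nor change a tape that it does not name. This lets a subroutine work on
  tapes of its own while the caller's data stay in place.
\<close>

lemma runs_rename:
  assumes "inj r" "runs c s t" "s' \<circ> r = s" "t' \<circ> r = t" "\<And>j. j \<notin> range r \<Longrightarrow> t' j = s' j"
  shows "runs (rename r c) s' t'"
proof -
  have "(small_step ^^ n) (c, s) = (Skip, t) \<Longrightarrow> s' \<circ> r = s \<Longrightarrow> t' \<circ> r = t \<Longrightarrow>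
        (\<And>j. j \<notin> range r \<Longrightarrow> t' j = s' j) \<Longrightarrow> runs (rename r c) s' t'" for n
  proof (induction n arbitrary: c s s')
    case 0
    have "t' j = s' j" for j
      using 0 by (cases "j \<in> range r") (auto simp: fun_eq_iff)
    then have "t' = s'" by auto
    with 0 show ?case by (auto intro: runs_Skip)
  next
    case (Suc n)
    define as where "as = snd (advance (rename r c) (\<lambda>i. scan (s' i)))"
    define s'' where "s'' = (\<lambda>i. act (as i) (s' i))"
    have scan: "(\<lambda>i. scan (s' i)) \<circ> r = (\<lambda>i. scan (s i))"
      using Suc.prems(2) by (auto simp: comp_def)
    have 1: "small_step (rename r c, s') = (rename r (fst (small_step (c, s))), s'')"
      by (simp add: small_step_def s''_def as_def advance_rename(1)[OF assms(1)] scan)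
    have 2: "s'' \<circ> r = snd (small_step (c, s))"
      using advance_rename(2)[OF assms(1), of c "\<lambda>i. scan (s' i)"] Suc.prems(2)
      by (auto simp: small_step_def s''_def as_def scan comp_def fun_eq_iff)
    have 3: "s'' j = s' j" if "j \<notin> range r" for j
      using advance_rename(3)[OF assms(1) that, of c "\<lambda>i. scan (s' i)"]
      by (simp add: s''_def as_def)
    have "(small_step ^^ n) (fst (small_step (c, s)), snd (small_step (c, s))) = (Skip, t)"
      using Suc.prems(1) by (simp add: funpow_swap1)
    then have "runs (rename r (fst (small_step (c, s)))) s'' t'"
      using 2 Suc.prems(3,4) 3 by (intro Suc.IH) auto
    then show ?case by (rule runs_step[OF 1])
  qed
  then show ?thesis using assms(2-) unfolding runs_def by blast
qed


subsection \<open>From programs to Turing machines\<close>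

text \<open>
  What can be left of a program during its run. There are finitely many such remainders, so they
  can serve as the states of a Turing machine.
\<close>

primrec conts :: "'a prog \<Rightarrow> 'a prog set" where
  "conts Skip = {Skip}"
| "conts (Move i d) = {Move i d, Skip}"
| "conts (Write i a) = {Write i a, Skip}"
| "conts (Seq c d) = (\<lambda>c'. Seq c' d) ` conts c \<union> conts d"
| "conts (Branch i a c d) = {Branch i a c d} \<union> conts c \<union> conts d"
| "conts (Until i a c) = {Until i a c, Skip} \<union> (\<lambda>c'. Seq c' (Until i a c)) ` conts c"

lemma finite_conts [simp]: "finite (conts c)"
  by (induction c) auto

lemma self_in_conts [simp]: "c \<in> conts c"
  by (induction c) auto

lemma Skip_in_conts [simp]: "Skip \<in> conts c"
  by (induction c) auto

lemma conts_closed: "d \<in> conts c \<Longrightarrow> fst (advance d ss) \<in> conts c"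
  by (induction c arbitrary: d) (auto simp: image_iff split: if_splits)

primrec width :: "'a prog \<Rightarrow> nat" where
  "width Skip = 0"
| "width (Move i d) = Suc i"
| "width (Write i a) = Suc i"
| "width (Seq c d) = max (width c) (width d)"
| "width (Branch i a c d) = max (Suc i) (max (width c) (width d))"
| "width (Until i a c) = max (Suc i) (width c)"

primrec written :: "'a prog \<Rightarrow> 'a cell set" where
  "written Skip = {}"
| "written (Move i d) = {}"
| "written (Write i a) = {a}"
| "written (Seq c d) = written c \<union> written d"
| "written (Branch i a c d) = written c \<union> written d"
| "written (Until i a c) = written c"

lemma finite_written [simp]: "finite (written c)"
  by (induction c) auto

lemma conts_bounds: "d \<in> conts c \<Longrightarrow> width d \<le> width c \<and> written d \<subseteq> written c"
  by (induction c arbitrary: d) fastforce+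

text \<open>
  A store has infinitely many tapes and a machine only \<open>k\<close> of them; a program of width at most \<open>k\<close> never
  looks beyond these.
\<close>

lemma advance_local:
  assumes "width c \<le> k" "\<And>i. i < k \<Longrightarrow> ss i = ss' i"
  shows "fst (advance c ss) = fst (advance c ss')"
    and "i < k \<Longrightarrow> snd (advance c ss) i = snd (advance c ss') i"
  using assms by (induction c) (auto simp: stay_def)

lemma advance_written: "fst (snd (advance c ss) i) \<in> insert (ss i) (written c)"
  by (induction c) (auto simp: stay_def)

text \<open>
  The numbers 0 and 1 are kept for the rejecting and the accepting state.
\<close>

definition code :: "'a prog \<Rightarrow> 'a prog \<Rightarrow> nat" where
  "code c = (\<lambda>d. (SOME f. inj_on f (conts c)) d + 2)"

lemma inj_code: "inj_on (code c) (conts c)"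
proof -
  have "\<exists>f :: 'a prog \<Rightarrow> nat. inj_on f (conts c)"
    using finite_imp_inj_to_nat_seg[OF finite_conts] by metis
  then have "inj_on (SOME f :: 'a prog \<Rightarrow> nat. inj_on f (conts c)) (conts c)"
    by (rule someI_ex)
  then show ?thesis by (auto simp: code_def inj_on_def)
qed

text \<open>
  When nothing is left of the program, tape 1 decides: the machine rejects if it scans \<open>Work 0\<close>. With
  the representation of numbers below, this says that the number on tape 1 is zero.
\<close>

definition machine :: "nat \<Rightarrow> 'a prog \<Rightarrow> 'a tm" where
  "machine k c =
    \<lparr>tapes = k,
     states = {0, 1} \<union> code c ` conts c,
     symbols = {Blank, Work 0} \<union> range Input \<union> written c,
     start = code c c,
     accept = 1,
     reject = 0,
     trans_fun = (\<lambda>q ss.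
       if q < 2 then (q, map (\<lambda>i. (ss ! i, Stay)) [0..<k])
       else let d = inv_into (conts c) (code c) q; r = advance d (\<lambda>i. ss ! i)
         in (if d = Skip then (if ss ! 1 = Work 0 then 0 else 1) else code c (fst r),
             map (snd r) [0..<k]))\<rparr>"

lemma tm_machine:
  fixes c :: "'a::finite prog"
  assumes "k \<ge> 1" "width c \<le> k"
  shows "tm (machine k c)"
proof -
  define S where "S = {Blank, Work 0} \<union> range Input \<union> written c"
  have table: "case trans_fun (machine k c) q ss of (q', as) \<Rightarrow>
      q' \<in> {0, 1} \<union> code c ` conts c \<and> length as = k \<and> fst ` set as \<subseteq> S"
    if q: "q \<in> {0, 1} \<union> code c ` conts c" and ss: "length ss = k" "set ss \<subseteq> S" for q ss
  proof (cases "q < 2")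
    case True
    then show ?thesis using q ss by (auto simp: machine_def)
  next
    case False
    then have q': "q \<in> code c ` conts c" using q by auto
    define d where "d = inv_into (conts c) (code c) q"
    have d: "d \<in> conts c" unfolding d_def by (rule inv_into_into[OF q'])
    have "fst (snd (advance d (\<lambda>i. ss ! i)) i) \<in> S" if "i < k" for i
    proof -
      have "ss ! i \<in> S" using ss that by (metis nth_mem subsetD)
      moreover have "written d \<subseteq> S" using conts_bounds[OF d] by (auto simp: S_def)
      ultimately show ?thesis using advance_written[of d "\<lambda>i. ss ! i" i] by auto
    qed
    moreover have "code c (fst (advance d (\<lambda>i. ss ! i))) \<in> code c ` conts c"
      using conts_closed[OF d] by blast
    ultimately show ?thesis
      using False by (auto simp: machine_def Let_def d_def)
  qed
  show ?thesis
    unfolding tm_def using table assms(1)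
    by (auto simp: S_def machine_def simp del: Un_insert_left)
qed

lemma step_machine:
  assumes "d \<in> conts c" "width c \<le> k"
  shows "d \<noteq> Skip \<Longrightarrow> step (machine k c) (code c d, map s [0..<k]) =
      (code c (fst (small_step (d, s))), map (snd (small_step (d, s))) [0..<k])"
    and "k \<ge> 2 \<Longrightarrow> fst (step (machine k c) (code c Skip, map s [0..<k])) =
      (if scan (s 1) = Work 0 then 0 else 1)"
proof -
  have inv: "inv_into (conts c) (code c) (code c d) = d" if "d \<in> conts c" for d
    using that by (simp add: inj_code)
  have acc: "accept (machine k c) = 1" "reject (machine k c) = 0" by (simp_all add: machine_def)
  have ge: "\<not> code c d < 2" "code c d \<noteq> 1" "code c d \<noteq> 0" "code c d \<noteq> Suc 0" for d
    by (auto simp: code_def)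
  let ?ss = "\<lambda>i. map scan (map s [0..<k]) ! i"
  have "width d \<le> k" using conts_bounds[OF assms(1)] assms(2) by auto
  note loc = advance_local[OF this, of ?ss "\<lambda>i. scan (s i)"]
  have map2: "map2 act (map f [0..<k]) (map s [0..<k]) = map (\<lambda>i. act (f i) (s i)) [0..<k]" for f
    by (rule nth_equalityI) auto
  have 1: "fst (advance d ?ss) = fst (advance d (\<lambda>i. scan (s i)))"
    by (rule loc) simp
  have 2: "map (snd (advance d ?ss)) [0..<k] = map (snd (advance d (\<lambda>i. scan (s i)))) [0..<k]"
    by (rule map_cong) (auto intro!: loc simp del: map_map)
  show "step (machine k c) (code c d, map s [0..<k]) =
      (code c (fst (small_step (d, s))), map (snd (small_step (d, s))) [0..<k])" if "d \<noteq> Skip"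
    using that 1 2 map2
    by (simp add: machine_def small_step_def ge inv[OF assms(1)] Let_def del: map_map)
  show "fst (step (machine k c) (code c Skip, map s [0..<k])) =
      (if scan (s 1) = Work 0 then 0 else 1)" if "k \<ge> 2"
    using that by (simp add: machine_def ge inv Let_def)
qed

lemma machine_runs:
  assumes "runs c s t" "width c \<le> k" "k \<ge> 2"
  shows "\<exists>n. fst ((step (machine k c) ^^ n) (code c c, map s [0..<k])) =
      (if scan (t 1) = Work 0 then 0 else 1)"
proof -
  have "(small_step ^^ n) (d, s) = (Skip, t) \<Longrightarrow> d \<in> conts c \<Longrightarrow>
     \<exists>n. fst ((step (machine k c) ^^ n) (code c d, map s [0..<k])) =
      (if scan (t 1) = Work 0 then 0 else 1)" for n d
  proof (induction n arbitrary: d s)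
    case 0
    then show ?case using step_machine(2)[OF 0(2) assms(2,3), of s]
      by (intro exI[of _ 1]) (auto simp del: step.simps)
  next
    case (Suc n)
    show ?case
    proof (cases "d = Skip")
      case True
      with Suc.prems have "s = t" by (simp del: funpow.simps)
      with True show ?thesis using step_machine(2)[OF Suc.prems(2) assms(2,3), of s]
        by (intro exI[of _ 1]) (auto simp del: step.simps)
    next
      case False
      have "(small_step ^^ n) (fst (small_step (d, s)), snd (small_step (d, s))) = (Skip, t)"
        using Suc.prems(1) by (simp add: funpow_swap1)
      moreover have "fst (small_step (d, s)) \<in> conts c"
        using conts_closed[OF Suc.prems(2)] by (simp add: small_step_def)
      ultimately obtain n' where
        "fst ((step (machine k c) ^^ n') (code c (fst (small_step (d, s))), map (snd (small_step (d, s))) [0..<k]))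
          = (if scan (t 1) = Work 0 then 0 else 1)"
        using Suc.IH by blast
      then show ?thesis
        using step_machine(1)[OF Suc.prems(2) assms(2) False, of s]
        by (intro exI[of _ "Suc n'"]) (simp add: funpow_swap1)
    qed
  qed
  then show ?thesis using assms(1) unfolding runs_def by auto
qed


section \<open>Registers\<close>

text \<open>
  The number \<open>n\<close> is the head position on a tape that is blank except for a marker at the origin. Then
  increment and decrement are moves of the head, and a number is zero if the marker is scanned.
\<close>

definition num :: "nat \<Rightarrow> 'a tape" where
  "num n = ((\<lambda>p. if p = 0 then Work 0 else Blank), int n)"

definition exec :: "'a prog \<Rightarrow> (nat \<Rightarrow> nat) \<Rightarrow> (nat \<Rightarrow> nat) \<Rightarrow> bool" where
  "exec c \<sigma> \<tau> \<longleftrightarrow> runs c (\<lambda>i. num (\<sigma> i)) (\<lambda>i. num (\<tau> i))"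

lemma scan_num [simp]: "scan (num n) = Work 0 \<longleftrightarrow> n = 0"
  by (simp add: num_def)

lemma exec_Skip: "exec Skip \<sigma> \<sigma>"
  by (simp add: exec_def runs_Skip)

lemma exec_Inc: "exec (Move r Right) \<sigma> (\<sigma>(r := Suc (\<sigma> r)))"
proof -
  have "(\<lambda>i. num (\<sigma> i))(r := (fst (num (\<sigma> r)), shift Right (snd (num (\<sigma> r))))) =
      (\<lambda>i. num ((\<sigma>(r := Suc (\<sigma> r))) i))"
    by (auto simp: num_def)
  from runs_Move[of r Right "\<lambda>i. num (\<sigma> i)", unfolded this] show ?thesis unfolding exec_def .
qed

lemma exec_Dec: "\<sigma> r \<noteq> 0 \<Longrightarrow> exec (Move r Left) \<sigma> (\<sigma>(r := \<sigma> r - 1))"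
proof -
  assume "\<sigma> r \<noteq> 0"
  then have "(\<lambda>i. num (\<sigma> i))(r := (fst (num (\<sigma> r)), shift Left (snd (num (\<sigma> r))))) =
      (\<lambda>i. num ((\<sigma>(r := \<sigma> r - 1)) i))"
    by (auto simp: num_def)
  from runs_Move[of r Left "\<lambda>i. num (\<sigma> i)", unfolded this] show ?thesis unfolding exec_def .
qed

lemma exec_Seq: "exec c \<sigma> \<tau> \<Longrightarrow> exec d \<tau> \<upsilon> \<Longrightarrow> exec (Seq c d) \<sigma> \<upsilon>"
  unfolding exec_def by (rule runs_Seq)

lemma exec_Branch:
  "(\<sigma> r = 0 \<Longrightarrow> exec c \<sigma> \<tau>) \<Longrightarrow> (\<sigma> r \<noteq> 0 \<Longrightarrow> exec d \<sigma> \<tau>) \<Longrightarrow> exec (Branch r (Work 0) c d) \<sigma> \<tau>"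
  unfolding exec_def by (rule runs_Branch) auto

lemma exec_loop_stop: "\<sigma> r = 0 \<Longrightarrow> exec (Until r (Work 0) c) \<sigma> \<sigma>"
  unfolding exec_def by (rule runs_Until_stop) auto

lemma exec_loop_step:
  "\<sigma> r \<noteq> 0 \<Longrightarrow> exec c \<sigma> \<tau> \<Longrightarrow> exec (Until r (Work 0) c) \<tau> \<upsilon> \<Longrightarrow> exec (Until r (Work 0) c) \<sigma> \<upsilon>"
  unfolding exec_def by (rule runs_Until_step) auto

lemma exec_rename:
  assumes "inj r" "exec c \<sigma> \<tau>" "\<sigma>' \<circ> r = \<sigma>" "\<tau>' \<circ> r = \<tau>" "\<And>j. j \<notin> range r \<Longrightarrow> \<tau>' j = \<sigma>' j"
  shows "exec (rename r c) \<sigma>' \<tau>'"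
  unfolding exec_def
  by (rule runs_rename[OF assms(1) assms(2)[unfolded exec_def]])
     (use assms(3-5) in \<open>auto simp: comp_def fun_eq_iff\<close>)

definition transfer :: "nat \<Rightarrow> nat \<Rightarrow> 'a prog" where
  "transfer r q = Until r (Work 0) (Seq (Move r Left) (Move q Right))"

definition transfer2 :: "nat \<Rightarrow> nat \<Rightarrow> nat \<Rightarrow> 'a prog" where
  "transfer2 r p q = Until r (Work 0) (Seq (Move r Left) (Seq (Move p Right) (Move q Right)))"

definition clear :: "nat \<Rightarrow> 'a prog" where
  "clear r = Until r (Work 0) (Move r Left)"

lemma exec_to: "exec c \<sigma> \<tau> \<Longrightarrow> \<tau> = \<tau>' \<Longrightarrow> exec c \<sigma> \<tau>'"
  by simp

lemma exec_eq: "exec c \<sigma> \<tau> \<Longrightarrow> \<sigma> = \<sigma>' \<Longrightarrow> \<tau> = \<tau>' \<Longrightarrow> exec c \<sigma>' \<tau>'"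
  by simp

lemma exec_transfer:
  assumes "r \<noteq> q"
  shows "exec (transfer r q :: 'a prog) \<sigma> (\<sigma>(r := 0, q := \<sigma> q + \<sigma> r))"
proof (induction "\<sigma> r" arbitrary: \<sigma>)
  case 0
  then show ?case unfolding transfer_def
    by (intro exec_to[OF exec_loop_stop]) auto
next
  case (Suc n)
  let ?\<tau> = "\<sigma>(r := n, q := Suc (\<sigma> q))"
  have "exec (transfer r q :: 'a prog) ?\<tau> (?\<tau>(r := 0, q := ?\<tau> q + ?\<tau> r))"
    by (rule Suc.hyps(1)) (use assms in simp)
  then have 1: "exec (transfer r q :: 'a prog) ?\<tau> (\<sigma>(r := 0, q := \<sigma> q + \<sigma> r))"
    by (rule exec_eq) (use assms Suc.hyps(2) in auto)
  have 2: "exec (Seq (Move r Left) (Move q Right) :: 'a prog) \<sigma> ?\<tau>"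
    by (rule exec_Seq[OF exec_Dec exec_to[OF exec_Inc]])
       (use assms Suc.hyps(2)[symmetric] in \<open>auto simp: fun_eq_iff\<close>)
  show ?case using exec_loop_step[OF _ 2 1[unfolded transfer_def]] Suc.hyps(2)
    by (simp add: transfer_def)
qed

lemma exec_transfer2:
  assumes "r \<noteq> p" "r \<noteq> q" "p \<noteq> q"
  shows "exec (transfer2 r p q :: 'a prog) \<sigma> (\<sigma>(r := 0, p := \<sigma> p + \<sigma> r, q := \<sigma> q + \<sigma> r))"
proof (induction "\<sigma> r" arbitrary: \<sigma>)
  case 0
  then show ?case unfolding transfer2_def
    by (intro exec_to[OF exec_loop_stop]) auto
next
  case (Suc n)
  let ?\<tau> = "\<sigma>(r := n, p := Suc (\<sigma> p), q := Suc (\<sigma> q))"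
  have "exec (transfer2 r p q :: 'a prog) ?\<tau> (?\<tau>(r := 0, p := ?\<tau> p + ?\<tau> r, q := ?\<tau> q + ?\<tau> r))"
    by (rule Suc.hyps(1)) (use assms in simp)
  then have 1: "exec (transfer2 r p q :: 'a prog) ?\<tau> (\<sigma>(r := 0, p := \<sigma> p + \<sigma> r, q := \<sigma> q + \<sigma> r))"
    by (rule exec_eq) (use assms Suc.hyps(2) in auto)
  have 2: "exec (Seq (Move r Left) (Seq (Move p Right) (Move q Right)) :: 'a prog) \<sigma> ?\<tau>"
    by (rule exec_Seq[OF exec_Dec exec_Seq[OF exec_Inc exec_to[OF exec_Inc]]])
       (use assms Suc.hyps(2)[symmetric] in \<open>auto simp: fun_eq_iff\<close>)
  show ?case using exec_loop_step[OF _ 2 1[unfolded transfer2_def]] Suc.hyps(2)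
    by (simp add: transfer2_def)
qed

lemma exec_clear: "exec (clear r :: 'a prog) \<sigma> (\<sigma>(r := 0))"
proof (induction "\<sigma> r" arbitrary: \<sigma>)
  case 0
  then show ?case unfolding clear_def
    by (intro exec_to[OF exec_loop_stop]) auto
next
  case (Suc n)
  have "exec (clear r :: 'a prog) (\<sigma>(r := n)) ((\<sigma>(r := n))(r := 0))"
    by (rule Suc.hyps(1)) simp
  moreover have "exec (Move r Left :: 'a prog) \<sigma> (\<sigma>(r := n))"
    by (rule exec_to[OF exec_Dec]) (use Suc.hyps(2)[symmetric] in auto)
  ultimately show ?case using exec_loop_step[of \<sigma> r "Move r Left"] Suc.hyps(2)
    by (simp add: clear_def)
qed


subsection \<open>Realizable functions\<close>

abbreviation zeros :: "nat \<Rightarrow> nat" where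
  "zeros \<equiv> (\<lambda>_. 0)"

text \<open>
  All registers but the first are zero before and after the computation. So the empty registers
  are free for auxiliary results, and programs for two functions can be run one after the other.
\<close>

definition realizable :: "(nat \<Rightarrow> nat) \<Rightarrow> bool" where
  "realizable f \<longleftrightarrow> (\<exists>c :: letter prog. \<forall>x. exec c (zeros(0 := x)) (zeros(0 := f x)))"

lemma realizable_id: "realizable (\<lambda>x. x)"
  unfolding realizable_def by (rule exI[of _ Skip]) (simp add: exec_Skip)

lemma realizable_comp:
  assumes "realizable f" "realizable g"
  shows "realizable (\<lambda>x. f (g x))"
  using assms unfolding realizable_def by (meson exec_Seq)

lemma realizable_Suc: "realizable Suc"
  unfolding realizable_def
  by (intro exI[of _ "Move 0 Right"] allI exec_to[OF exec_Inc]) auto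

lemma realizable_const: "realizable (\<lambda>x. n)"
proof (induction n)
  case 0
  show ?case unfolding realizable_def
    by (intro exI[of _ "clear 0"] allI exec_to[OF exec_clear]) auto
next
  case (Suc n)
  show ?case by (rule realizable_comp[OF realizable_Suc Suc])
qed

text \<open>
  The successor in the enumeration of pairs along the diagonals, which the program for the inverse
  of the pairing function steps through.
\<close>

lemma Suc_prod_encode:
  "Suc (prod_encode (a, 0)) = prod_encode (0, Suc a)"
  "Suc (prod_encode (a, Suc b)) = prod_encode (Suc a, b)"
  by (simp_all add: prod_encode_def)

definition unpair_prog :: "'a prog" where
  "unpair_prog = Until 0 (Work 0) (Seq (Move 0 Left)
     (Branch 2 (Work 0) (Seq (transfer 1 2) (Move 2 Right)) (Seq (Move 2 Left) (Move 1 Right))))"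

lemma exec_unpair:
  "exec unpair_prog (zeros(0 := n)) (zeros(1 := fst (prod_decode n), 2 := snd (prod_decode n)))"
proof -
  have "exec unpair_prog (zeros(0 := n, 1 := a, 2 := b))
      (zeros(1 := fst (prod_decode (prod_encode (a, b) + n)),
             2 := snd (prod_decode (prod_encode (a, b) + n))))" for a b
  proof (induction n arbitrary: a b)
    case 0
    show ?case unfolding unpair_prog_def
      by (intro exec_to[OF exec_loop_stop]) auto
  next
    case (Suc n)
    show ?case
    proof (cases b)
      case 0
      have "exec (Seq (Move 0 Left) (Branch 2 (Work 0) (Seq (transfer 1 2) (Move 2 Right))
           (Seq (Move 2 Left) (Move 1 Right))))
          (zeros(0 := Suc n, 1 := a, 2 := b)) (zeros(0 := n, 1 := 0, 2 := Suc a))"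
        by (rule exec_Seq[OF exec_Dec exec_Branch[OF exec_Seq[OF exec_transfer exec_to[OF exec_Inc]]]])
           (use 0 in \<open>auto simp: fun_eq_iff\<close>)
      then show ?thesis unfolding unpair_prog_def
        by (rule exec_eq[OF exec_loop_step[OF _ _ Suc.IH[unfolded unpair_prog_def]], rotated])
           (use Suc_prod_encode(1)[of a, symmetric] 0 in \<open>auto simp: fun_eq_iff\<close>)
    next
      case (Suc b')
      have "exec (Seq (Move 0 Left) (Branch 2 (Work 0) (Seq (transfer 1 2) (Move 2 Right))
           (Seq (Move 2 Left) (Move 1 Right))))
          (zeros(0 := Suc n, 1 := a, 2 := b)) (zeros(0 := n, 1 := Suc a, 2 := b'))"
        by (rule exec_Seq[OF exec_Dec exec_Branch[OF _ exec_Seq[OF exec_Dec exec_to[OF exec_Inc]]]])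
           (use Suc in \<open>auto simp: fun_eq_iff\<close>)
      then show ?thesis unfolding unpair_prog_def
        by (rule exec_eq[OF exec_loop_step[OF _ _ Suc.IH[unfolded unpair_prog_def]], rotated])
           (use Suc_prod_encode(2)[of a b', symmetric] Suc in \<open>auto simp: fun_eq_iff\<close>)
    qed
  qed
  from this[of 0 0] show ?thesis
    by (rule exec_eq) (auto simp: prod_encode_def fun_eq_iff)
qed

text \<open>
  Adds the triangular number of register 3 to register 0. The code of \<open>(a, b)\<close> is \<open>a\<close> plus the triangular number
  of \<open>a + b\<close>.
\<close>

definition triangle_prog :: "'a prog" where
  "triangle_prog = Until 3 (Work 0) (Seq (transfer2 3 0 4) (Seq (Move 4 Left) (transfer 4 3)))"

lemma exec_triangle: "exec triangle_prog (zeros(0 := x, 3 := n)) (zeros(0 := x + triangle n))"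
proof (induction n arbitrary: x)
  case 0
  show ?case unfolding triangle_prog_def
    by (intro exec_to[OF exec_loop_stop]) auto
next
  case (Suc n)
  have "exec (Seq (transfer2 3 0 4) (Seq (Move 4 Left) (transfer 4 3)))
      (zeros(0 := x, 3 := Suc n)) (zeros(0 := x + Suc n, 3 := n))"
    by (rule exec_Seq[OF exec_transfer2 exec_Seq[OF exec_Dec exec_to[OF exec_transfer]]])
       (auto simp: fun_eq_iff)
  then show ?case unfolding triangle_prog_def
    by (rule exec_eq[OF exec_loop_step[OF _ _ Suc[unfolded triangle_prog_def]], rotated])
       (auto simp: fun_eq_iff)
qed

definition pair_prog :: "'a prog" where
  "pair_prog = Seq (transfer2 1 0 3) (Seq (transfer 2 3) triangle_prog)"

lemma exec_pair: "exec pair_prog (zeros(1 := a, 2 := b)) (zeros(0 := prod_encode (a, b)))"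
  unfolding pair_prog_def
  by (rule exec_Seq[OF exec_transfer2 exec_Seq[OF exec_transfer exec_eq[OF exec_triangle[of a "a + b"]]]])
     (auto simp: fun_eq_iff prod_encode_def)

lemma realizable_fst: "realizable (\<lambda>x. fst (prod_decode x))"
  unfolding realizable_def
  by (intro exI[of _ "Seq unpair_prog (Seq (clear 2) (transfer 1 0))"] allI
        exec_Seq[OF exec_unpair exec_Seq[OF exec_clear exec_to[OF exec_transfer]]])
     (auto simp: fun_eq_iff)

lemma realizable_snd: "realizable (\<lambda>x. snd (prod_decode x))"
  unfolding realizable_def
  by (intro exI[of _ "Seq unpair_prog (Seq (clear 1) (transfer 2 0))"] allI
        exec_Seq[OF exec_unpair exec_Seq[OF exec_clear exec_to[OF exec_transfer]]])
     (auto simp: fun_eq_iff)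

text \<open>
  The renaming under which a subroutine finds its argument in register \<open>r\<close>, which is 1 or 2, and its
  auxiliary registers from 3 on.
\<close>

definition relocate :: "nat \<Rightarrow> nat \<Rightarrow> nat" where
  "relocate r = (\<lambda>i. if i = 0 then r else i + 2)"

lemma exec_relocate:
  assumes "exec c (zeros(0 := x)) (zeros(0 := y))" "r = 1 \<or> r = 2" "\<sigma> r = x" "\<And>i. i \<ge> 3 \<Longrightarrow> \<sigma> i = 0"
  shows "exec (rename (relocate r) c) \<sigma> (\<sigma>(r := y))"
proof (rule exec_rename[OF _ assms(1)])
  show "inj (relocate r)" using assms(2) by (auto simp: relocate_def inj_def)
  show "\<sigma> \<circ> relocate r = zeros(0 := x)" "(\<sigma>(r := y)) \<circ> relocate r = zeros(0 := y)"
    using assms(2-4) by (auto simp: relocate_def fun_eq_iff)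
  fix j assume "j \<notin> range (relocate r)"
  then have "j \<noteq> relocate r 0" by blast
  then show "(\<sigma>(r := y)) j = \<sigma> j" by (auto simp: relocate_def)
qed

lemma realizable_pair:
  assumes "realizable f" "realizable g"
  shows "realizable (\<lambda>x. prod_encode (f x, g x))"
proof -
  obtain c d :: "letter prog" where
    c: "\<And>x. exec c (zeros(0 := x)) (zeros(0 := f x))" and
    d: "\<And>x. exec d (zeros(0 := x)) (zeros(0 := g x))"
    using assms unfolding realizable_def by blast
  have "exec (Seq (transfer2 0 1 2) (Seq (rename (relocate 1) c) (Seq (rename (relocate 2) d) pair_prog)))
      (zeros(0 := x)) (zeros(0 := prod_encode (f x, g x)))" for x
    by (rule exec_Seq[OF exec_transfer2 exec_Seq[OF exec_relocate[OF c[of x]]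
             exec_Seq[OF exec_relocate[OF d[of x]] exec_eq[OF exec_pair[of "f x" "g x"]]]]])
       (auto simp: fun_eq_iff)
  then show ?thesis unfolding realizable_def by blast
qed

text \<open>
  Iteration, with the number of rounds and the initial value given as a pair; together with pairing
  it yields primitive recursion.
\<close>

lemma realizable_iterate:
  assumes "realizable f"
  shows "realizable (\<lambda>x. (f ^^ fst (prod_decode x)) (snd (prod_decode x)))"
proof -
  obtain c :: "letter prog" where c: "\<And>x. exec c (zeros(0 := x)) (zeros(0 := f x))"
    using assms unfolding realizable_def by blast
  have loop: "exec (Until 1 (Work 0) (Seq (Move 1 Left) (rename (relocate 2) c)))
      (zeros(1 := n, 2 := x)) (zeros(2 := (f ^^ n) x))" for n x
  proof (induction n arbitrary: x)
    case 0
    show ?case by (intro exec_to[OF exec_loop_stop]) auto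
  next
    case (Suc n)
    have "exec (Seq (Move 1 Left) (rename (relocate 2) c))
        (zeros(1 := Suc n, 2 := x)) (zeros(1 := n, 2 := f x))"
      by (rule exec_Seq[OF exec_Dec exec_to[OF exec_relocate[OF c[of x]]]]) (auto simp: fun_eq_iff)
    then show ?case
      by (rule exec_eq[OF exec_loop_step[OF _ _ Suc], rotated])
         (auto simp: fun_eq_iff funpow_swap1)
  qed
  have "exec (Seq unpair_prog (Seq (Until 1 (Work 0) (Seq (Move 1 Left) (rename (relocate 2) c)))
        (transfer 2 0)))
      (zeros(0 := x)) (zeros(0 := (f ^^ fst (prod_decode x)) (snd (prod_decode x))))" for x
    by (rule exec_Seq[OF exec_unpair exec_Seq[OF loop exec_to[OF exec_transfer]]])
       (auto simp: fun_eq_iff)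
  then show ?thesis unfolding realizable_def by blast
qed


section \<open>Computable functions on encoded data\<close>

text \<open>
  The encodings have to be concrete: for an arbitrary numbering of a type, not even the projections
  of a pair need be computable on the codes.
\<close>

class enc =
  fixes enc :: "'a \<Rightarrow> nat"
  assumes enc_inject: "enc x = enc y \<Longrightarrow> x = y"

instantiation nat :: enc
begin
definition enc_nat :: "nat \<Rightarrow> nat" where "enc_nat n = n"
instance by standard (simp add: enc_nat_def)
end

instantiation bool :: enc
begin
definition enc_bool :: "bool \<Rightarrow> nat" where "enc_bool b = of_bool b"
instance by standard (auto simp: enc_bool_def of_bool_def split: if_splits)
end

instantiation prod :: (enc, enc) enc
begin
definition enc_prod :: "'a \<times> 'b \<Rightarrow> nat" where
  "enc_prod p = prod_encode (enc (fst p), enc (snd p))"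
instance by standard (auto simp: enc_prod_def intro: prod_eqI enc_inject)
end

instantiation list :: (enc) enc
begin
definition enc_list :: "'a list \<Rightarrow> nat" where "enc_list xs = list_encode (map enc xs)"
instance
proof
  fix xs ys :: "'a list"
  have "inj (enc :: 'a \<Rightarrow> nat)" by (auto intro: injI enc_inject)
  moreover assume "enc xs = enc ys"
  ultimately show "xs = ys" by (simp add: enc_list_def inj_map_eq_map list_encode_eq)
qed
end

instantiation letter :: enc
begin
definition enc_letter :: "letter \<Rightarrow> nat" where
  "enc_letter a = (case a of Letter_X \<Rightarrow> 0 | Stroke \<Rightarrow> 1 | Letter_0 \<Rightarrow> 2 | Sym_plus \<Rightarrow> 3 |
     Sym_minus \<Rightarrow> 4 | Sym_join \<Rightarrow> 5 | Sym_meet \<Rightarrow> 6 | Separator \<Rightarrow> 7)"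
instance by standard (auto simp: enc_letter_def split: letter.splits)
end

lemma enc_Nil [simp]: "enc [] = 0"
  by (simp add: enc_list_def)

lemma enc_Cons [simp]: "enc (x # xs) = Suc (prod_encode (enc x, enc xs))"
  by (simp add: enc_list_def)

text \<open>
  The code of a list is thus a computable bound for the number of steps of a loop through the list.
\<close>

lemma length_le_enc: "length xs \<le> enc xs"
  by (induction xs) (auto intro: order.trans le_prod_encode_2)

definition computable :: "('a::enc \<Rightarrow> 'b::enc) \<Rightarrow> bool" where
  "computable f \<longleftrightarrow> (\<exists>g. realizable g \<and> (\<forall>x. g (enc x) = enc (f x)))"

named_theorems computable_intros

lemma computable_id [computable_intros]: "computable (\<lambda>x. x)"
  unfolding computable_def using realizable_id by blast

lemma computable_const [computable_intros]: "computable (\<lambda>x. c)"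
  unfolding computable_def using realizable_const by blast

lemma computable_comp: "computable f \<Longrightarrow> computable g \<Longrightarrow> computable (\<lambda>x. f (g x))"
  unfolding computable_def using realizable_comp by metis

lemma computable_Pair [computable_intros]:
  assumes "computable f" "computable g"
  shows "computable (\<lambda>x. (f x, g x))"
proof -
  obtain f' g' where "realizable f'" "\<And>x. f' (enc x) = enc (f x)"
    "realizable g'" "\<And>x. g' (enc x) = enc (g x)"
    using assms unfolding computable_def by blast
  then show ?thesis unfolding computable_def
    by (intro exI[of _ "\<lambda>x. prod_encode (f' x, g' x)"]) (simp add: realizable_pair enc_prod_def)
qed

lemma computable_nat: "computable (f :: nat \<Rightarrow> nat) \<longleftrightarrow> realizable f"
proof
  assume "computable f"
  then obtain g where "realizable g" "\<And>x. g x = f x"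
    unfolding computable_def enc_nat_def by blast
  then show "realizable f" by (metis ext)
qed (auto simp: computable_def enc_nat_def)

text \<open>
  A function is computable if an arithmetical function imitates it on the codes.
\<close>

lemma computable_via:
  assumes "computable (G :: nat \<Rightarrow> nat)" "\<And>y. G (enc y) = enc (F y)" "computable f"
  shows "computable (\<lambda>x. F (f x))"
proof (rule computable_comp[OF _ assms(3)])
  show "computable F"
    using assms(1,2) unfolding computable_nat computable_def by blast
qed

lemma computable_fst [computable_intros]: "computable f \<Longrightarrow> computable (\<lambda>x. fst (f x))"
  by (rule computable_via[of "\<lambda>n. fst (prod_decode n)" fst])
     (auto simp: computable_nat realizable_fst enc_prod_def)

lemma computable_snd [computable_intros]: "computable f \<Longrightarrow> computable (\<lambda>x. snd (f x))"
  by (rule computable_via[of "\<lambda>n. snd (prod_decode n)" snd])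
     (auto simp: computable_nat realizable_snd enc_prod_def)

lemma computable_prod_decode [computable_intros]:
  "computable f \<Longrightarrow> computable (\<lambda>x. prod_decode (f x))"
  by (rule computable_via[of "\<lambda>n. n"])
     (auto simp: computable_nat realizable_id enc_prod_def enc_nat_def)

lemma computable_Suc [computable_intros]: "computable f \<Longrightarrow> computable (\<lambda>x. Suc (f x))"
  by (rule computable_via[of Suc]) (auto simp: computable_nat realizable_Suc enc_nat_def)

lemma computable_enc [computable_intros]: "computable f \<Longrightarrow> computable (\<lambda>x. enc (f x))"
  by (rule computable_via[of "\<lambda>n. n"]) (auto simp: computable_nat realizable_id enc_nat_def)

lemma computable_iterate:
  fixes F :: "'b::enc \<Rightarrow> 'b"
  assumes "computable n" "computable F" "computable i"
  shows "computable (\<lambda>x. (F ^^ n x) (i x))"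
proof -
  obtain g where g: "realizable g" "\<And>x. g (enc x) = enc (F x)"
    using assms(2) unfolding computable_def by blast
  have iter: "(g ^^ k) (enc x) = enc ((F ^^ k) x)" for k x
    by (induction k) (auto simp: g)
  obtain h where h: "realizable h" "\<And>x. h (enc x) = enc (n x, i x)"
    using computable_Pair[OF assms(1,3)] unfolding computable_def by blast
  show ?thesis unfolding computable_def
    by (rule exI[of _ "\<lambda>x. (g ^^ fst (prod_decode (h x))) (snd (prod_decode (h x)))"])
       (simp add: h realizable_comp[OF realizable_iterate[OF g(1)] h(1)] enc_prod_def enc_nat_def iter)
qed

text \<open>
  The iterated function may depend on the argument, since the argument can be carried along in the
  state.
\<close>

lemma computable_funpow [computable_intros]:
  fixes F :: "'a::enc \<Rightarrow> 'b::enc \<Rightarrow> 'b"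
  assumes "computable n" "computable (\<lambda>p. F (fst p) (snd p))" "computable i"
  shows "computable (\<lambda>x. (F x ^^ n x) (i x))"
proof -
  define G where "G = (\<lambda>p. (fst p, F (fst p) (snd p)))"
  have "computable G" unfolding G_def by (intro computable_intros assms(2))
  then have "computable (\<lambda>x. snd ((G ^^ n x) (x, i x)))"
    by (intro computable_intros computable_iterate assms(1,3))
  moreover have "(G ^^ k) (x, s) = (x, (F x ^^ k) s)" for k x s
    by (induction k) (auto simp: G_def)
  ultimately show ?thesis by simp
qed

lemma computable_pred [computable_intros]:
  assumes "computable f"
  shows "computable (\<lambda>x. f x - Suc 0)"
proof -
  have "((\<lambda>p :: nat \<times> nat. (snd p, Suc (snd p))) ^^ n) (0, 0) = (n - Suc 0, n)" for n
    by (induction n) auto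
  moreover have "computable (\<lambda>x. fst (((\<lambda>p. (snd p, Suc (snd p))) ^^ f x) (0::nat, 0::nat)))"
    by (intro computable_intros assms)
  ultimately show ?thesis by simp
qed

lemma computable_add [computable_intros]:
  fixes f g :: "_ \<Rightarrow> nat"
  assumes "computable f" "computable g"
  shows "computable (\<lambda>x. f x + g x)"
proof -
  have "(Suc ^^ n) m = m + n" for n m by (induction n) auto
  moreover have "computable (\<lambda>x. ((\<lambda>y. Suc y) ^^ g x) (f x))"
    by (intro computable_intros assms)
  ultimately show ?thesis by (simp add: add.commute)
qed

lemma computable_mult [computable_intros]:
  fixes f g :: "_ \<Rightarrow> nat"
  assumes "computable f" "computable g"
  shows "computable (\<lambda>x. f x * g x)"
proof -
  have "((\<lambda>y. m + y) ^^ n) 0 = m * n" for n m :: nat by (induction n) auto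
  moreover have "computable (\<lambda>x. ((\<lambda>y. f x + y) ^^ g x) 0)"
    by (intro computable_intros assms computable_comp[OF assms(1)])
  ultimately show ?thesis by simp
qed

lemma computable_diff [computable_intros]:
  fixes f g :: "_ \<Rightarrow> nat"
  assumes "computable f" "computable g"
  shows "computable (\<lambda>x. f x - g x)"
proof -
  have "((\<lambda>y. y - Suc 0) ^^ n) m = m - n" for n m :: nat by (induction n) auto
  moreover have "computable (\<lambda>x. ((\<lambda>y. y - Suc 0) ^^ g x) (f x))"
    by (intro computable_intros assms)
  ultimately show ?thesis by simp
qed

lemma computable_of_bool: "computable (\<lambda>x. of_bool (P x) :: nat) \<longleftrightarrow> computable P"
  by (simp add: computable_def enc_nat_def enc_bool_def)

lemma computable_eq [computable_intros]:
  fixes f g :: "_ \<Rightarrow> 'a::enc"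
  assumes "computable f" "computable g"
  shows "computable (\<lambda>x. f x = g x)"
proof -
  have "of_bool (a = b) = 1 - ((enc a - enc b) + (enc b - enc a))" for a b :: 'a
  proof (cases "a = b")
    case False
    then have "enc a \<noteq> enc b" using enc_inject by blast
    then have "(enc a - enc b) + (enc b - enc a) \<ge> 1" by arith
    then show ?thesis using False by simp
  qed simp
  moreover have "computable (\<lambda>x. 1 - ((enc (f x) - enc (g x)) + (enc (g x) - enc (f x))))"
    by (intro computable_intros assms)
  ultimately show ?thesis by (subst computable_of_bool[symmetric]) simp
qed

lemma computable_le [computable_intros]:
  fixes f g :: "_ \<Rightarrow> nat"
  assumes "computable f" "computable g"
  shows "computable (\<lambda>x. f x \<le> g x)"
proof -
  have "computable (\<lambda>x. f x - g x = 0)" by (intro computable_intros assms)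
  then show ?thesis by simp
qed

lemma computable_if [computable_intros]:
  fixes f g :: "'a::enc \<Rightarrow> 'b::enc"
  assumes "computable P" "computable f" "computable g"
  shows "computable (\<lambda>x. if P x then f x else g x)"
proof -
  have "computable (\<lambda>x. fst (((\<lambda>p. (snd p, snd p)) ^^ of_bool (P x)) (g x, f x)))"
    by (intro computable_intros assms computable_of_bool[THEN iffD2])
  moreover have "fst (((\<lambda>p. (snd p, snd p)) ^^ of_bool b) (v, u)) = (if b then u else v)"
    for b and u v :: 'b by auto
  ultimately show ?thesis by simp
qed

lemma computable_conj [computable_intros]:
  assumes "computable P" "computable Q"
  shows "computable (\<lambda>x. P x \<and> Q x)"
proof -
  have "computable (\<lambda>x. if P x then Q x else False)" by (intro computable_intros assms)
  moreover have "(if a then b else False) = (a \<and> b)" for a b by simp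
  ultimately show ?thesis by (simp only:)
qed

lemma computable_not [computable_intros]:
  assumes "computable P"
  shows "computable (\<lambda>x. \<not> P x)"
proof -
  have "computable (\<lambda>x. if P x then False else True)" by (intro computable_intros assms)
  moreover have "(if a then False else True) = (\<not> a)" for a by simp
  ultimately show ?thesis by (simp only:)
qed

lemma computable_ball [computable_intros]:
  assumes "computable (\<lambda>p. P (fst p) (snd p))" "computable (n :: _ \<Rightarrow> nat)"
  shows "computable (\<lambda>x. \<forall>i<n x. P x i)"
proof -
  let ?F = "\<lambda>x s. (Suc (fst s), snd s \<and> P x (fst s))"
  have P: "computable (\<lambda>y. P (a y) (b y))" if "computable a" "computable b" for a :: "_ \<Rightarrow> 'a" and b
    using computable_comp[OF assms(1) computable_Pair[OF that]] by simp
  have "(?F x ^^ k) (0, True) = (k, \<forall>i<k. P x i)" for x k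
    by (induction k) (auto simp: less_Suc_eq)
  moreover have "computable (\<lambda>x. snd ((?F x ^^ n x) (0, True)))"
    by (intro computable_intros assms(2) P)
  ultimately show ?thesis by simp
qed

lemma computable_bex [computable_intros]:
  assumes "computable (\<lambda>p. P (fst p) (snd p))" "computable (n :: _ \<Rightarrow> nat)"
  shows "computable (\<lambda>x. \<exists>i<n x. P x i)"
proof -
  have "computable (\<lambda>x. \<not> (\<forall>i<n x. \<not> P x i))" by (intro computable_intros assms)
  then show ?thesis by simp
qed

lemma computable_Cons [computable_intros]:
  assumes "computable f" "computable g"
  shows "computable (\<lambda>x. f x # g x)"
proof -
  have "computable (\<lambda>x. case (f x, g x) of (y, ys) \<Rightarrow> y # ys)"
    by (rule computable_via[of Suc])
       (auto simp: computable_nat realizable_Suc enc_prod_def intro!: computable_intros assms)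
  then show ?thesis by simp
qed

lemma computable_hd [computable_intros]:
  assumes "computable f"
  shows "computable (\<lambda>x. hd (f x) :: 'a::enc)"
proof (rule computable_via[OF _ _ assms])
  \<comment> \<open>the head of the empty list is some value, and its code enters as a constant\<close>
  show "computable (\<lambda>n. if n = 0 then enc (hd [] :: 'a) else fst (prod_decode (n - Suc 0)))"
    by (intro computable_intros)
  show "(if enc ys = 0 then enc (hd [] :: 'a) else fst (prod_decode (enc ys - Suc 0))) = enc (hd ys)"
    for ys :: "'a list" by (cases ys) auto
qed

lemma computable_tl [computable_intros]:
  assumes "computable f"
  shows "computable (\<lambda>x. tl (f x) :: 'a::enc list)"
proof (rule computable_via[OF _ _ assms])
  show "computable (\<lambda>n. if n = 0 then 0 else snd (prod_decode (n - Suc 0)))"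
    by (intro computable_intros)
  show "(if enc ys = 0 then 0 else snd (prod_decode (enc ys - Suc 0))) = enc (tl ys)"
    for ys :: "'a list" by (cases ys) auto
qed

text \<open>
  The loop runs as often as the code of the list says, which is often enough; once the list is
  used up, nothing changes any more.
\<close>

lemma computable_fold [computable_intros]:
  assumes "computable (\<lambda>q. F (fst q) (fst (snd q)) (snd (snd q)))" "computable l" "computable i"
  shows "computable (\<lambda>x. fold (F x) (l x) (i x))"
proof -
  let ?G = "\<lambda>x s. if fst s = [] then s else (tl (fst s), F x (hd (fst s)) (snd s))"
  have F: "computable (\<lambda>y. F (a y) (b y) (c y))"
    if "computable a" "computable b" "computable c" for a :: "_ \<Rightarrow> 'a" and b c
    using computable_comp[OF assms(1) computable_Pair[OF that(1) computable_Pair[OF that(2,3)]]]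
    by simp
  have "length ys \<le> k \<Longrightarrow> (?G x ^^ k) (ys, s) = ([], fold (F x) ys s)" for x k ys s
  proof (induction k arbitrary: ys s)
    case (Suc k)
    show ?case
    proof (cases ys)
      case Nil
      have "(?G x ^^ j) ([], s) = ([], s)" for j by (induction j) auto
      from this[of "Suc k"] show ?thesis using Nil by simp
    qed (use Suc in \<open>simp add: funpow_Suc_right del: funpow.simps\<close>)
  qed auto
  then have "(?G x ^^ enc (l x)) (l x, i x) = ([], fold (F x) (l x) (i x))" for x
    using length_le_enc by blast
  moreover have "computable (\<lambda>x. snd ((?G x ^^ enc (l x)) (l x, i x)))"
    by (intro computable_intros assms(2,3) F)
  ultimately show ?thesis by simp
qed


section \<open>Computable sets of words are decidable\<close>

text \<open>
  The input is on tape 0, with the head on its \<open>j\<close>-th letter; register \<open>i\<close> is on tape \<open>i + 1\<close>, and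
  register 0 holds \<open>v\<close>.
\<close>

definition word_store :: "letter list \<Rightarrow> nat \<Rightarrow> nat \<Rightarrow> letter store" where
  "word_store w j v = (\<lambda>i. case i of 0 \<Rightarrow> (fst (input_tape w), int j) | Suc i \<Rightarrow> num ((zeros(0 := v)) i))"

lemma runs_register:
  assumes "\<And>x. exec c (zeros(0 := x)) (zeros(0 := f x))"
  shows "runs (rename Suc c) (word_store w j v) (word_store w j (f v))"
  by (rule runs_rename[OF _ assms[unfolded exec_def, of v]])
     (auto simp: word_store_def comp_def fun_eq_iff split: nat.splits)

primrec select :: "(letter \<Rightarrow> letter prog) \<Rightarrow> letter list \<Rightarrow> letter prog" where
  "select H [] = Skip"
| "select H (a # as) = Branch 0 (Input a) (H a) (select H as)"

lemma runs_select:
  assumes "scan (s 0) = Input a" "a \<in> set as" "runs (H a) s t"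
  shows "runs (select H as) s t"
  using assms(2) by (induction as) (use assms in \<open>auto intro!: runs_Branch\<close>)

text \<open>
  Writes the marker, so that tapes that are blank at the start represent zero.
\<close>

primrec mark :: "nat list \<Rightarrow> 'a prog \<Rightarrow> 'a prog" where
  "mark [] c = c"
| "mark (i # is) c = Seq (Write i (Work 0)) (mark is c)"

lemma width_mark: "width (mark is c) \<le> k \<longleftrightarrow> width c \<le> k \<and> (\<forall>i\<in>set is. i < k)"
  by (induction "is") auto

lemma runs_mark:
  assumes "runs c (\<lambda>i. if i \<in> set is then ((fst (s i))(snd (s i) := Work 0), snd (s i)) else s i) t"
  shows "runs (mark is c) s t"
  using assms
proof (induction "is" arbitrary: s)
  case (Cons j js)
  let ?s = "s(j := ((fst (s j))(snd (s j) := Work 0), snd (s j)))"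
  have eq: "(\<lambda>i. if i \<in> set js then ((fst (?s i))(snd (?s i) := Work 0), snd (?s i)) else ?s i) =
      (\<lambda>i. if i \<in> set (j # js) then ((fst (s i))(snd (s i) := Work 0), snd (s i)) else s i)"
    by (auto simp: fun_eq_iff)
  have "runs (mark js c) ?s t"
    by (rule Cons.IH) (unfold eq, rule Cons.prems)
  then show ?case using runs_Seq[OF runs_Write] by simp
qed simp

text \<open>
  The machine turns its input into the code of a list and then runs the program for \<open>P\<close>. Reading
  from left to right, it puts each letter in front of the previous ones, so what \<open>P\<close> is applied to is
  the reversed word.
\<close>

theorem turing_decidable_computable:
  fixes P :: "letter list \<Rightarrow> bool"
  assumes "computable P"
  shows "turing_decidable {w. P (rev w)}"
proof -
  obtain g where g: "realizable g" "\<And>w. g (enc w) = of_bool (P w)"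
    using assms unfolding computable_def enc_bool_def by blast
  obtain D :: "letter prog" where D: "\<And>x. exec D (zeros(0 := x)) (zeros(0 := g x))"
    using g(1) unfolding realizable_def by blast
  have "realizable (\<lambda>v. Suc (prod_encode (enc a, v)))" for a :: letter
    by (rule realizable_comp[OF realizable_Suc realizable_pair[OF realizable_const realizable_id]])
  then have "\<forall>a :: letter. \<exists>c :: letter prog. \<forall>x.
      exec c (zeros(0 := x)) (zeros(0 := Suc (prod_encode (enc a, x))))"
    unfolding realizable_def by blast
  then obtain H :: "letter \<Rightarrow> letter prog" where
    H: "\<And>a x. exec (H a) (zeros(0 := x)) (zeros(0 := Suc (prod_encode (enc a, x))))"
    by metis
  obtain as :: "letter list" where as: "set as = UNIV"
    using finite_list[OF finite_class.finite_UNIV] by blast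
  define body where "body = Seq (select (\<lambda>a. rename Suc (H a)) as) (Move 0 Right)"
  define c where "c = Seq (Until 0 Blank body) (rename Suc D)"
  define k where "k = max 2 (width c)"
  define M where "M = machine k (mark [1..<k] c)"
  have read: "runs (Until 0 Blank body) (word_store w 0 0)
      (word_store w (length w) (enc (rev w)))" for w
  proof -
    define S where "S = (\<lambda>j. word_store w j (enc (rev (take j w))))"
    have "runs (Until 0 Blank body) (S 0) (S (length w))"
    proof (rule runs_Until_iterate)
      show "scan (S (length w) 0) = Blank"
        by (simp add: S_def word_store_def input_tape_def)
      fix j assume j: "j < length w"
      have sc: "scan (S j 0) = Input (w ! j)"
        using j by (simp add: S_def word_store_def input_tape_def)
      have 1: "runs (select (\<lambda>a. rename Suc (H a)) as) (S j)
          (word_store w j (Suc (prod_encode (enc (w ! j), enc (rev (take j w))))))"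
        by (rule runs_select[where a = "w ! j"]) (use sc as in \<open>auto simp: S_def intro!: runs_register H\<close>)
      have "Suc (prod_encode (enc (w ! j), enc (rev (take j w)))) = enc (rev (take (Suc j) w))"
        using j by (simp add: take_Suc_conv_app_nth)
      with 1 have 1: "runs (select (\<lambda>a. rename Suc (H a)) as) (S j)
          (word_store w j (enc (rev (take (Suc j) w))))" by simp
      have "(word_store w j v)(0 := (fst (word_store w j v 0), shift Right (snd (word_store w j v 0))))
          = word_store w (Suc j) v" for v
        by (auto simp: word_store_def fun_eq_iff split: nat.splits)
      then have 2: "runs (Move 0 Right) (word_store w j v) (word_store w (Suc j) v)" for v
        using runs_Move[of 0 Right "word_store w j v"] by simp
      show "scan (S j 0) \<noteq> Blank \<and> runs body (S j) (S (Suc j))"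
        using sc runs_Seq[OF 1 2] by (simp add: body_def S_def)
    qed
    then show ?thesis by (simp add: S_def)
  qed
  have run: "reaches M w (if P (rev w) then accept M else reject M)" for w
  proof -
    \<comment> \<open>the tapes from \<open>k\<close> on are not part of the machine, so they may be taken to hold zeros already\<close>
    define s where "s = (\<lambda>i. if i = 0 then input_tape w else if i < k then (\<lambda>_. Blank, 0) else num 0)"
    have "runs c (word_store w 0 0) (word_store w (length w) (of_bool (P (rev w))))"
      using runs_Seq[OF read runs_register[OF D]] by (simp add: c_def g(2))
    moreover have "(\<lambda>i. if i \<in> set [1..<k] then ((fst (s i))(snd (s i) := Work 0), snd (s i)) else s i)
        = word_store w 0 0"
      by (auto simp: s_def word_store_def num_def fun_eq_iff input_tape_def split: nat.splits)
    ultimately have "runs (mark [1..<k] c) s (word_store w (length w) (of_bool (P (rev w))))"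
      by (intro runs_mark) simp
    from machine_runs[OF this, of k] obtain n where
      n: "fst ((step M ^^ n) (code (mark [1..<k] c) (mark [1..<k] c), map s [0..<k])) =
        (if P (rev w) then 1 else 0)"
      unfolding M_def by (cases "P (rev w)") (auto simp: width_mark k_def word_store_def)
    have "map s [0..<k] = input_tape w # replicate (k - 1) (\<lambda>_. Blank, 0)"
      by (rule nth_equalityI) (auto simp: s_def k_def nth_Cons split: nat.splits)
    then have "initial M w = (code (mark [1..<k] c) (mark [1..<k] c), map s [0..<k])"
      by (simp add: initial_def M_def machine_def)
    with n show ?thesis
      unfolding reaches_def by (auto simp: M_def machine_def)
  qed
  have "tm M"
    unfolding M_def by (rule tm_machine) (auto simp: width_mark k_def)
  moreover have "decides M {w. P (rev w)}"
    unfolding decides_def using run by (metis mem_Collect_eq)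
  ultimately show ?thesis unfolding turing_decidable_def by blast
qed


section \<open>Integer linear forms and specialization\<close>

definition lin :: "nat \<Rightarrow> (nat \<Rightarrow> int) \<Rightarrow> (nat \<Rightarrow> real) \<Rightarrow> real" where
  "lin k a z = (\<Sum>i<k. of_int (a i) * z i)"

definition bounded_form :: "nat \<Rightarrow> nat \<Rightarrow> (nat \<Rightarrow> int) \<Rightarrow> bool" where
  "bounded_form k C a \<longleftrightarrow> (\<forall>i<k. \<bar>a i\<bar> \<le> int C)"

text \<open>
  Geometrically, \<open>z'\<close> lies in the closure of the cell of \<open>z\<close> in the arrangement of the hyperplanes
  with coefficients bounded by \<open>C\<close>.
\<close>

definition specializes :: "nat \<Rightarrow> nat \<Rightarrow> (nat \<Rightarrow> real) \<Rightarrow> (nat \<Rightarrow> real) \<Rightarrow> bool" where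
  "specializes k C z z' \<longleftrightarrow> (\<forall>a. bounded_form k C a \<longrightarrow> lin k a z \<le> 0 \<longrightarrow> lin k a z' \<le> 0)"

lemma lin_Suc: "lin (Suc k) a z = lin k a z + of_int (a k) * z k"
  by (simp add: lin_def)

lemma lin_upd [simp]: "lin k a (z(k := x)) = lin k a z"
  by (auto simp: lin_def intro!: sum.cong)

lemma lin_cong: "(\<And>i. i < k \<Longrightarrow> a i = b i) \<Longrightarrow> (\<And>i. i < k \<Longrightarrow> z i = y i) \<Longrightarrow> lin k a z = lin k b y"
  by (auto simp: lin_def intro!: sum.cong)

lemma lin_combine:
  "lin k (\<lambda>i. p * a i + q * b i) z = of_int p * lin k a z + of_int q * lin k b z"
  by (simp add: lin_def sum.distrib sum_distrib_left algebra_simps)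

lemma lin_uminus: "lin k (\<lambda>i. - a i) z = - lin k a z"
  using lin_combine[of k "-1" a 0 a z] by simp

lemma specializes_ge:
  assumes "specializes k C z z'" "bounded_form k C a" "lin k a z \<ge> 0"
  shows "lin k a z' \<ge> 0"
  using assms(1)[unfolded specializes_def, rule_format, of "\<lambda>i. - a i"] assms(2,3)
  by (simp add: lin_uminus bounded_form_def)

lemma specializes_gt:
  assumes "specializes k C z z'" "bounded_form k C a" "lin k a z' > 0"
  shows "lin k a z > 0"
  using assms unfolding specializes_def by (meson not_le)

lemma specializes_mono: "specializes k D z z' \<Longrightarrow> C \<le> D \<Longrightarrow> specializes k C z z'"
  unfolding specializes_def bounded_form_def by (meson of_nat_mono order.trans)

lemma bounded_combine:
  assumes "bounded_form k C a" "bounded_form k C b" "\<bar>p\<bar> \<le> int C" "\<bar>q\<bar> \<le> int C"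
  shows "bounded_form k (2 * C * C) (\<lambda>i. p * a i + q * b i)"
  unfolding bounded_form_def
proof (intro allI impI)
  fix i assume "i < k"
  then have "\<bar>p * a i\<bar> \<le> int C * int C" "\<bar>q * b i\<bar> \<le> int C * int C"
    using assms by (auto simp: bounded_form_def abs_mult intro!: mult_mono)
  then show "\<bar>p * a i + q * b i\<bar> \<le> int (2 * C * C)" by auto
qed

text \<open>
  The values at which a form in \<open>k + 1\<close> variables with bounded coefficients can change its sign, as the
  last variable runs and the first \<open>k\<close> are given by \<open>z\<close>. The predicate selects the forms that bound
  the variable from one side.
\<close>

definition quotients ::
  "nat \<Rightarrow> nat \<Rightarrow> (nat \<Rightarrow> real) \<Rightarrow> ((nat \<Rightarrow> int) \<Rightarrow> nat \<Rightarrow> bool) \<Rightarrow> real set" where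
  "quotients k C z Q = {lin k a z / real b | a b. bounded_form k C a \<and> 1 \<le> b \<and> b \<le> C \<and> Q a b}"

lemma finite_quotients: "finite (quotients k C z Q)"
proof -
  let ?A = "PiE {..<k} (\<lambda>_. {- int C..int C}) \<times> {1..C}"
  have "quotients k C z Q \<subseteq> (\<lambda>(a, b). lin k a z / real b) ` ?A"
  proof
    fix q assume "q \<in> quotients k C z Q"
    then obtain a b where ab: "q = lin k a z / real b" "bounded_form k C a" "1 \<le> b" "b \<le> C"
      unfolding quotients_def by blast
    have "q = (\<lambda>(a, b). lin k a z / real b) (restrict a {..<k}, b)"
      using ab(1) lin_cong[of k "restrict a {..<k}" a z z] by simp
    moreover have "(restrict a {..<k}, b) \<in> ?A"
      using ab(2-4) by (auto simp: bounded_form_def abs_le_iff minus_le_iff)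
    ultimately show "q \<in> (\<lambda>(a, b). lin k a z / real b) ` ?A" by blast
  qed
  moreover have "finite ?A" by (intro finite_cartesian_product finite_PiE) auto
  ultimately show ?thesis by (rule finite_subset[OF _ finite_imageI])
qed


subsection \<open>Rational points of bounded height\<close>

text \<open>
  \<open>D\<close> is a common denominator of the coordinates, and it is bounded by \<open>M\<close> like the resulting
  numerators.
\<close>

definition height_le :: "nat \<Rightarrow> nat \<Rightarrow> nat \<Rightarrow> (nat \<Rightarrow> real) \<Rightarrow> bool" where
  "height_le D M k z \<longleftrightarrow>
     1 \<le> D \<and> D \<le> M \<and> (\<forall>i<k. \<exists>p::int. \<bar>p\<bar> \<le> int M \<and> real D * z i = of_int p)"

lemma height_le_lin:
  assumes "height_le D M k z" "bounded_form k C a"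
  shows "\<exists>p::int. \<bar>p\<bar> \<le> int (k * C * M) \<and> real D * lin k a z = of_int p"
  using assms
proof (induction k)
  case 0
  then show ?case by (simp add: lin_def)
next
  case (Suc k)
  then have "height_le D M k z" "bounded_form k C a"
    by (auto simp: height_le_def bounded_form_def)
  then obtain p :: int where p: "\<bar>p\<bar> \<le> int (k * C * M)" "real D * lin k a z = of_int p"
    using Suc.IH by blast
  obtain q :: int where q: "\<bar>q\<bar> \<le> int M" "real D * z k = of_int q"
    using Suc.prems(1) by (auto simp: height_le_def)
  have "\<bar>a k * q\<bar> \<le> int C * int M"
    unfolding abs_mult by (rule mult_mono) (use Suc.prems(2) q in \<open>auto simp: bounded_form_def\<close>)
  then have "\<bar>p + a k * q\<bar> \<le> int (Suc k * C * M)"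
    using p(1) by (simp add: algebra_simps)
  moreover have "real D * lin (Suc k) a z = of_int (p + a k * q)"
    using p(2) q(2) by (simp add: lin_Suc algebra_simps)
  ultimately show ?case by blast
qed

lemma height_le_extend:
  assumes "height_le D M k z" "1 \<le> E" "E \<le> N" "\<bar>p\<bar> \<le> int (N * M)" "real (E * D) * x = of_int p"
  shows "height_le (E * D) (N * M) (Suc k) (z(k := x))"
  unfolding height_le_def
proof (intro conjI allI impI)
  show "1 \<le> E * D" "E * D \<le> N * M"
    using assms(1-3) by (auto simp: height_le_def intro: mult_le_mono)
  fix i assume i: "i < Suc k"
  show "\<exists>q::int. \<bar>q\<bar> \<le> int (N * M) \<and> real (E * D) * (z(k := x)) i = of_int q"
  proof (cases "i = k")
    case True
    then show ?thesis using assms(4,5) by auto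
  next
    case False
    then have "i < k" using i by simp
    then obtain q :: int where q: "\<bar>q\<bar> \<le> int M" "real D * z i = of_int q"
      using assms(1) unfolding height_le_def by blast
    have "\<bar>int E * q\<bar> \<le> int N * int M"
      unfolding abs_mult by (rule mult_mono) (use assms(3) q in auto)
    moreover have "real (E * D) * z i = of_int (int E * q)"
      using q(2) by simp
    ultimately show ?thesis using False by (intro exI[of _ "int E * q"]) auto
  qed
qed

lemma height_le_mono: "height_le D M k z \<Longrightarrow> M \<le> M' \<Longrightarrow> height_le D M' k z"
  unfolding height_le_def by (meson of_nat_mono order.trans)

text \<open>
  The factor by which the height may grow with one more coordinate. It covers quotients, quotients
  shifted by one, and midpoints of two quotients.
\<close>

definition extension_height :: "nat \<Rightarrow> nat \<Rightarrow> nat" where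
  "extension_height k C = Suc k * (2 * C * C)"

lemma height_le_quotient:
  assumes z: "height_le D M k z" and ab: "bounded_form k C a" "1 \<le> b" "b \<le> C" and e: "\<bar>e\<bar> \<le> 1"
  shows "\<exists>D'. height_le D' (extension_height k C * M) (Suc k) (z(k := lin k a z / real b + of_int e))"
proof -
  obtain p :: int where p: "\<bar>p\<bar> \<le> int (k * C * M)" "real D * lin k a z = of_int p"
    using height_le_lin[OF z ab(1)] by blast
  have D: "D \<le> M" using z by (simp add: height_le_def)
  have "C \<ge> 1" using ab by simp
  then have "C \<le> C * C" by simp
  have N: "Suc k * C \<le> extension_height k C"
    unfolding extension_height_def using \<open>C \<le> C * C\<close> by (intro mult_le_mono) auto
  have "\<bar>int b * int D * e\<bar> \<le> int C * int M * 1"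
    unfolding abs_mult by (intro mult_mono) (use ab D e in auto)
  then have "\<bar>p + int b * int D * e\<bar> \<le> int (Suc k * C * M)"
    using p(1) by (simp add: algebra_simps)
  also have "\<dots> \<le> int (extension_height k C * M)"
    using N by (intro of_nat_mono mult_le_mono1)
  finally have "\<bar>p + int b * int D * e\<bar> \<le> int (extension_height k C * M)" .
  moreover have "b \<le> extension_height k C"
    using N ab by (metis le_add1 mult_Suc order_trans)
  moreover have "real (b * D) * (lin k a z / real b + of_int e) = of_int (p + int b * int D * e)"
    using ab(2) p(2) by (simp add: field_simps)
  ultimately show ?thesis using height_le_extend[OF z ab(2)] by blast
qed

lemma height_le_midpoint:
  assumes z: "height_le D M k z"
    and ab: "bounded_form k C a" "1 \<le> b" "b \<le> C" and cd: "bounded_form k C c" "1 \<le> d" "d \<le> C"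
  shows "\<exists>D'. height_le D' (extension_height k C * M) (Suc k)
    (z(k := (lin k a z / real b + lin k c z / real d) / 2))"
proof -
  obtain p :: int where p: "\<bar>p\<bar> \<le> int (k * C * M)" "real D * lin k a z = of_int p"
    using height_le_lin[OF z ab(1)] by blast
  obtain q :: int where q: "\<bar>q\<bar> \<le> int (k * C * M)" "real D * lin k c z = of_int q"
    using height_le_lin[OF z cd(1)] by blast
  have "\<bar>int d * p\<bar> \<le> int C * int (k * C * M)" "\<bar>int b * q\<bar> \<le> int C * int (k * C * M)"
    unfolding abs_mult by (intro mult_mono; use ab cd p q in auto)+
  then have "\<bar>int d * p + int b * q\<bar> \<le> int (2 * (C * (k * C * M)))" by simp
  also have "\<dots> \<le> int (extension_height k C * M)"
    by (rule of_nat_mono) (simp add: extension_height_def algebra_simps)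
  finally have "\<bar>int d * p + int b * q\<bar> \<le> int (extension_height k C * M)" .
  moreover have "2 * b * d \<le> extension_height k C"
  proof -
    have "2 * b * d \<le> 2 * C * C" using ab cd by (intro mult_le_mono) auto
    then show ?thesis by (simp add: extension_height_def)
  qed
  moreover have "1 \<le> 2 * b * d" using ab cd by (metis One_nat_def Suc_le_eq mult_pos_pos pos2)
  moreover have "real (2 * b * d * D) * ((lin k a z / real b + lin k c z / real d) / 2) =
      of_int (int d * p + int b * q)"
  proof -
    have "real (2 * b * d * D) * ((lin k a z / real b + lin k c z / real d) / 2) =
        real d * (real D * lin k a z) + real b * (real D * lin k c z)"
      using ab(2) cd(2) by (simp add: field_simps)
    then show ?thesis by (simp add: p q)
  qed
  ultimately show ?thesis using height_le_extend[OF z] by blast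
qed


subsection \<open>Extending by one coordinate\<close>

text \<open>
  Eliminating the last variable from two inequalities gives a form with coefficients bounded by
  \<open>2 C\<^sup>2\<close>; this is the reason for the loss in the level of specialization. The comparison \<open>R\<close> with zero
  is weak in one application and strict in the other.
\<close>

lemma quotients_less:
  assumes "\<And>e. bounded_form k (2 * C * C) e \<Longrightarrow> R (lin k e z) \<Longrightarrow> R (lin k e z')"
    and "bounded_form k C a" "1 \<le> b" "b \<le> C" "bounded_form k C c" "1 \<le> d" "d \<le> C"
    and "R (real d * lin k a z - real b * lin k c z)"
  shows "R (real d * lin k a z' - real b * lin k c z')"
proof -
  have "bounded_form k (2 * C * C) (\<lambda>i. int d * a i + (- int b) * c i)"
    by (rule bounded_combine) (use assms in auto)
  from assms(1)[OF this] show ?thesis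
    using assms(8) unfolding lin_combine by simp
qed

text \<open>
  Fourier-Motzkin elimination of the new coordinate of \<open>z'\<close>. The inequalities that it has to satisfy
  bound it by lower quotients \<open>L\<close> and upper quotients \<open>U\<close>. Those at \<open>z\<close> are consistent, being satisfied
  by its coordinate \<open>z k\<close>, and as \<open>z'\<close> specializes \<open>z\<close>, so are those at \<open>z'\<close>. The new coordinate can be
  taken to be one of the quotients.
\<close>

lemma specializes_extend_right:
  assumes sp: "specializes k (2 * C * C) z z'" and C: "1 \<le> C"
  shows "\<exists>x. specializes (Suc k) C z (z'(k := x)) \<and>
    (\<forall>D M. height_le D M k z' \<longrightarrow> (\<exists>D'. height_le D' (extension_height k C * M) (Suc k) (z'(k := x))))"
proof -
  let ?x = "z k"
  define L where "L = quotients k C z' (\<lambda>a b. lin k a z \<le> real b * ?x)"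
  define U where "U = quotients k C z' (\<lambda>a b. lin k a z \<ge> real b * ?x)"
  have LU: "l \<le> u" if "l \<in> L" "u \<in> U" for l u
  proof -
    obtain a b where ab: "l = lin k a z' / real b" "bounded_form k C a" "1 \<le> b" "b \<le> C"
        "lin k a z \<le> real b * ?x"
      using \<open>l \<in> L\<close> unfolding L_def quotients_def by blast
    obtain c d where cd: "u = lin k c z' / real d" "bounded_form k C c" "1 \<le> d" "d \<le> C"
        "lin k c z \<ge> real d * ?x"
      using \<open>u \<in> U\<close> unfolding U_def quotients_def by blast
    have "real d * lin k a z \<le> real d * (real b * ?x)"
      by (rule mult_left_mono[OF ab(5)]) simp
    moreover have "real b * (real d * ?x) \<le> real b * lin k c z"
      by (rule mult_left_mono[OF cd(5)]) simp
    ultimately have "real d * lin k a z - real b * lin k c z \<le> 0"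
      by (simp add: mult_ac)
    then have "real d * lin k a z' - real b * lin k c z' \<le> 0"
      by (rule quotients_less[where R = "\<lambda>r. r \<le> 0", rotated -1])
         (use sp ab cd in \<open>auto simp: specializes_def\<close>)
    then show ?thesis unfolding ab(1) cd(1) using ab(3) cd(3) by (simp add: field_simps)
  qed
  have fin: "finite L" "finite U" by (simp_all add: L_def U_def finite_quotients)
  have zero: "bounded_form k C (\<lambda>_. 0)" "lin k (\<lambda>_. 0) y = 0" for y
    by (auto simp: bounded_form_def lin_def)
  \<comment> \<open>the zero form contributes the quotient 0, so \<open>L\<close> and \<open>U\<close> are not both empty\<close>
  obtain x where x: "x \<in> L \<union> U" "\<forall>l\<in>L. l \<le> x" "\<forall>u\<in>U. x \<le> u"
  proof (cases "L = {}")
    case False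
    then show ?thesis using that[of "Max L"] LU fin by (auto simp: Max_in)
  next
    case True
    have "U \<noteq> {}"
    proof (rule ccontr)
      assume "\<not> U \<noteq> {}"
      then have "0 / real 1 \<notin> L \<union> U" using True by auto
      then show False unfolding L_def U_def quotients_def
        using zero C by (smt (verit, best) Un_iff le_numeral_extra(4) mem_Collect_eq)
    qed
    then show ?thesis using that[of "Min U"] True LU fin by (auto simp: Min_in)
  qed
  have "specializes (Suc k) C z (z'(k := x))"
    unfolding specializes_def
  proof (intro allI impI)
    fix a assume a: "bounded_form (Suc k) C a" "lin (Suc k) a z \<le> 0"
    have ak: "bounded_form k C a" "bounded_form k C (\<lambda>i. - a i)" "\<bar>a k\<bar> \<le> int C"
      using a(1) by (auto simp: bounded_form_def)
    consider "a k = 0" | "a k > 0" | "a k < 0" by linarith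
    then show "lin (Suc k) a (z'(k := x)) \<le> 0"
    proof cases
      case 1
      have "C \<le> 2 * C * C" using C by simp
      then have "specializes k C z z'" using sp specializes_mono by blast
      then show ?thesis using a ak(1) 1 by (simp add: lin_Suc specializes_def)
    next
      case 2
      have "lin k (\<lambda>i. - a i) z' / real (nat (a k)) \<in> U"
        unfolding U_def quotients_def
        using 2 a(2) ak by (auto simp: lin_Suc lin_uminus intro!: exI[of _ "\<lambda>i. - a i"] exI[of _ "nat (a k)"])
      then have "x \<le> lin k (\<lambda>i. - a i) z' / real (nat (a k))" using x by blast
      then show ?thesis using 2 by (simp add: lin_Suc lin_uminus field_simps)
    next
      case 3
      have "lin k a z' / real (nat (- a k)) \<in> L"
        unfolding L_def quotients_def
        using 3 a(2) ak by (auto simp: lin_Suc intro!: exI[of _ a] exI[of _ "nat (- a k)"])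
      then have "lin k a z' / real (nat (- a k)) \<le> x" using x by blast
      then show ?thesis using 3 by (simp add: lin_Suc field_simps)
    qed
  qed
  moreover obtain a b where "x = lin k a z' / real b" "bounded_form k C a" "1 \<le> b" "b \<le> C"
    using x(1) unfolding L_def U_def quotients_def by blast
  then have "\<exists>D'. height_le D' (extension_height k C * M) (Suc k) (z'(k := x))"
    if "height_le D M k z'" for D M
    using height_le_quotient[OF that, of C a b 0] by simp
  ultimately show ?thesis by blast
qed

text \<open>
  Here the new coordinate belongs to the point that is specialized, and what it has to inherit are
  the strict inequalities that hold at \<open>z\<close>. It must therefore lie strictly between the lower and the upper
  quotients, and a midpoint is taken if both kinds are present.
\<close>

lemma specializes_extend_left:
  assumes sp: "specializes k (2 * C * C) z' z" and C: "1 \<le> C"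
  shows "\<exists>x. specializes (Suc k) C (z'(k := x)) z \<and>
    (\<forall>D M. height_le D M k z' \<longrightarrow> (\<exists>D'. height_le D' (extension_height k C * M) (Suc k) (z'(k := x))))"
proof -
  let ?x = "z k"
  define L where "L = quotients k C z' (\<lambda>a b. lin k a z < real b * ?x)"
  define U where "U = quotients k C z' (\<lambda>a b. lin k a z > real b * ?x)"
  have LU: "l < u" if "l \<in> L" "u \<in> U" for l u
  proof -
    obtain a b where ab: "l = lin k a z' / real b" "bounded_form k C a" "1 \<le> b" "b \<le> C"
        "lin k a z < real b * ?x"
      using \<open>l \<in> L\<close> unfolding L_def quotients_def by blast
    obtain c d where cd: "u = lin k c z' / real d" "bounded_form k C c" "1 \<le> d" "d \<le> C"
        "lin k c z > real d * ?x"
      using \<open>u \<in> U\<close> unfolding U_def quotients_def by blast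
    have "real d * lin k a z < real d * (real b * ?x)"
      by (rule mult_strict_left_mono[OF ab(5)]) (use cd in simp)
    moreover have "real b * (real d * ?x) < real b * lin k c z"
      by (rule mult_strict_left_mono[OF cd(5)]) (use ab in simp)
    ultimately have "real b * lin k c z - real d * lin k a z > 0"
      by (simp add: mult_ac)
    then have "real b * lin k c z' - real d * lin k a z' > 0"
      by (rule quotients_less[where R = "\<lambda>r. r > 0", rotated -1])
         (use ab cd in \<open>auto intro: specializes_gt[OF sp]\<close>)
    then show ?thesis unfolding ab(1) cd(1) using ab(3) cd(3) by (simp add: field_simps)
  qed
  have fin: "finite L" "finite U" by (simp_all add: L_def U_def finite_quotients)
  have LE: "\<exists>a b. l = lin k a z' / real b \<and> bounded_form k C a \<and> 1 \<le> b \<and> b \<le> C" if "l \<in> L \<union> U" for l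
    using that unfolding L_def U_def quotients_def by blast
  have zero: "bounded_form k C (\<lambda>_. 0)" "lin k (\<lambda>_. 0) y = 0" for y
    by (auto simp: bounded_form_def lin_def)
  have "\<exists>x. (\<forall>l\<in>L. l < x) \<and> (\<forall>u\<in>U. x < u) \<and>
     (\<forall>D M. height_le D M k z' \<longrightarrow> (\<exists>D'. height_le D' (extension_height k C * M) (Suc k) (z'(k := x))))"
  proof (cases "L = {}"; cases "U = {}")
    assume "L = {}" "U = {}"
    then show ?thesis
      using height_le_quotient[OF _ zero(1) le_refl C, where e = 0 and z = z']
      by (intro exI[of _ 0]) (auto simp: zero)
  next
    assume "L \<noteq> {}" "U = {}"
    then have "Max L \<in> L" using fin by simp
    then obtain a b where "Max L = lin k a z' / real b" "bounded_form k C a" "1 \<le> b" "b \<le> C"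
      using LE by blast
    moreover have "l < Max L + 1" if "l \<in> L" for l
      using Max_ge[OF fin(1) that] by simp
    ultimately show ?thesis using \<open>U = {}\<close> fin height_le_quotient[of _ _ k z' C a b 1]
      by (intro exI[of _ "Max L + 1"]) auto
  next
    assume "L = {}" "U \<noteq> {}"
    then have "Min U \<in> U" using fin by simp
    then obtain a b where "Min U = lin k a z' / real b" "bounded_form k C a" "1 \<le> b" "b \<le> C"
      using LE by blast
    moreover have "Min U - 1 < u" if "u \<in> U" for u
      using Min_le[OF fin(2) that] by simp
    ultimately show ?thesis using \<open>L = {}\<close> fin height_le_quotient[of _ _ k z' C a b "-1"]
      by (intro exI[of _ "Min U - 1"]) auto
  next
    assume "L \<noteq> {}" "U \<noteq> {}"
    then have m: "Max L \<in> L" "Min U \<in> U" using fin by auto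
    obtain a b where ab: "Max L = lin k a z' / real b" "bounded_form k C a" "1 \<le> b" "b \<le> C"
      using LE m by blast
    obtain c d where cd: "Min U = lin k c z' / real d" "bounded_form k C c" "1 \<le> d" "d \<le> C"
      using LE m by blast
    have lt: "Max L < Min U" using LU m by blast
    have "l < (Max L + Min U) / 2" if "l \<in> L" for l
      using Max_ge[OF fin(1) that] lt by simp
    moreover have "(Max L + Min U) / 2 < u" if "u \<in> U" for u
      using Min_le[OF fin(2) that] lt by simp
    moreover have "\<exists>D'. height_le D' (extension_height k C * M) (Suc k) (z'(k := (Max L + Min U) / 2))"
      if "height_le D M k z'" for D M
      unfolding ab(1) cd(1) by (rule height_le_midpoint[OF that ab(2-4) cd(2-4)])
    ultimately show ?thesis by blast
  qed
  then obtain x where x: "\<forall>l\<in>L. l < x" "\<forall>u\<in>U. x < u"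
     "\<forall>D M. height_le D M k z' \<longrightarrow> (\<exists>D'. height_le D' (extension_height k C * M) (Suc k) (z'(k := x)))"
    by blast
  have "specializes (Suc k) C (z'(k := x)) z"
    unfolding specializes_def
  proof (intro allI impI, rule ccontr)
    fix a assume a: "bounded_form (Suc k) C a" "lin (Suc k) a (z'(k := x)) \<le> 0"
      "\<not> lin (Suc k) a z \<le> 0"
    have ak: "bounded_form k C a" "bounded_form k C (\<lambda>i. - a i)" "\<bar>a k\<bar> \<le> int C"
      using a(1) by (auto simp: bounded_form_def)
    consider "a k = 0" | "a k > 0" | "a k < 0" by linarith
    then show False
    proof cases
      case 1
      have "C \<le> 2 * C * C" using C by simp
      then have "specializes k C z' z" using sp specializes_mono by blast
      then show ?thesis using a ak(1) 1 by (simp add: lin_Suc specializes_def)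
    next
      case 2
      have "lin k (\<lambda>i. - a i) z' / real (nat (a k)) \<in> L"
        unfolding L_def quotients_def
        using 2 a(3) ak by (auto simp: lin_Suc lin_uminus intro!: exI[of _ "\<lambda>i. - a i"] exI[of _ "nat (a k)"])
      then have "lin k (\<lambda>i. - a i) z' / real (nat (a k)) < x" using x by blast
      then show ?thesis using 2 a(2) by (simp add: lin_Suc lin_uminus field_simps)
    next
      case 3
      have "lin k a z' / real (nat (- a k)) \<in> U"
        unfolding U_def quotients_def
        using 3 a(3) ak by (auto simp: lin_Suc intro!: exI[of _ a] exI[of _ "nat (- a k)"])
      then have "x < lin k a z' / real (nat (- a k))" using x by blast
      then show ?thesis using 3 a(2) by (simp add: lin_Suc field_simps)
    qed
  qed
  with x(3) show ?thesis by blast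
qed

text \<open>
  The level from which \<open>j\<close> coordinates can be added so that level \<open>C\<close> remains.
\<close>

definition grow :: "nat \<Rightarrow> nat \<Rightarrow> nat" where
  "grow j C = ((\<lambda>c. 2 * c * c) ^^ j) C"

lemma grow_Suc: "grow (Suc j) C = 2 * grow j C * grow j C"
  by (simp add: grow_def)

lemma grow_0 [simp]: "grow 0 C = C"
  by (simp add: grow_def)

lemma grow_add: "grow (i + j) C = grow i (grow j C)"
  by (simp add: grow_def funpow_add)

lemma grow_ge: "1 \<le> C \<Longrightarrow> 1 \<le> grow j C"
  by (induction j) (auto simp: grow_Suc)

lemma grow_mono: "1 \<le> C \<Longrightarrow> i \<le> j \<Longrightarrow> grow i C \<le> grow j C"
proof (induction j)
  case (Suc j)
  have "grow j C \<le> grow (Suc j) C" using grow_ge[OF Suc.prems(1), of j] by (simp add: grow_Suc)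
  then show ?case using Suc by (cases "i = Suc j") auto
qed simp

text \<open>
  Adds \<open>j\<close> coordinates one by one. The relation \<open>R\<close> stands for specialization in either direction, the other
  point being fixed.
\<close>

lemma iterate_extension:
  assumes step: "\<And>k C z. R k (2 * C * C) z \<Longrightarrow> 1 \<le> C \<Longrightarrow> \<exists>x. R (Suc k) C (z(k := x)) \<and>
    (\<forall>D M. height_le D M k z \<longrightarrow> (\<exists>D'. height_le D' (extension_height k C * M) (Suc k) (z(k := x))))"
    and "R k (grow j C) z" "1 \<le> C" "(k + j) * grow j C \<le> N"
  shows "\<exists>z'. R (k + j) C z' \<and> (\<forall>i<k. z' i = z i) \<and>
    (\<forall>D M. height_le D M k z \<longrightarrow> (\<exists>D'. height_le D' (N ^ j * M) (k + j) z'))"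
  using assms(2,4)
proof (induction j arbitrary: k z)
  case 0
  then show ?case by auto
next
  case (Suc j)
  have "R k (2 * grow j C * grow j C) z" using Suc.prems(1) by (simp only: grow_Suc)
  from step[OF this grow_ge[OF assms(3)]] obtain x where
    x: "R (Suc k) (grow j C) (z(k := x))"
      "\<And>D M. height_le D M k z \<Longrightarrow>
         \<exists>D'. height_le D' (extension_height k (grow j C) * M) (Suc k) (z(k := x))"
    by blast
  have "extension_height k (grow j C) \<le> (k + Suc j) * grow (Suc j) C"
    unfolding extension_height_def grow_Suc by (rule mult_le_mono1) simp
  with Suc.prems(2) have le: "extension_height k (grow j C) \<le> N" by simp
  have "(Suc k + j) * grow j C \<le> (k + Suc j) * grow (Suc j) C"
    using grow_mono[OF assms(3), of j "Suc j"] by (intro mult_le_mono) auto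
  with Suc.prems(2) have "(Suc k + j) * grow j C \<le> N" by simp
  from Suc.IH[OF x(1) this] obtain z' where z': "R (Suc k + j) C z'"
      "\<forall>i<Suc k. z' i = (z(k := x)) i"
      "\<And>D M. height_le D M (Suc k) (z(k := x)) \<Longrightarrow> \<exists>D'. height_le D' (N ^ j * M) (Suc k + j) z'"
    by blast
  have "\<exists>D'. height_le D' (N ^ Suc j * M) (k + Suc j) z'" if h: "height_le D M k z" for D M
  proof -
    obtain D1 where "height_le D1 (extension_height k (grow j C) * M) (Suc k) (z(k := x))"
      using x(2)[OF h] by blast
    then have "height_le D1 (N * M) (Suc k) (z(k := x))"
      by (rule height_le_mono[OF _ mult_le_mono1[OF le]])
    from z'(3)[OF this] show ?thesis by (simp add: mult_ac)
  qed
  then show ?case using z'(1,2) by (intro exI[of _ z']) auto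
qed


section \<open>Term maps\<close>

text \<open>
  Targets are indexed from 0, like lists, whereas the variables of terms are indexed from 1. A point
  is a total function here; the coordinates that do not occur in the terms are irrelevant.
\<close>

definition solves :: "lterm list \<Rightarrow> (nat \<Rightarrow> real) \<Rightarrow> (nat \<Rightarrow> real) \<Rightarrow> bool" where
  "solves ts y x \<longleftrightarrow> (\<forall>j<length ts. eval_term (ts ! j) x = y j)"

definition onto :: "lterm list \<Rightarrow> bool" where
  "onto ts \<longleftrightarrow> (\<forall>y. \<exists>x. solves ts y x)"

text \<open>
  The length of its code bounds the coefficients of all linear forms that a term can agree with, and
  the strict inequality leaves room for subtracting a coordinate from such a form. The coordinate 0 is
  admitted to keep the indices of a point an initial segment of the natural numbers.
\<close>

definition fits :: "nat \<Rightarrow> nat \<Rightarrow> lterm list \<Rightarrow> bool" where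
  "fits m C ts \<longleftrightarrow> (\<forall>t\<in>set ts. vars t \<subseteq> {..m} \<and> length (encode_term t) < C)"

lemma eval_term_cong: "(\<And>i. i \<in> vars t \<Longrightarrow> x i = x' i) \<Longrightarrow> eval_term t x = eval_term t x'"
  by (induction t) auto

lemma eval_term_scale: "c \<ge> 0 \<Longrightarrow> eval_term t (\<lambda>i. c * x i) = c * eval_term t x"
  by (induction t)
     (auto simp: algebra_simps max_mult_distrib_left min_mult_distrib_left)

lemma lin_add: "lin k (\<lambda>i. a i + b i) z = lin k a z + lin k b z"
  using lin_combine[of k 1 a 1 b z] by simp

lemma lin_diff: "lin k (\<lambda>i. a i - b i) z = lin k a z - lin k b z"
  using lin_combine[of k 1 a "-1" b z] by simp

lemma lin_unit: "j < k \<Longrightarrow> lin k (\<lambda>i. if i = j then 1 else 0) z = z j"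
proof -
  assume "j < k"
  then have "(\<Sum>i<k. of_int (if i = j then 1 else 0) * z i) = (\<Sum>i<k. if i = j then z i else 0)"
    by (intro sum.cong) auto
  then show ?thesis using \<open>j < k\<close> by (simp add: lin_def)
qed

lemma bounded_add:
  "bounded_form k C a \<Longrightarrow> bounded_form k D b \<Longrightarrow> C + D \<le> E \<Longrightarrow> bounded_form k E (\<lambda>i. a i + b i)"
  "bounded_form k C a \<Longrightarrow> bounded_form k D b \<Longrightarrow> C + D \<le> E \<Longrightarrow> bounded_form k E (\<lambda>i. a i - b i)"
  unfolding bounded_form_def by fastforce+

lemma bounded_form_mono: "bounded_form k C a \<Longrightarrow> C \<le> D \<Longrightarrow> bounded_form k D a"
  unfolding bounded_form_def by fastforce

text \<open>
  At every point a term agrees with a linear form, found by following joins and meets to the larger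
  or smaller argument. Such a choice compares two forms of bounded coefficients, so the form chosen
  for \<open>z\<close> may be chosen for its specialization \<open>z'\<close> as well. The variables of the term are read from
  position \<open>n\<close> on.
\<close>

lemma eval_term_common_form:
  assumes "specializes k C z z'" "length (encode_term t) \<le> C" "\<And>i. i \<in> vars t \<Longrightarrow> n + i < k"
  shows "\<exists>a. bounded_form k (length (encode_term t)) a \<and>
    eval_term t (\<lambda>i. z (n + i)) = lin k a z \<and> eval_term t (\<lambda>i. z' (n + i)) = lin k a z'"
  using assms(2,3)
proof (induction t)
  case (Var i)
  then show ?case
    by (intro exI[of _ "\<lambda>j. if j = n + i then 1 else 0"]) (auto simp: lin_unit bounded_form_def)
next
  case Zero
  then show ?case
    by (intro exI[of _ "\<lambda>j. 0"]) (auto simp: lin_def bounded_form_def)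
next
  case (Plus s t)
  then obtain a b where
    "bounded_form k (length (encode_term s)) a" "bounded_form k (length (encode_term t)) b"
    "eval_term s (\<lambda>i. z (n + i)) = lin k a z" "eval_term s (\<lambda>i. z' (n + i)) = lin k a z'"
    "eval_term t (\<lambda>i. z (n + i)) = lin k b z" "eval_term t (\<lambda>i. z' (n + i)) = lin k b z'"
    by auto
  then show ?case
    by (intro exI[of _ "\<lambda>i. a i + b i"]) (auto simp: lin_add intro: bounded_add)
next
  case (Minus s t)
  then obtain a b where
    "bounded_form k (length (encode_term s)) a" "bounded_form k (length (encode_term t)) b"
    "eval_term s (\<lambda>i. z (n + i)) = lin k a z" "eval_term s (\<lambda>i. z' (n + i)) = lin k a z'"
    "eval_term t (\<lambda>i. z (n + i)) = lin k b z" "eval_term t (\<lambda>i. z' (n + i)) = lin k b z'"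
    by auto
  then show ?case
    by (intro exI[of _ "\<lambda>i. a i - b i"]) (auto simp: lin_diff intro: bounded_add)
next
  case (Join s t)
  then obtain a b where ab:
    "bounded_form k (length (encode_term s)) a" "bounded_form k (length (encode_term t)) b"
    "eval_term s (\<lambda>i. z (n + i)) = lin k a z" "eval_term s (\<lambda>i. z' (n + i)) = lin k a z'"
    "eval_term t (\<lambda>i. z (n + i)) = lin k b z" "eval_term t (\<lambda>i. z' (n + i)) = lin k b z'"
    by auto
  have le: "bounded_form k (length (encode_term (Join s t))) a"
      "bounded_form k (length (encode_term (Join s t))) b"
    using ab(1,2) by (auto intro: bounded_form_mono)
  have "bounded_form k C (\<lambda>i. a i - b i)"
    using ab(1,2) Join.prems(1) by (auto intro: bounded_add)
  then have "lin k a z \<le> lin k b z \<Longrightarrow> lin k a z' \<le> lin k b z'"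
      "lin k a z \<ge> lin k b z \<Longrightarrow> lin k a z' \<ge> lin k b z'"
    using assms(1) specializes_ge[OF assms(1)] by (force simp: specializes_def lin_diff)+
  then show ?case using ab le
    by (cases "lin k a z \<le> lin k b z") (auto simp: max_def intro: exI[of _ a] exI[of _ b])
next
  case (Meet s t)
  then obtain a b where ab:
    "bounded_form k (length (encode_term s)) a" "bounded_form k (length (encode_term t)) b"
    "eval_term s (\<lambda>i. z (n + i)) = lin k a z" "eval_term s (\<lambda>i. z' (n + i)) = lin k a z'"
    "eval_term t (\<lambda>i. z (n + i)) = lin k b z" "eval_term t (\<lambda>i. z' (n + i)) = lin k b z'"
    by auto
  have le: "bounded_form k (length (encode_term (Meet s t))) a"
      "bounded_form k (length (encode_term (Meet s t))) b"
    using ab(1,2) by (auto intro: bounded_form_mono)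
  have "bounded_form k C (\<lambda>i. a i - b i)"
    using ab(1,2) Meet.prems(1) by (auto intro: bounded_add)
  then have "lin k a z \<le> lin k b z \<Longrightarrow> lin k a z' \<le> lin k b z'"
      "lin k a z \<ge> lin k b z \<Longrightarrow> lin k a z' \<ge> lin k b z'"
    using assms(1) specializes_ge[OF assms(1)] by (force simp: specializes_def lin_diff)+
  then show ?case using ab le
    by (cases "lin k a z \<le> lin k b z") (auto simp: min_def intro: exI[of _ a] exI[of _ b])
qed

text \<open>
  The combined point \<open>z\<close> lists the target first and the solution after it, so that the equation
  \<open>T x = y\<close> consists of weak inequalities for forms in \<open>z\<close>.
\<close>

lemma solves_specializes:
  assumes "specializes k C z z'" "fits m C ts" "length ts + m < k"
    and "solves ts z (\<lambda>i. z (length ts + i))"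
  shows "solves ts z' (\<lambda>i. z' (length ts + i))"
  unfolding solves_def
proof (intro allI impI)
  fix j assume j: "j < length ts"
  then have t: "vars (ts ! j) \<subseteq> {..m}" "length (encode_term (ts ! j)) < C"
    using assms(2) by (auto simp: fits_def)
  obtain a where a: "bounded_form k (length (encode_term (ts ! j))) a"
      "eval_term (ts ! j) (\<lambda>i. z (length ts + i)) = lin k a z"
      "eval_term (ts ! j) (\<lambda>i. z' (length ts + i)) = lin k a z'"
    using eval_term_common_form[OF assms(1), of "ts ! j" "length ts"] t assms(3) by fastforce
  let ?b = "\<lambda>i. a i - (if i = j then 1 else 0)"
  have "bounded_form k C ?b"
    by (rule bounded_add(2)[OF a(1), of 1]) (use t in \<open>auto simp: bounded_form_def\<close>)
  moreover have "lin k ?b y = lin k a y - y j" for y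
    using j assms(3) by (simp add: lin_diff lin_unit)
  moreover have "lin k a z = z j"
    using assms(4) a(2) j by (simp add: solves_def)
  ultimately have "lin k a z' \<le> z' j" "lin k a z' \<ge> z' j"
    using assms(1) specializes_ge[OF assms(1)] by (force simp: specializes_def)+
  then show "eval_term (ts ! j) (\<lambda>i. z' (length ts + i)) = z' j"
    using a(3) by simp
qed

text \<open>
  A specialization \<open>y'\<close> of \<open>y\<close> is extended by specialized coordinates of a solution \<open>x\<close>. For different
  points this shows that the range is closed under specialization; for \<open>y' = y\<close> it replaces a real solution by
  a rational one of bounded height.
\<close>

lemma solvable_specializes:
  assumes "fits m C ts" "1 \<le> C" "specializes (length ts) (grow (Suc m) C) y y'" "solves ts y x"
    and "(length ts + Suc m) * grow (Suc m) C \<le> N"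
  shows "\<exists>x'. solves ts y' x' \<and>
    (\<forall>D M. height_le D M (length ts) y' \<longrightarrow> (\<exists>D'. height_le D' (N ^ Suc m * M) (Suc m) x'))"
proof -
  define z where "z = (\<lambda>i. if i < length ts then y i else x (i - length ts))"
  let ?R = "\<lambda>k C w. specializes k C z w"
  have "lin (length ts) a z = lin (length ts) a y" for a
    by (rule lin_cong) (auto simp: z_def)
  then have "?R (length ts) (grow (Suc m) C) y'"
    using assms(3) by (simp add: specializes_def)
  from iterate_extension[where R = ?R, OF specializes_extend_right this assms(2,5)]
  obtain w where w: "specializes (length ts + Suc m) C z w"
      "\<And>i. i < length ts \<Longrightarrow> w i = y' i"
      "\<And>D M. height_le D M (length ts) y' \<Longrightarrow> \<exists>D'. height_le D' (N ^ Suc m * M) (length ts + Suc m) w"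
    by blast
  have "solves ts z (\<lambda>i. z (length ts + i))"
    using assms(4) by (auto simp: solves_def z_def)
  then have "solves ts w (\<lambda>i. w (length ts + i))"
    by (rule solves_specializes[OF w(1) assms(1), rotated]) simp
  then have "solves ts y' (\<lambda>i. w (length ts + i))"
    using w(2) by (simp add: solves_def)
  moreover have "\<exists>D'. height_le D' (N ^ Suc m * M) (Suc m) (\<lambda>i. w (length ts + i))"
    if h: "height_le D M (length ts) y'" for D M
  proof -
    obtain D' where "height_le D' (N ^ Suc m * M) (length ts + Suc m) w" using w(3)[OF h] by blast
    then show ?thesis by (intro exI[of _ D']) (auto simp: height_le_def)
  qed
  ultimately show ?thesis by blast
qed

lemma solves_scale: "solves ts y x \<Longrightarrow> solves ts (\<lambda>j. real d * y j) (\<lambda>i. real d * x i)"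
  by (simp add: solves_def eval_term_scale)

lemma solves_cong:
  assumes "fits m C ts" "\<And>j. j < length ts \<Longrightarrow> y j = y' j" "\<And>i. i \<le> m \<Longrightarrow> x i = x' i"
  shows "solves ts y x \<longleftrightarrow> solves ts y' x'"
proof -
  have "eval_term (ts ! j) x = eval_term (ts ! j) x'" if "j < length ts" for j
    by (rule eval_term_cong) (use assms(1,3) that in \<open>force simp: fits_def\<close>)
  then show ?thesis using assms(2) by (simp add: solves_def)
qed

lemma onto_imp_small_solution:
  fixes y :: "nat \<Rightarrow> int"
  assumes ts: "fits m C ts" and C: "1 \<le> C" and K: "length ts + Suc m \<le> K"
    and N: "N = K * grow K C" and "onto ts" and y: "\<And>j. j < length ts \<Longrightarrow> \<bar>y j\<bar> \<le> int B" and B: "1 \<le> B"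
  shows "\<exists>(x :: nat \<Rightarrow> int) d. 1 \<le> d \<and> d \<le> N ^ K * B \<and> (\<forall>i\<le>m. \<bar>x i\<bar> \<le> int (N ^ K * B)) \<and>
    solves ts (\<lambda>j. real d * of_int (y j)) (\<lambda>i. of_int (x i))"
proof -
  have N1: "1 \<le> N" unfolding N using grow_ge[OF C, of K] K by simp
  have Nm: "(length ts + Suc m) * grow (Suc m) C \<le> N"
    unfolding N using K by (intro mult_le_mono grow_mono C) auto
  let ?y = "\<lambda>j. real_of_int (y j)"
  have h: "height_le 1 B (length ts) ?y"
    using y B by (auto simp: height_le_def)
  obtain x0 where x0: "solves ts ?y x0" using \<open>onto ts\<close> by (auto simp: onto_def)
  have "specializes (length ts) (grow (Suc m) C) ?y ?y" by (simp add: specializes_def)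
  from solvable_specializes[OF ts C this x0 Nm] h
  obtain x D where x: "solves ts ?y x" and D: "height_le D (N ^ Suc m * B) (Suc m) x"
    by blast
  have "N ^ Suc m \<le> N ^ K" by (rule power_increasing[OF _ N1]) (use K in simp)
  then have D: "height_le D (N ^ K * B) (Suc m) x"
    by (rule height_le_mono[OF D mult_le_mono1])
  then have "\<forall>i. \<exists>p::int. i \<le> m \<longrightarrow> \<bar>p\<bar> \<le> int (N ^ K * B) \<and> real D * x i = of_int p"
    unfolding height_le_def by (meson le_imp_less_Suc)
  then obtain p :: "nat \<Rightarrow> int" where
    p: "\<And>i. i \<le> m \<Longrightarrow> \<bar>p i\<bar> \<le> int (N ^ K * B)" "\<And>i. i \<le> m \<Longrightarrow> real D * x i = of_int (p i)"
    by metis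
  have "solves ts (\<lambda>j. real D * ?y j) (\<lambda>i. of_int (p i))"
    using solves_scale[OF x, of D]
    by (subst solves_cong[OF ts, of _ "\<lambda>j. real D * ?y j" _ "\<lambda>i. real D * x i"]) (auto simp: p(2))
  moreover have "1 \<le> D" "D \<le> N ^ K * B"
    using D unfolding height_le_def by blast+
  ultimately show ?thesis using p(1) by blast
qed

text \<open>
  Every point \<open>y0\<close> specializes a rational point of bounded height, and multiplied by its denominator this
  becomes an integer point \<open>p\<close> of bounded size. If some multiple of \<open>p\<close> is in the range, so is \<open>y0\<close>.
\<close>

lemma onto_if_integral_solutions:
  assumes ts: "fits m C ts" and C: "1 \<le> C" and K: "length ts + Suc m \<le> K"
    and N: "N = K * grow K C"
    and integral: "\<And>y :: nat \<Rightarrow> int. (\<And>j. j < length ts \<Longrightarrow> \<bar>y j\<bar> \<le> int (N ^ K)) \<Longrightarrow>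
      \<exists>x d. 1 \<le> d \<and> solves ts (\<lambda>j. real d * of_int (y j)) x"
  shows "onto ts"
  unfolding onto_def
proof
  have N1: "1 \<le> N" unfolding N using grow_ge[OF C, of K] K by simp
  have Nm: "(length ts + Suc m) * grow (Suc m) C \<le> N"
    unfolding N using K by (intro mult_le_mono grow_mono C) auto
  fix y0
  let ?n = "length ts" and ?C = "grow (Suc m) C"
  let ?R = "\<lambda>k C w. specializes k C w y0"
  have R0: "?R 0 (grow ?n ?C) (\<lambda>_. 0)" by (simp add: specializes_def lin_def)
  have "?n * grow ?n ?C \<le> N"
    unfolding N grow_add[symmetric] using K by (intro mult_le_mono grow_mono C) auto
  then have "(0 + ?n) * grow ?n ?C \<le> N" by simp
  from iterate_extension[where R = ?R, OF specializes_extend_left R0 grow_ge[OF C] this]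
  obtain w where w: "specializes (0 + ?n) ?C w y0"
      "\<forall>D M. height_le D M 0 (\<lambda>_. 0) \<longrightarrow> (\<exists>D'. height_le D' (N ^ ?n * M) (0 + ?n) w)"
    by blast
  have "height_le 1 1 0 (\<lambda>_. 0)" by (simp add: height_le_def)
  with w(2) obtain D where "height_le D (N ^ ?n * 1) (0 + ?n) w" by blast
  moreover have "N ^ ?n * 1 \<le> N ^ K" using power_increasing[OF _ N1, of ?n K] K by simp
  ultimately have D: "height_le D (N ^ K) (0 + ?n) w" by (rule height_le_mono)
  then have "\<forall>i. \<exists>p::int. i < ?n \<longrightarrow> \<bar>p\<bar> \<le> int (N ^ K) \<and> real D * w i = of_int p"
    unfolding height_le_def by fastforce
  then obtain p :: "nat \<Rightarrow> int" where
    p: "\<And>i. i < ?n \<Longrightarrow> \<bar>p i\<bar> \<le> int (N ^ K)" "\<And>i. i < ?n \<Longrightarrow> real D * w i = of_int (p i)"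
    by metis
  obtain x d where x: "1 \<le> d" "solves ts (\<lambda>j. real d * of_int (p j)) x"
    using integral[of p, OF p(1)] by blast
  let ?y = "\<lambda>j. real d * of_int (p j)"
  have D1: "1 \<le> D" using D by (simp add: height_le_def)
  have lin: "lin ?n a ?y = real d * (real D * lin ?n a w)" for a
    unfolding lin_def sum_distrib_left by (intro sum.cong) (auto simp: p(2)[symmetric] mult_ac)
  have "specializes ?n ?C ?y y0"
    unfolding specializes_def lin using w(1) x(1) D1
    by (auto simp: specializes_def mult_le_0_iff)
  from solvable_specializes[OF ts C this x(2) Nm] show "\<exists>x. solves ts y0 x" by blast
qed


subsection \<open>Separating terms\<close>

lemma nat_multiple_term: "\<exists>s. vars s \<subseteq> vars t \<and> (\<forall>v. eval_term s v = real k * eval_term t v)"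
proof (induction k)
  case 0
  show ?case by (rule exI[of _ Zero]) simp
next
  case (Suc k)
  then obtain s where "vars s \<subseteq> vars t" "\<forall>v. eval_term s v = real k * eval_term t v" by blast
  then show ?case by (intro exI[of _ "Plus s t"]) (auto simp: algebra_simps)
qed

lemma int_multiple_term: "\<exists>s. vars s \<subseteq> vars t \<and> (\<forall>v. eval_term s v = of_int z * eval_term t v)"
proof (cases z rule: int_cases2)
  case (nonneg k)
  then show ?thesis using nat_multiple_term[of t k] by simp
next
  case (nonpos k)
  obtain s where "vars s \<subseteq> vars t" "\<forall>v. eval_term s v = real k * eval_term t v"
    using nat_multiple_term by blast
  then show ?thesis using nonpos by (intro exI[of _ "Minus Zero s"]) simp
qed

lemma linear_term: "\<exists>t. vars t \<subseteq> {1..n} \<and> (\<forall>v. eval_term t v = lin n a (\<lambda>i. v (Suc i)))"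
proof (induction n)
  case 0
  show ?case by (rule exI[of _ Zero]) (simp add: lin_def)
next
  case (Suc n)
  then obtain t where t: "vars t \<subseteq> {1..n}" "\<forall>v. eval_term t v = lin n a (\<lambda>i. v (Suc i))" by blast
  obtain s where s: "vars s \<subseteq> vars (Var (Suc n))"
      "\<forall>v. eval_term s v = of_int (a n) * eval_term (Var (Suc n)) v"
    using int_multiple_term by blast
  show ?case
    by (rule exI[of _ "Plus t s"]) (use s t in \<open>auto simp: lin_Suc\<close>)
qed

text \<open>
  The minimum of the linear forms, written as a term.
\<close>

lemma positivity_term:
  assumes "finite A" "A \<noteq> {}"
  shows "\<exists>t. vars t \<subseteq> {1..n} \<and>
    (\<forall>v. 0 < eval_term t v \<longleftrightarrow> (\<forall>a\<in>A. 0 < lin n a (\<lambda>i. v (Suc i))))"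
  using assms
proof (induction A rule: finite_ne_induct)
  case (singleton a)
  obtain t where "vars t \<subseteq> {1..n}" "\<forall>v. eval_term t v = lin n a (\<lambda>i. v (Suc i))"
    using linear_term by blast
  then show ?case by (intro exI[of _ t]) simp
next
  case (insert a A)
  obtain t where "vars t \<subseteq> {1..n}" "\<forall>v. eval_term t v = lin n a (\<lambda>i. v (Suc i))"
    using linear_term by blast
  moreover obtain s where "vars s \<subseteq> {1..n}"
      "\<forall>v. 0 < eval_term s v \<longleftrightarrow> (\<forall>a\<in>A. 0 < lin n a (\<lambda>i. v (Suc i)))"
    using insert.IH by blast
  ultimately show ?case by (intro exI[of _ "Meet t s"]) simp
qed

text \<open>
  The term is the positive part of the minimum of all forms of bounded coefficients that are
  positive at \<open>y0\<close>. Wherever it is positive, these forms are positive, and so \<open>y0\<close> is a specialization; as the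
  range is closed under specialization and \<open>y0\<close> is missed, this cannot happen on the range.
\<close>

lemma separating_term:
  assumes ts: "fits m C ts" and C: "1 \<le> C" and y0: "\<nexists>x. solves ts y0 x"
  shows "\<exists>s. vars s \<subseteq> {1..length ts} \<and> eval_term s (\<lambda>i. y0 (i - 1)) \<noteq> 0 \<and>
    (\<forall>x. eval_term s (\<lambda>i. eval_term (ts ! (i - 1)) x) = 0)"
proof -
  let ?n = "length ts" and ?C = "grow (Suc m) C"
  define A where "A = {a \<in> PiE {..<?n} (\<lambda>_. {- int ?C..int ?C}). 0 < lin ?n a y0}"
  have "finite (PiE {..<?n} (\<lambda>_. {- int ?C..int ?C}))" by (rule finite_PiE) auto
  then have "finite A" unfolding A_def by simp
  have special: "specializes ?n ?C y y0" if "\<forall>a\<in>A. 0 < lin ?n a y" for y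
    unfolding specializes_def
  proof (intro allI impI, rule ccontr)
    fix a assume a: "bounded_form ?n ?C a" "lin ?n a y \<le> 0" "\<not> lin ?n a y0 \<le> 0"
    have lin: "lin ?n (restrict a {..<?n}) z = lin ?n a z" for z by (rule lin_cong) auto
    have "restrict a {..<?n} \<in> A"
      using a(1,3) by (auto simp: A_def lin bounded_form_def abs_le_iff minus_le_iff)
    with that a(2) show False by (auto simp: lin dest!: bspec)
  qed
  have image: "\<not> (\<forall>a\<in>A. 0 < lin ?n a (\<lambda>j. eval_term (ts ! j) x))" for x
  proof
    assume "\<forall>a\<in>A. 0 < lin ?n a (\<lambda>j. eval_term (ts ! j) x)"
    from special[OF this] have "specializes ?n ?C (\<lambda>j. eval_term (ts ! j) x) y0" .
    moreover have "solves ts (\<lambda>j. eval_term (ts ! j) x) x" by (simp add: solves_def)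
    ultimately show False using solvable_specializes[OF ts C _ _ le_refl] y0 by blast
  qed
  from image[of undefined] have "A \<noteq> {}" by blast
  then obtain t where t: "vars t \<subseteq> {1..?n}"
      "\<And>v. 0 < eval_term t v \<longleftrightarrow> (\<forall>a\<in>A. 0 < lin ?n a (\<lambda>i. v (Suc i)))"
    using positivity_term[OF \<open>finite A\<close>] by blast
  have "0 < eval_term t (\<lambda>i. y0 (i - 1))" unfolding t(2) by (simp add: A_def)
  moreover have "\<not> 0 < eval_term t (\<lambda>i. eval_term (ts ! (i - 1)) x)" for x
    unfolding t(2) using image by simp
  ultimately show ?thesis
    by (intro exI[of _ "Join Zero t"]) (use t(1) in \<open>auto simp: max_def not_less intro: antisym\<close>)
qed


section \<open>Generated subgroups and surjectivity\<close>

primrec subst :: "(nat \<Rightarrow> lterm) \<Rightarrow> lterm \<Rightarrow> lterm" where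
  "subst \<sigma> (Var i) = \<sigma> i"
| "subst \<sigma> Zero = Zero"
| "subst \<sigma> (Plus s t) = Plus (subst \<sigma> s) (subst \<sigma> t)"
| "subst \<sigma> (Minus s t) = Minus (subst \<sigma> s) (subst \<sigma> t)"
| "subst \<sigma> (Join s t) = Join (subst \<sigma> s) (subst \<sigma> t)"
| "subst \<sigma> (Meet s t) = Meet (subst \<sigma> s) (subst \<sigma> t)"

lemma eval_subst: "eval_term (subst \<sigma> s) x = eval_term s (\<lambda>i. eval_term (\<sigma> i) x)"
  by (induction s) auto

lemma vars_subst: "vars (subst \<sigma> s) = (\<Union>i\<in>vars s. vars (\<sigma> i))"
  by (induction s) auto

lemma term_fun_eq_iff:
  assumes "vars s \<subseteq> {1..k}" "vars t \<subseteq> {1..k}"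
  shows "term_fun k s = term_fun k t \<longleftrightarrow> (\<forall>x. eval_term s x = eval_term t x)"
proof
  assume eq: "term_fun k s = term_fun k t"
  show "\<forall>x. eval_term s x = eval_term t x"
  proof
    fix x :: "nat \<Rightarrow> real"
    let ?x = "restrict x {1..k}"
    have "?x \<in> Rn k" by (simp add: Rn_def)
    then have "eval_term s ?x = eval_term t ?x"
      using fun_cong[OF eq, of ?x] by (simp add: term_fun_def)
    moreover have "eval_term s ?x = eval_term s x" "eval_term t ?x = eval_term t x"
      using assms by (auto intro!: eval_term_cong)
    ultimately show "eval_term s x = eval_term t x" by simp
  qed
qed (simp add: term_fun_def)

lemma inv_term_fun:
  assumes "vars t \<subseteq> {1..k}"
  shows "inv\<^bsub>free_lgroup k\<^esub> (term_fun k t) = term_fun k (Minus Zero t)"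
proof -
  interpret comm_group "free_lgroup k" by (rule comm_group_free_lgroup)
  show ?thesis
  proof (rule inv_equality)
    show "term_fun k (Minus Zero t) \<otimes>\<^bsub>free_lgroup k\<^esub> term_fun k t = \<one>\<^bsub>free_lgroup k\<^esub>"
      unfolding free_lgroup_term_fun by (simp add: term_fun_def)
  qed (use assms in \<open>auto intro!: term_fun_closed\<close>)
qed

text \<open>
  In this context \<open>H\<close> is the generated subgroup, and \<open>\<sigma>\<close> substitutes the terms of the instance for
  the \<open>n\<close> variables, which corresponds to composition with the term map.
\<close>

locale term_system =
  fixes m :: nat and ts :: "lterm list" and n :: nat and \<sigma> :: "nat \<Rightarrow> lterm"
    and H :: "((nat \<Rightarrow> real) \<Rightarrow> real) lgroup"
  assumes vars_ts: "\<forall>t\<in>set ts. vars t \<subseteq> {1..m}"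
  defines "n \<equiv> length ts" and "\<sigma> \<equiv> \<lambda>i. ts ! (i - 1)"
    and "H \<equiv> l_generated (free_lgroup m) (term_fun m ` set ts)"
begin

lemma vars_\<sigma>: "i \<in> {1..n} \<Longrightarrow> vars (\<sigma> i) \<subseteq> {1..m}"
  using vars_ts unfolding \<sigma>_def n_def by (metis One_nat_def Suc_le_eq Suc_pred atLeastAtMost_iff nth_mem)

lemma vars_subst_\<sigma>: "vars s \<subseteq> {1..n} \<Longrightarrow> vars (subst \<sigma> s) \<subseteq> {1..m}"
  unfolding vars_subst using vars_\<sigma> by blast

lemma fits: "fits m (Suc (sum_list (map (length \<circ> encode_term) ts))) ts"
  unfolding fits_def using vars_ts member_le_sum_list[of _ "map (length \<circ> encode_term) ts"]
  by (fastforce simp: less_Suc_eq_le)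

lemma H_ops [simp]:
  "mult H = mult (free_lgroup m)" "one H = one (free_lgroup m)"
  "ljoin H = ljoin (free_lgroup m)" "lmeet H = lmeet (free_lgroup m)"
  by (simp_all add: H_def l_generated_def)

lemma carrier_H: "carrier H = {term_fun m (subst \<sigma> s) | s. vars s \<subseteq> {1..n}}" (is "_ = ?K")
proof
  interpret comm_group "free_lgroup m" by (rule comm_group_free_lgroup)
  have closed: "term_fun m (subst \<sigma> s) \<in> carrier (free_lgroup m)" if "vars s \<subseteq> {1..n}" for s
    by (rule term_fun_closed[OF vars_subst_\<sigma>[OF that]])
  have mem: "term_fun m (subst \<sigma> s) \<in> ?K" if "vars s \<subseteq> {1..n}" for s using that by blast
  have "l_subgroup ?K (free_lgroup m)"
    unfolding l_subgroup_def
  proof (intro conjI ballI)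
    show "subgroup ?K (free_lgroup m)"
    proof (rule subgroupI)
      show "?K \<subseteq> carrier (free_lgroup m)" using closed by blast
      show "?K \<noteq> {}" using mem[of Zero] by auto
      fix u assume "u \<in> ?K"
      then obtain s where s: "u = term_fun m (subst \<sigma> s)" "vars s \<subseteq> {1..n}" by blast
      show "inv\<^bsub>free_lgroup m\<^esub> u \<in> ?K"
        unfolding s(1) inv_term_fun[OF vars_subst_\<sigma>[OF s(2)]]
        using mem[of "Minus Zero s"] s(2) by simp
      fix v assume "v \<in> ?K"
      then obtain t where t: "v = term_fun m (subst \<sigma> t)" "vars t \<subseteq> {1..n}" by blast
      show "u \<otimes>\<^bsub>free_lgroup m\<^esub> v \<in> ?K"
        unfolding s(1) t(1) free_lgroup_term_fun using mem[of "Plus s t"] s(2) t(2) by simp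
    qed
    fix u v assume "u \<in> ?K" "v \<in> ?K"
    then obtain s t where st: "u = term_fun m (subst \<sigma> s)" "vars s \<subseteq> {1..n}"
        "v = term_fun m (subst \<sigma> t)" "vars t \<subseteq> {1..n}" by blast
    show "ljoin (free_lgroup m) u v \<in> ?K" "lmeet (free_lgroup m) u v \<in> ?K"
      unfolding st(1,3) free_lgroup_term_fun
      using mem[of "Join s t"] mem[of "Meet s t"] st(2,4) by simp_all
  qed
  moreover have "term_fun m ` set ts \<subseteq> ?K"
  proof
    fix u assume "u \<in> term_fun m ` set ts"
    then obtain j where "j < length ts" "u = term_fun m (ts ! j)" by (auto simp: in_set_conv_nth)
    then show "u \<in> ?K" using mem[of "Var (Suc j)"] by (simp add: \<sigma>_def n_def)
  qed
  ultimately show "carrier H \<subseteq> ?K"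
    unfolding H_def l_generated_def by auto
  have "term_fun m (subst \<sigma> s) \<in> K"
    if K: "l_subgroup K (free_lgroup m)" "term_fun m ` set ts \<subseteq> K" and "vars s \<subseteq> {1..n}" for K s
    using \<open>vars s \<subseteq> {1..n}\<close>
  proof (induction s)
    case (Var i)
    then have "\<sigma> i \<in> set ts" by (auto simp: \<sigma>_def n_def)
    then show ?case using K(2) by auto
  next
    case Zero
    then show ?case
      using K(1) unfolding l_subgroup_def subgroup_def free_lgroup_term_fun(2) by simp
  next
    case (Plus s t)
    then show ?case
      using K(1) unfolding l_subgroup_def subgroup_def
      by (simp add: free_lgroup_term_fun(1)[symmetric])
  next
    case (Minus s t)
    have "term_fun m (subst \<sigma> (Minus s t)) =
        term_fun m (subst \<sigma> s) \<otimes>\<^bsub>free_lgroup m\<^esub> term_fun m (Minus Zero (subst \<sigma> t))"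
      unfolding free_lgroup_term_fun by (simp add: term_fun_def)
    then have "term_fun m (subst \<sigma> (Minus s t)) =
        term_fun m (subst \<sigma> s) \<otimes>\<^bsub>free_lgroup m\<^esub> inv\<^bsub>free_lgroup m\<^esub> term_fun m (subst \<sigma> t)"
      using Minus.prems by (subst inv_term_fun[OF vars_subst_\<sigma>]) auto
    then show ?case
      using K(1) Minus unfolding l_subgroup_def subgroup_def by simp
  next
    case (Join s t)
    then show ?case
      using K(1) unfolding l_subgroup_def by (simp add: free_lgroup_term_fun(3)[symmetric])
  next
    case (Meet s t)
    then show ?case
      using K(1) unfolding l_subgroup_def by (simp add: free_lgroup_term_fun(4)[symmetric])
  qed
  then show "?K \<subseteq> carrier H" unfolding H_def l_generated_def by auto
qed

lemma carrier_H_cases: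
  assumes "u \<in> carrier H"
  obtains s where "u = term_fun m (subst \<sigma> s)" "vars s \<subseteq> {1..n}"
  using assms carrier_H by blast

lemma subst_in_H: "vars s \<subseteq> {1..n} \<Longrightarrow> term_fun m (subst \<sigma> s) \<in> carrier H"
  using carrier_H by blast

text \<open>
  The isomorphism sends \<open>s \<circ> T\<close> to \<open>s\<close>. This is well defined, because a term function on \<open>\<real>\<^sup>n\<close> is
  determined by its composition with the onto map \<open>T\<close>.
\<close>

lemma onto_imp_isomorphic:
  assumes "onto ts"
  shows "l_isomorphic H (free_lgroup n)"
proof -
  have eq_iff: "term_fun m (subst \<sigma> s) = term_fun m (subst \<sigma> t) \<longleftrightarrow> term_fun n s = term_fun n t"
    if st: "vars s \<subseteq> {1..n}" "vars t \<subseteq> {1..n}" for s t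
  proof -
    have "(\<forall>x. eval_term (subst \<sigma> s) x = eval_term (subst \<sigma> t) x) \<longleftrightarrow>
        (\<forall>v. eval_term s v = eval_term t v)"
    proof
      assume eq: "\<forall>x. eval_term (subst \<sigma> s) x = eval_term (subst \<sigma> t) x"
      show "\<forall>v. eval_term s v = eval_term t v"
      proof
        fix v
        obtain x where x: "solves ts (\<lambda>j. v (Suc j)) x" using assms unfolding onto_def by blast
        then have v: "eval_term (\<sigma> i) x = v i" if "i \<in> {1..n}" for i
          using that unfolding solves_def \<sigma>_def n_def
          by (metis One_nat_def Suc_le_eq Suc_pred atLeastAtMost_iff)
        have "eval_term r v = eval_term (subst \<sigma> r) x" if "vars r \<subseteq> {1..n}" for r
          unfolding eval_subst by (rule eval_term_cong) (use v that in auto)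
        then show "eval_term s v = eval_term t v" using eq st by simp
      qed
    qed (simp add: eval_subst)
    then show ?thesis
      unfolding term_fun_eq_iff[OF st] term_fun_eq_iff[OF st[THEN vars_subst_\<sigma>]] .
  qed
  define h where "h = (\<lambda>u. term_fun n (SOME s. vars s \<subseteq> {1..n} \<and> u = term_fun m (subst \<sigma> s)))"
  have h: "h (term_fun m (subst \<sigma> s)) = term_fun n s" if s: "vars s \<subseteq> {1..n}" for s
  proof -
    let ?P = "\<lambda>s'. vars s' \<subseteq> {1..n} \<and> term_fun m (subst \<sigma> s) = term_fun m (subst \<sigma> s')"
    have "?P (SOME s'. ?P s')" by (rule someI[of ?P s]) (use s in simp)
    then show ?thesis unfolding h_def using eq_iff[OF s] by metis
  qed
  have "h \<in> hom H (free_lgroup n)"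
  proof (rule homI)
    fix u assume "u \<in> carrier H"
    then obtain s where "u = term_fun m (subst \<sigma> s)" "vars s \<subseteq> {1..n}" by (rule carrier_H_cases)
    then show "h u \<in> carrier (free_lgroup n)" using h[of s] term_fun_closed[of s n] by simp
  next
    fix u v assume "u \<in> carrier H" "v \<in> carrier H"
    then obtain s t where st: "u = term_fun m (subst \<sigma> s)" "vars s \<subseteq> {1..n}"
        "v = term_fun m (subst \<sigma> t)" "vars t \<subseteq> {1..n}" unfolding carrier_H by blast
    show "h (u \<otimes>\<^bsub>H\<^esub> v) = h u \<otimes>\<^bsub>free_lgroup n\<^esub> h v"
      using h[of "Plus s t"] st by (simp add: h free_lgroup_term_fun)
  qed
  moreover have "bij_betw h (carrier H) (carrier (free_lgroup n))"
  proof (rule bij_betw_imageI)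
    show "inj_on h (carrier H)"
    proof (rule inj_onI)
      fix u v assume "u \<in> carrier H" "v \<in> carrier H" "h u = h v"
      then obtain s t where st: "u = term_fun m (subst \<sigma> s)" "vars s \<subseteq> {1..n}"
          "v = term_fun m (subst \<sigma> t)" "vars t \<subseteq> {1..n}" unfolding carrier_H by blast
      with \<open>h u = h v\<close> show "u = v" by (simp add: h eq_iff)
    qed
    have "h ` carrier H = {term_fun n s | s. vars s \<subseteq> {1..n}}"
    proof -
      have "h ` carrier H = {h (term_fun m (subst \<sigma> s)) | s. vars s \<subseteq> {1..n}}"
        unfolding carrier_H by blast
      also have "\<dots> = {term_fun n s | s. vars s \<subseteq> {1..n}}"
        by (intro Collect_cong ex_cong1) (auto simp: h)
      finally show ?thesis .
    qed
    then show "h ` carrier H = carrier (free_lgroup n)" by (simp add: free_lgroup_def)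
  qed
  moreover have "h (ljoin H u v) = ljoin (free_lgroup n) (h u) (h v) \<and>
      h (lmeet H u v) = lmeet (free_lgroup n) (h u) (h v)"
    if uv: "u \<in> carrier H" "v \<in> carrier H" for u v
  proof -
    obtain s t where st: "u = term_fun m (subst \<sigma> s)" "vars s \<subseteq> {1..n}"
        "v = term_fun m (subst \<sigma> t)" "vars t \<subseteq> {1..n}" using uv unfolding carrier_H by blast
    then show ?thesis using h[of "Join s t"] h[of "Meet s t"] by (simp add: h free_lgroup_term_fun)
  qed
  ultimately show ?thesis unfolding l_isomorphic_def l_iso_def iso_def by blast
qed

end


subsection \<open>Injective term maps\<close>

lemma continuous_map_eval_term:
  "continuous_map (Euclidean_space n) euclideanreal (\<lambda>x. eval_term t (\<lambda>i. x (i - 1)))"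
proof (induction t)
  case (Var i)
  have "continuous_map (powertop_real UNIV) euclideanreal (\<lambda>x. x (i - 1))"
    by (rule continuous_map_product_projection) simp
  then show ?case
    by (simp add: Euclidean_space_def continuous_map_from_subtopology)
qed (auto intro: continuous_map_add continuous_map_diff continuous_map_real_max continuous_map_real_min)

text \<open>
  The map with components \<open>g i\<close> has the left inverse with components \<open>f i\<close>. So it is injective, and by
  invariance of domain its image is an open neighbourhood of \<open>0\<close>. For every \<open>y\<close> it
  contains a small positive multiple of \<open>y\<close>, and hence \<open>y\<close>, as term functions are positively homogeneous.
\<close>

lemma injective_term_map_onto:
  assumes "\<And>x i. i \<in> {1..n} \<Longrightarrow> eval_term (f i) (\<lambda>j. eval_term (g j) x) = x i"
    and f: "\<And>i. i \<in> {1..n} \<Longrightarrow> vars (f i) \<subseteq> {1..n}" and g: "\<And>i. i \<in> {1..n} \<Longrightarrow> vars (g i) \<subseteq> {1..n}"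
  shows "\<exists>x. \<forall>i\<in>{1..n}. eval_term (g i) x = y i"
proof -
  let ?E = "Euclidean_space n"
  \<comment> \<open>the coordinates of \<open>Euclidean_space n\<close> are numbered from 0\<close>
  define \<Phi> where "\<Phi> = (\<lambda>x i. if i < n then eval_term (g (Suc i)) (\<lambda>j. x (j - 1)) else 0)"
  have inj: "inj_on \<Phi> (topspace ?E)"
  proof (rule inj_onI)
    fix x x' assume x: "x \<in> topspace ?E" "x' \<in> topspace ?E" "\<Phi> x = \<Phi> x'"
    show "x = x'"
    proof
      fix i show "x i = x' i"
      proof (cases "i < n")
        case True
        have g_eq: "eval_term (g j) (\<lambda>l. x (l - 1)) = eval_term (g j) (\<lambda>l. x' (l - 1))" if "j \<in> {1..n}" for j
        proof -
          have "j - 1 < n" "Suc (j - 1) = j" using that by auto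
          then show ?thesis using fun_cong[OF x(3), of "j - 1"] by (simp add: \<Phi>_def)
        qed
        have "eval_term (f (Suc i)) (\<lambda>j. eval_term (g j) (\<lambda>l. x (l - 1))) =
            eval_term (f (Suc i)) (\<lambda>j. eval_term (g j) (\<lambda>l. x' (l - 1)))"
          by (rule eval_term_cong) (use f[of "Suc i"] g_eq True in auto)
        with assms(1)[of "Suc i" "\<lambda>l. x (l - 1)"] assms(1)[of "Suc i" "\<lambda>l. x' (l - 1)"] True
        show ?thesis by simp
      qed (use x in \<open>simp add: topspace_Euclidean_space\<close>)
    qed
  qed
  have "continuous_map ?E ?E \<Phi>"
    unfolding \<Phi>_def continuous_map_componentwise_Euclidean_space
    using continuous_map_eval_term by blast
  then have op: "openin ?E (\<Phi> ` topspace ?E)"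
    using invariance_of_domain_Euclidean_space[OF openin_topspace _ inj] by simp
  define \<gamma> where "\<gamma> = (\<lambda>(c::real) i. if i < n then c * y (Suc i) else 0)"
  have "continuous_map euclideanreal ?E \<gamma>"
    unfolding \<gamma>_def continuous_map_componentwise_Euclidean_space
    by (auto intro!: continuous_intros)
  then have "open {c. \<gamma> c \<in> \<Phi> ` topspace ?E}"
    using openin_continuous_map_preimage[OF _ op] by fastforce
  moreover have "eval_term t (\<lambda>_. 0) = 0" for t by (induction t) auto
  then have "\<Phi> (\<lambda>_. 0) = \<gamma> 0" by (auto simp: \<Phi>_def \<gamma>_def)
  then have "0 \<in> {c. \<gamma> c \<in> \<Phi> ` topspace ?E}"
    by (auto simp: topspace_Euclidean_space image_iff intro!: exI[of _ "\<lambda>_. 0"])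
  ultimately obtain e where e: "e > 0" "ball 0 e \<subseteq> {c. \<gamma> c \<in> \<Phi> ` topspace ?E}"
    by (meson open_contains_ball)
  have "e / 2 \<in> ball 0 e" using e(1) by simp
  then have "\<gamma> (e / 2) \<in> \<Phi> ` topspace ?E" using e(2) by blast
  then obtain x where x: "\<gamma> (e / 2) = \<Phi> x" by blast
  have "eval_term (g i) (\<lambda>j. 2 / e * x (j - 1)) = y i" if "i \<in> {1..n}" for i
  proof -
    have "i - 1 < n" "Suc (i - 1) = i" using that by auto
    then have "e / 2 * y i = eval_term (g i) (\<lambda>j. x (j - 1))"
      using fun_cong[OF x, of "i - 1"] by (simp add: \<gamma>_def \<Phi>_def)
    then show ?thesis using e(1) by (subst eval_term_scale) (auto simp: field_simps)
  qed
  then show ?thesis by blast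
qed

context term_system
begin

text \<open>
  The isomorphism \<open>h\<close> replaces the components of \<open>T\<close> by terms \<open>g i\<close> in \<open>n\<close> variables: it sends \<open>s \<circ> T\<close> to
  \<open>s \<circ> G\<close>. Since \<open>h\<close> is onto, each coordinate is of the form \<open>s \<circ> G\<close>, which gives the left inverse of \<open>G\<close>. A
  term that separates a missed point from the range of \<open>T\<close> would vanish on the range of \<open>G\<close>, that is,
  everywhere.
\<close>

lemma isomorphic_imp_onto:
  assumes "l_isomorphic H (free_lgroup n)"
  shows "onto ts"
proof -
  obtain h where h: "h \<in> hom H (free_lgroup n)" "bij_betw h (carrier H) (carrier (free_lgroup n))"
    and lattice: "\<And>u v. u \<in> carrier H \<Longrightarrow> v \<in> carrier H \<Longrightarrow>
      h (ljoin H u v) = ljoin (free_lgroup n) (h u) (h v) \<and>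
      h (lmeet H u v) = lmeet (free_lgroup n) (h u) (h v)"
    using assms unfolding l_isomorphic_def l_iso_def iso_def by blast
  let ?\<tau> = "\<lambda>s. term_fun m (subst \<sigma> s)"
  have "\<exists>w. h (?\<tau> s) = term_fun n w \<and> vars w \<subseteq> {1..n}" if "vars s \<subseteq> {1..n}" for s
    using bij_betwE[OF h(2)] subst_in_H[OF that] by (metis free_lgroup_cases)
  then obtain w where w: "\<And>s. vars s \<subseteq> {1..n} \<Longrightarrow> h (?\<tau> s) = term_fun n (w s) \<and> vars (w s) \<subseteq> {1..n}"
    by metis
  define g where "g = (\<lambda>i. w (Var i))"
  have g: "vars (g i) \<subseteq> {1..n}" if "i \<in> {1..n}" for i using w[of "Var i"] that by (simp add: g_def)
  have vars_g: "vars (subst g s) \<subseteq> {1..n}" if "vars s \<subseteq> {1..n}" for s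
    unfolding vars_subst using g that by blast
  have add: "h (?\<tau> (Plus s t)) = h (?\<tau> s) \<otimes>\<^bsub>free_lgroup n\<^esub> h (?\<tau> t)"
    if "vars s \<subseteq> {1..n}" "vars t \<subseteq> {1..n}" for s t
    using hom_mult[OF h(1) subst_in_H[OF that(1)] subst_in_H[OF that(2)]]
    by (simp add: free_lgroup_term_fun)
  have "\<forall>x. eval_term (w s) x = eval_term (subst g s) x" if "vars s \<subseteq> {1..n}" for s
    using that
  proof (induction s)
    case (Var i)
    then show ?case by (simp add: g_def)
  next
    case Zero
    have "h (?\<tau> (Plus Zero Zero)) = h (?\<tau> Zero)" by (simp add: term_fun_def)
    then have "term_fun n (Plus (w Zero) (w Zero)) = term_fun n (w Zero)"
      using add[of Zero Zero] w[of Zero] by (simp add: free_lgroup_term_fun)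
    then show ?case using w[of Zero] by (subst (asm) term_fun_eq_iff) auto
  next
    case (Plus s t)
    then have "term_fun n (w (Plus s t)) = term_fun n (Plus (w s) (w t))"
      using add[of s t] w[of s] w[of t] w[of "Plus s t"] by (simp add: free_lgroup_term_fun)
    then show ?case using Plus w[of s] w[of t] w[of "Plus s t"] by (subst (asm) term_fun_eq_iff) auto
  next
    case (Minus s t)
    have "?\<tau> (Plus (Minus s t) t) = ?\<tau> s" by (simp add: term_fun_def)
    then have "term_fun n (w s) = term_fun n (Plus (w (Minus s t)) (w t))"
      using Minus.prems add[of "Minus s t" t] w[of s] w[of t] w[of "Minus s t"]
      by (simp add: free_lgroup_term_fun del: subst.simps)
    then show ?case using Minus w[of s] w[of t] w[of "Minus s t"]
      by (subst (asm) term_fun_eq_iff) (auto simp: eq_diff_eq)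
  next
    case (Join s t)
    then have "term_fun n (w (Join s t)) = term_fun n (Join (w s) (w t))"
      using lattice[of "?\<tau> s" "?\<tau> t"] subst_in_H w[of s] w[of t] w[of "Join s t"]
      by (simp add: free_lgroup_term_fun)
    then show ?case using Join w[of s] w[of t] w[of "Join s t"] by (subst (asm) term_fun_eq_iff) auto
  next
    case (Meet s t)
    then have "term_fun n (w (Meet s t)) = term_fun n (Meet (w s) (w t))"
      using lattice[of "?\<tau> s" "?\<tau> t"] subst_in_H w[of s] w[of t] w[of "Meet s t"]
      by (simp add: free_lgroup_term_fun)
    then show ?case using Meet w[of s] w[of t] w[of "Meet s t"] by (subst (asm) term_fun_eq_iff) auto
  qed
  then have h_subst: "h (?\<tau> s) = term_fun n (subst g s)" if "vars s \<subseteq> {1..n}" for s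
    using w[OF that] term_fun_eq_iff[OF conjunct2[OF w[OF that]] vars_g[OF that]] that by simp
  have "\<exists>s. vars s \<subseteq> {1..n} \<and> (\<forall>x. eval_term s (\<lambda>j. eval_term (g j) x) = x i)" if i: "i \<in> {1..n}" for i
  proof -
    have "term_fun n (Var i) \<in> h ` carrier H"
      using bij_betw_imp_surj_on[OF h(2)] i by (simp add: term_fun_closed)
    then obtain s where s: "vars s \<subseteq> {1..n}" "term_fun n (Var i) = h (?\<tau> s)"
      by (auto elim: carrier_H_cases)
    then have "term_fun n (subst g s) = term_fun n (Var i)" using h_subst by simp
    then have "\<forall>x. eval_term (subst g s) x = x i"
      using i vars_g[OF s(1)] by (subst (asm) term_fun_eq_iff) auto
    with s(1) show ?thesis by (auto simp: eval_subst)
  qed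
  then obtain f where f: "\<And>i. i \<in> {1..n} \<Longrightarrow> vars (f i) \<subseteq> {1..n}"
      "\<And>i x. i \<in> {1..n} \<Longrightarrow> eval_term (f i) (\<lambda>j. eval_term (g j) x) = x i"
    by metis
  have surj: "\<exists>x. \<forall>i\<in>{1..n}. eval_term (g i) x = y i" for y
    by (rule injective_term_map_onto[OF f(2,1) g])
  show ?thesis
    unfolding onto_def
  proof (rule allI, rule ccontr)
    fix y assume "\<nexists>x. solves ts y x"
    from separating_term[OF fits _ this] obtain s where s: "vars s \<subseteq> {1..n}"
        "eval_term s (\<lambda>i. y (i - 1)) \<noteq> 0" "\<And>x. eval_term (subst \<sigma> s) x = 0"
      unfolding eval_subst \<sigma>_def n_def by auto
    have "?\<tau> s = ?\<tau> Zero" using s(3) by (simp add: term_fun_def)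
    then have "term_fun n (subst g s) = term_fun n (subst g Zero)"
      using h_subst[OF s(1)] h_subst[of Zero] by simp
    then have zero: "eval_term s (\<lambda>i. eval_term (g i) x) = 0" for x
      using vars_g[OF s(1)] by (subst (asm) term_fun_eq_iff) (auto simp: eval_subst)
    obtain x where "\<forall>i\<in>{1..n}. eval_term (g i) x = y (i - 1)"
      using surj[of "\<lambda>i. y (i - 1)"] by blast
    then have "eval_term s (\<lambda>i. eval_term (g i) x) = eval_term s (\<lambda>i. y (i - 1))"
      using s(1) by (intro eval_term_cong) auto
    with zero s(2) show False by simp
  qed
qed

end

theorem isomorphic_iff_onto:
  assumes "\<forall>t\<in>set ts. vars t \<subseteq> {1..m}"
  shows "l_isomorphic (l_generated (free_lgroup m) (term_fun m ` set ts)) (free_lgroup (length ts))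
    \<longleftrightarrow> onto ts"
proof -
  interpret term_system m ts "length ts" "\<lambda>i. ts ! (i - 1)"
    "l_generated (free_lgroup m) (term_fun m ` set ts)"
    by unfold_locales (use assms in simp_all)
  show ?thesis using onto_imp_isomorphic isomorphic_imp_onto by blast
qed


section \<open>The decision procedure\<close>

text \<open>
  Every number is regarded as the code of an infinite sequence, whose head and tail are the two
  components of a pair. Thus points of any dimension are found by a search through the numbers.
\<close>

definition entry :: "nat \<Rightarrow> nat \<Rightarrow> nat" where
  "entry e i = fst (prod_decode (((\<lambda>e. snd (prod_decode e)) ^^ i) e))"

text \<open>
  The code of the sequence of \<open>k\<close> entries \<open>B\<close> followed by zeros.
\<close>

definition code_bound :: "nat \<Rightarrow> nat \<Rightarrow> nat" where
  "code_bound B k = ((\<lambda>e. prod_encode (B, e)) ^^ k) 0"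

lemma prod_encode_mono: "a \<le> a' \<Longrightarrow> b \<le> b' \<Longrightarrow> prod_encode (a, b) \<le> prod_encode (a', b')"
proof -
  assume "a \<le> a'" "b \<le> b'"
  moreover from this have "triangle (a + b) \<le> triangle (a' + b')"
    unfolding triangle_def by (intro div_le_mono mult_le_mono) auto
  ultimately show ?thesis by (simp add: prod_encode_def)
qed

lemma entries_exist: "(\<And>i. i < k \<Longrightarrow> f i \<le> B) \<Longrightarrow> \<exists>e. e \<le> code_bound B k \<and> (\<forall>i<k. entry e i = f i)"
proof (induction k arbitrary: f)
  case (Suc k)
  have "f (Suc i) \<le> B" if "i < k" for i using Suc.prems[of "Suc i"] that by simp
  from Suc.IH[of "\<lambda>i. f (Suc i)", OF this]
  obtain e where e: "e \<le> code_bound B k" "\<forall>i<k. entry e i = f (Suc i)" by blast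
  have "prod_encode (f 0, e) \<le> code_bound B (Suc k)"
    using e(1) Suc.prems[of 0] by (simp add: code_bound_def prod_encode_mono)
  moreover have "entry (prod_encode (f 0, e)) i = f i" if "i < Suc k" for i
    using that e(2) by (cases i) (auto simp: entry_def funpow_Suc_right simp del: funpow.simps(2))
  ultimately show ?case by blast
qed (auto intro: exI[of _ 0])

lemma entry_le: "entry e i \<le> e"
proof -
  have "snd (prod_decode e) \<le> e" "fst (prod_decode e) \<le> e" for e
    by (metis le_prod_encode_1 le_prod_encode_2 prod.collapse prod_decode_inverse)+
  moreover from this have "((\<lambda>e. snd (prod_decode e)) ^^ i) e \<le> e"
    by (induction i) (auto intro: order_trans)
  ultimately show ?thesis unfolding entry_def by (meson order_trans)
qed

text \<open>
  The state of the evaluation of a word from right to left: whether the word has been correct so far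
  and the equations checked so far hold; the number of strokes that wait for their \<open>Letter_X\<close>; the
  largest index of a variable; the number of separators; and the stack of values. An
  integer is a pair of natural numbers, standing for their difference.
\<close>

type_synonym stack_state = "bool \<times> nat \<times> nat \<times> nat \<times> (nat \<times> nat) list"

text \<open>
  Reading from right to left, the first operand is on top of the stack. For a join the second operand is
  taken if it is at least the first, for a meet if it is not.
\<close>

definition operate :: "letter \<Rightarrow> nat \<times> nat \<Rightarrow> nat \<times> nat \<Rightarrow> nat \<times> nat" where
  "operate a x y =
     (if a = Sym_plus then (fst x + fst y, snd x + snd y)
      else if a = Sym_minus then (fst x + snd y, snd x + fst y)
      else if (a = Sym_join) = (fst x + snd y \<le> fst y + snd x) then y else x)"

text \<open>
  The parameters are the target \<open>y\<close>, the point \<open>x\<close> and the factor \<open>d\<close>. At a separator the value of the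
  term just read is compared with \<open>d\<close> times a coordinate of \<open>y\<close>. These coordinates are used in reverse order,
  since the last term is met first.
\<close>

definition read_letter ::
  "(nat \<times> nat) \<times> (nat \<times> nat) \<times> nat \<Rightarrow> letter \<Rightarrow> stack_state \<Rightarrow> stack_state" where
  "read_letter par a s =
     (let ok = fst s; c = fst (snd s); mx = fst (snd (snd s)); j = fst (snd (snd (snd s)));
        st = snd (snd (snd (snd s)));
        y = fst par; x = fst (snd par); d = snd (snd par) in
      if a = Stroke then (ok, Suc c, mx, j, st)
      else if a = Letter_X then
        (ok \<and> c \<noteq> 0, 0, if mx \<le> c then c else mx, j, (entry (fst x) c, entry (snd x) c) # st)
      else if a = Letter_0 then (ok \<and> c = 0, 0, mx, j, (0, 0) # st)
      else if a = Separator then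
        (ok \<and> c = 0 \<and> st \<noteq> [] \<and> tl st = [] \<and>
           fst (hd st) + d * entry (snd y) j = snd (hd st) + d * entry (fst y) j,
         0, mx, Suc j, [])
      else (ok \<and> c = 0 \<and> st \<noteq> [] \<and> tl st \<noteq> [], 0, mx, j,
         operate a (hd st) (hd (tl st)) # tl (tl st)))"

definition successful :: "stack_state \<Rightarrow> bool" where
  "successful s \<longleftrightarrow> fst s \<and> snd (snd (snd (snd s))) = [] \<and> fst (snd s) \<noteq> 0 \<and>
     fst (snd (snd (snd s))) \<noteq> 0 \<and> fst (snd (snd s)) \<le> fst (snd s)"

abbreviation initial_state :: stack_state where
  "initial_state \<equiv> (True, 0, 0, 0, [])"

primrec run ::
  "(nat \<times> nat) \<times> (nat \<times> nat) \<times> nat \<Rightarrow> letter list \<Rightarrow> stack_state \<Rightarrow> stack_state" where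
  "run par [] s = s"
| "run par (a # w) s = read_letter par a (run par w s)"

lemma run_append [simp]: "run par (v @ w) s = run par v (run par w s)"
  by (induction v) auto

lemma run_eq_fold: "run par w s = fold (read_letter par) (rev w) s"
  by (induction w) auto

lemma read_letter_simps [simp]:
  "read_letter par Stroke (ok, c, mx, j, st) = (ok, Suc c, mx, j, st)"
  "read_letter par Letter_X (ok, c, mx, j, st) =
     (ok \<and> c \<noteq> 0, 0, if mx \<le> c then c else mx, j,
      (entry (fst (fst (snd par))) c, entry (snd (fst (snd par))) c) # st)"
  "read_letter par Letter_0 (ok, c, mx, j, st) = (ok \<and> c = 0, 0, mx, j, (0, 0) # st)"
  "read_letter par Separator (ok, c, mx, j, st) =
     (ok \<and> c = 0 \<and> st \<noteq> [] \<and> tl st = [] \<and>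
        fst (hd st) + snd (snd par) * entry (snd (fst par)) j =
        snd (hd st) + snd (snd par) * entry (fst (fst par)) j, 0, mx, Suc j, [])"
  by (simp_all add: read_letter_def Let_def)

lemma read_letter_operation:
  "a \<notin> {Stroke, Letter_X, Letter_0, Separator} \<Longrightarrow> read_letter par a (ok, c, mx, j, st) =
     (ok \<and> c = 0 \<and> st \<noteq> [] \<and> tl st \<noteq> [], 0, mx, j, operate a (hd st) (hd (tl st)) # tl (tl st))"
  by (simp add: read_letter_def)

lemma read_letter_ok: "fst (read_letter par a s) \<Longrightarrow> fst s"
  by (auto simp: read_letter_def Let_def split: if_splits)

definition val :: "nat \<times> nat \<Rightarrow> real" where
  "val x = real (fst x) - real (snd x)"

definition point :: "nat \<times> nat \<Rightarrow> nat \<Rightarrow> real" where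
  "point x i = val (entry (fst x) i, entry (snd x) i)"

lemma run_strokes: "run par (replicate k Stroke) (ok, c, mx, j, st) = (ok, c + k, mx, j, st)"
  by (induction k) auto

text \<open>
  The index recorded by a run is described by its upper bounds, since in the end it is only compared with
  the number of variables, and since upper bounds combine without case distinctions.
\<close>

definition pushes_value :: "(nat \<times> nat) \<times> (nat \<times> nat) \<times> nat \<Rightarrow> lterm \<Rightarrow> bool" where
  "pushes_value par t \<longleftrightarrow> (\<forall>ok mx j st. \<exists>mx' r.
     run par (encode_term t) (ok, 0, mx, j, st) = (ok \<and> 0 \<notin> vars t, 0, mx', j, r # st) \<and>
     (\<forall>b. mx' \<le> b \<longleftrightarrow> mx \<le> b \<and> (\<forall>i\<in>vars t. i \<le> b)) \<and>
     val r = eval_term t (point (fst (snd par))))"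

lemma pushes_value_operands:
  assumes "pushes_value par s" "pushes_value par t"
  obtains mx' q r where
    "run par (encode_term s @ encode_term t) (ok, 0, mx, j, st) =
       (ok \<and> 0 \<notin> vars t \<and> 0 \<notin> vars s, 0, mx', j, q # r # st)"
    "\<And>b. mx' \<le> b \<longleftrightarrow> mx \<le> b \<and> (\<forall>i\<in>vars s \<union> vars t. i \<le> b)"
    "val q = eval_term s (point (fst (snd par)))" "val r = eval_term t (point (fst (snd par)))"
proof -
  obtain mx1 r where 1:
    "run par (encode_term t) (ok, 0, mx, j, st) = (ok \<and> 0 \<notin> vars t, 0, mx1, j, r # st)"
    "\<forall>b. mx1 \<le> b \<longleftrightarrow> mx \<le> b \<and> (\<forall>i\<in>vars t. i \<le> b)"
    "val r = eval_term t (point (fst (snd par)))"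
    using assms(2)[unfolded pushes_value_def, rule_format, of ok mx j st] by blast
  obtain mx2 q where 2:
    "run par (encode_term s) (ok \<and> 0 \<notin> vars t, 0, mx1, j, r # st) =
       ((ok \<and> 0 \<notin> vars t) \<and> 0 \<notin> vars s, 0, mx2, j, q # r # st)"
    "\<forall>b. mx2 \<le> b \<longleftrightarrow> mx1 \<le> b \<and> (\<forall>i\<in>vars s. i \<le> b)"
    "val q = eval_term s (point (fst (snd par)))"
    using assms(1)[unfolded pushes_value_def, rule_format, of "ok \<and> 0 \<notin> vars t" mx1 j "r # st"] by blast
  show ?thesis
    by (rule that[of mx2 q r]) (use 1 2 in auto)
qed

lemma pushes_value_operation:
  assumes "pushes_value par s" "pushes_value par t" "a \<notin> {Stroke, Letter_X, Letter_0, Separator}"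
    and "encode_term u = a # encode_term s @ encode_term t" "vars u = vars s \<union> vars t"
    and "\<And>q r. val q = eval_term s (point (fst (snd par))) \<Longrightarrow> val r = eval_term t (point (fst (snd par))) \<Longrightarrow>
      val (operate a q r) = eval_term u (point (fst (snd par)))"
  shows "pushes_value par u"
  unfolding pushes_value_def
proof (intro allI)
  fix ok mx j st
  obtain mx' q r where *:
    "run par (encode_term s @ encode_term t) (ok, 0, mx, j, st) =
       (ok \<and> 0 \<notin> vars t \<and> 0 \<notin> vars s, 0, mx', j, q # r # st)"
    "\<And>b. mx' \<le> b \<longleftrightarrow> mx \<le> b \<and> (\<forall>i\<in>vars s \<union> vars t. i \<le> b)"
    "val q = eval_term s (point (fst (snd par)))" "val r = eval_term t (point (fst (snd par)))"
    using pushes_value_operands[OF assms(1,2), of ok mx j st] by blast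
  have "run par (encode_term u) (ok, 0, mx, j, st) = (ok \<and> 0 \<notin> vars u, 0, mx', j, operate a q r # st)"
    using assms(3) by (simp add: assms(4,5) *(1) read_letter_operation del: run_append) blast
  then show "\<exists>mx' r. run par (encode_term u) (ok, 0, mx, j, st) = (ok \<and> 0 \<notin> vars u, 0, mx', j, r # st) \<and>
     (\<forall>b. mx' \<le> b \<longleftrightarrow> mx \<le> b \<and> (\<forall>i\<in>vars u. i \<le> b)) \<and> val r = eval_term u (point (fst (snd par)))"
    using *(2) assms(5) assms(6)[OF *(3,4)] by blast
qed

lemma run_term: "pushes_value par t"
proof (induction t)
  case (Var i)
  show ?case by (auto simp: pushes_value_def run_strokes point_def)
next
  case Zero
  show ?case by (auto simp: pushes_value_def val_def)
next
  case (Plus s t)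
  then show ?case by (rule pushes_value_operation) (auto simp: operate_def val_def)
next
  case (Minus s t)
  then show ?case by (rule pushes_value_operation) (auto simp: operate_def val_def)
next
  case (Join s t)
  then show ?case by (rule pushes_value_operation) (auto simp: operate_def val_def)
next
  case (Meet s t)
  then show ?case by (rule pushes_value_operation) (auto simp: operate_def val_def)
qed

lemma run_terms:
  "\<exists>mx. run (y, x, d) (concat (map (\<lambda>t. Separator # encode_term t) ts)) initial_state =
     ((\<forall>t\<in>set ts. 0 \<notin> vars t) \<and> solves (rev ts) (\<lambda>j. real d * point y j) (point x),
      0, mx, length ts, []) \<and>
     (\<forall>b. mx \<le> b \<longleftrightarrow> (\<forall>t\<in>set ts. \<forall>i\<in>vars t. i \<le> b))"
proof (induction ts)
  case Nil
  show ?case by (intro exI[of _ 0]) (auto simp: solves_def)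
next
  case (Cons t ts)
  define ok where "ok \<longleftrightarrow> (\<forall>t\<in>set ts. 0 \<notin> vars t) \<and> solves (rev ts) (\<lambda>j. real d * point y j) (point x)"
  obtain mx1 where 1: "run (y, x, d) (concat (map (\<lambda>t. Separator # encode_term t) ts)) initial_state =
      (ok, 0, mx1, length ts, [])"
      "\<forall>b. mx1 \<le> b \<longleftrightarrow> (\<forall>t\<in>set ts. \<forall>i\<in>vars t. i \<le> b)"
    using Cons.IH unfolding ok_def by blast
  obtain mx2 r where 2: "run (y, x, d) (encode_term t) (ok, 0, mx1, length ts, []) =
      (ok \<and> 0 \<notin> vars t, 0, mx2, length ts, [r])"
      "\<forall>b. mx2 \<le> b \<longleftrightarrow> mx1 \<le> b \<and> (\<forall>i\<in>vars t. i \<le> b)" "val r = eval_term t (point x)"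
    using run_term[unfolded pushes_value_def, rule_format, of "(y, x, d)" t ok mx1 "length ts" "[]"]
    by auto
  have cmp: "fst r + d * entry (snd y) (length ts) = snd r + d * entry (fst y) (length ts) \<longleftrightarrow>
      eval_term t (point x) = real d * point y (length ts)"
  proof -
    have "fst r + d * entry (snd y) (length ts) = snd r + d * entry (fst y) (length ts) \<longleftrightarrow>
        real (fst r + d * entry (snd y) (length ts)) = real (snd r + d * entry (fst y) (length ts))"
      by (simp only: of_nat_eq_iff)
    also have "\<dots> \<longleftrightarrow> val r = real d * point y (length ts)"
      by (auto simp: val_def point_def algebra_simps)
    finally show ?thesis using 2(3) by simp
  qed
  have "solves (rev (t # ts)) (\<lambda>j. real d * point y j) (point x) \<longleftrightarrow>
      solves (rev ts) (\<lambda>j. real d * point y j) (point x) \<and> eval_term t (point x) = real d * point y (length ts)"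
    by (auto simp: solves_def nth_append less_Suc_eq)
  moreover have "run (y, x, d) (concat (map (\<lambda>t. Separator # encode_term t) (t # ts))) initial_state =
      (ok \<and> 0 \<notin> vars t \<and> eval_term t (point x) = real d * point y (length ts), 0, mx2, length (t # ts), [])"
    by (simp add: 1(1) 2(1) cmp)
  ultimately show ?case
    using 1(2) 2(2) by (intro exI[of _ mx2]) (auto simp: ok_def)
qed

lemma successful_encode_instance:
  "successful (run (y, x, d) (encode_instance m ts) initial_state) \<longleftrightarrow>
     1 \<le> m \<and> 1 \<le> length ts \<and> (\<forall>t\<in>set ts. vars t \<subseteq> {1..m}) \<and>
     solves (rev ts) (\<lambda>j. real d * point y j) (point x)"
proof -
  obtain mx where mx: "run (y, x, d) (concat (map (\<lambda>t. Separator # encode_term t) ts)) initial_state =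
      ((\<forall>t\<in>set ts. 0 \<notin> vars t) \<and> solves (rev ts) (\<lambda>j. real d * point y j) (point x),
       0, mx, length ts, [])"
      "\<forall>b. mx \<le> b \<longleftrightarrow> (\<forall>t\<in>set ts. \<forall>i\<in>vars t. i \<le> b)"
    using run_terms by blast
  have "vars t \<subseteq> {1..m} \<longleftrightarrow> 0 \<notin> vars t \<and> (\<forall>i\<in>vars t. i \<le> m)" for t
    by (auto simp: Suc_le_eq) (metis gr0I)
  then show ?thesis
    using mx(2) by (auto simp: encode_instance_def mx(1) run_strokes successful_def Suc_le_eq)
qed

text \<open>
  The stack always corresponds to the terms that are complete but not yet used as operands, so a word without an
  error is the code of such terms, preceded by strokes that wait and followed by the terms already
  closed by a separator.
\<close>

lemma run_ok_imp_parsed: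
  "fst (run par w initial_state) \<Longrightarrow> \<exists>c mx j st ss ts. run par w initial_state = (True, c, mx, j, st) \<and>
     length ss = length st \<and> w = replicate c Stroke @ concat (map encode_term ss) @
       concat (map (\<lambda>t. Separator # encode_term t) ts)"
proof (induction w)
  case Nil
  show ?case by (auto intro: exI[of _ "[]"])
next
  case (Cons a w)
  let ?s = "run par w initial_state"
  have "fst ?s" using Cons.prems by (auto intro: read_letter_ok)
  with Cons.IH obtain c mx j st ss ts where IH: "?s = (True, c, mx, j, st)"
      "length ss = length st" "w = replicate c Stroke @ concat (map encode_term ss) @
       concat (map (\<lambda>t. Separator # encode_term t) ts)" by blast
  let ?goal = "\<lambda>c ss ts. \<exists>mx j st. run par (a # w) initial_state = (True, c, mx, j, st) \<and>
     length ss = length st \<and> a # w = replicate c Stroke @ concat (map encode_term ss) @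
       concat (map (\<lambda>t. Separator # encode_term t) ts)"
  have run: "run par (a # w) initial_state = read_letter par a (True, c, mx, j, st)"
    using IH(1) by simp
  note ok = Cons.prems[unfolded run]
  have binary: "\<exists>s1 s2 ss'. c = 0 \<and> ss = s1 # s2 # ss'"
    if "a \<notin> {Stroke, Letter_X, Letter_0, Separator}"
  proof -
    have "c = 0" "st \<noteq> []" "tl st \<noteq> []" using ok that by (auto simp: read_letter_operation)
    then have "length ss \<ge> 2" using IH(2) by (cases st; cases "tl st") auto
    then show ?thesis using \<open>c = 0\<close> by (cases ss; cases "tl ss") auto
  qed
  have "\<exists>c ss ts. ?goal c ss ts"
  proof (cases a)
    case Stroke
    then have "?goal (Suc c) ss ts" using IH(2) IH(3)[symmetric] by (simp add: IH(1) read_letter_operation)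
    then show ?thesis by blast
  next
    case Letter_X
    then have "?goal 0 (Var c # ss) ts" using ok IH(2) IH(3)[symmetric] by (simp add: IH(1) read_letter_operation)
    then show ?thesis by blast
  next
    case Letter_0
    then have "?goal 0 (Zero # ss) ts" using ok IH(2) IH(3)[symmetric] by (simp add: IH(1) read_letter_operation)
    then show ?thesis by blast
  next
    case Separator
    then have st: "c = 0" "st \<noteq> []" "tl st = []" using ok by (auto simp: read_letter_operation)
    then have "length ss = 1" using IH(2) by (cases st) auto
    then obtain s1 where "ss = [s1]" by (auto simp: length_Suc_conv)
    then have "?goal 0 [] (s1 # ts)" using Separator ok IH(2) IH(3)[symmetric] st by (simp add: IH(1) read_letter_operation)
    then show ?thesis by blast
  next
    case Sym_plus
    then obtain s1 s2 ss' where "c = 0" "ss = s1 # s2 # ss'" using binary by auto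
    then have "?goal 0 (Plus s1 s2 # ss') ts"
      using Sym_plus ok IH(2) IH(3)[symmetric] by (auto simp: IH(1) read_letter_operation)
    then show ?thesis by blast
  next
    case Sym_minus
    then obtain s1 s2 ss' where "c = 0" "ss = s1 # s2 # ss'" using binary by auto
    then have "?goal 0 (Minus s1 s2 # ss') ts"
      using Sym_minus ok IH(2) IH(3)[symmetric] by (auto simp: IH(1) read_letter_operation)
    then show ?thesis by blast
  next
    case Sym_join
    then obtain s1 s2 ss' where "c = 0" "ss = s1 # s2 # ss'" using binary by auto
    then have "?goal 0 (Join s1 s2 # ss') ts"
      using Sym_join ok IH(2) IH(3)[symmetric] by (auto simp: IH(1) read_letter_operation)
    then show ?thesis by blast
  next
    case Sym_meet
    then obtain s1 s2 ss' where "c = 0" "ss = s1 # s2 # ss'" using binary by auto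
    then have "?goal 0 (Meet s1 s2 # ss') ts"
      using Sym_meet ok IH(2) IH(3)[symmetric] by (auto simp: IH(1) read_letter_operation)
    then show ?thesis by blast
  qed
  then show ?case by blast
qed

lemma successful_imp_encode_instance:
  assumes "successful (run par w initial_state)"
  shows "\<exists>m ts. w = encode_instance m ts"
proof -
  have "fst (run par w initial_state)" using assms by (simp add: successful_def)
  from run_ok_imp_parsed[OF this] obtain c mx j st ss ts where
    "run par w initial_state = (True, c, mx, j, st)" "length ss = length st"
    "w = replicate c Stroke @ concat (map encode_term ss) @ concat (map (\<lambda>t. Separator # encode_term t) ts)"
    by blast
  with assms show ?thesis by (auto simp: successful_def encode_instance_def)
qed


subsection \<open>Bounded search\<close>

definition search_height :: "nat \<Rightarrow> nat" where
  "search_height K = (K * grow K K) ^ K"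

text \<open>
  The codes below this number include those of all sequences needed as targets. It bounds the entries of these
  codes as well, since an entry never exceeds its code; this is why the size of the solutions to be searched
  is computed from it.
\<close>

definition target_bound :: "nat \<Rightarrow> nat" where
  "target_bound K = Suc (code_bound (search_height K) K)"

definition solution_bound :: "nat \<Rightarrow> nat" where
  "solution_bound K = search_height K * target_bound K"

text \<open>
  With \<open>K = Suc (enc w)\<close> exceeding the length of the word, \<open>K\<close> bounds at once the number of coordinates and
  the coefficients of the forms of the terms. Syntactic errors
  make every run unsuccessful, so they need no separate test.
\<close>

definition accepts :: "letter list \<Rightarrow> bool" where
  "accepts w \<longleftrightarrow>
    (\<forall>p<target_bound (Suc (enc w)). \<forall>q<target_bound (Suc (enc w)).
     \<exists>u<Suc (code_bound (solution_bound (Suc (enc w))) (Suc (enc w))).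
     \<exists>v<Suc (code_bound (solution_bound (Suc (enc w))) (Suc (enc w))).
     \<exists>d<Suc (solution_bound (Suc (enc w))).
       1 \<le> d \<and> successful (fold (read_letter ((p, q), (u, v), d)) w initial_state))"

lemma computable_entry [computable_intros]:
  "computable f \<Longrightarrow> computable g \<Longrightarrow> computable (\<lambda>x. entry (f x) (g x))"
  unfolding entry_def by (intro computable_intros)

lemma computable_prod_encode [computable_intros]:
  assumes "computable f" "computable g"
  shows "computable (\<lambda>x. prod_encode (f x, g x))"
proof -
  have "computable (\<lambda>x. enc (f x, g x))" by (intro computable_intros assms)
  then show ?thesis by (simp add: enc_prod_def enc_nat_def)
qed

lemma computable_code_bound [computable_intros]:
  assumes "computable f" "computable g"
  shows "computable (\<lambda>x. code_bound (f x) (g x))"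
  unfolding code_bound_def
  by (intro computable_intros assms computable_comp[OF assms(1)])

lemma computable_grow [computable_intros]:
  assumes "computable f" "computable g"
  shows "computable (\<lambda>x. grow (f x) (g x))"
  unfolding grow_def by (intro computable_intros assms)

lemma computable_power [computable_intros]:
  fixes f g :: "_ \<Rightarrow> nat"
  assumes "computable f" "computable g"
  shows "computable (\<lambda>x. f x ^ g x)"
proof -
  have "((\<lambda>y. b * y) ^^ n) 1 = b ^ n" for b n :: nat by (induction n) auto
  moreover have "computable (\<lambda>x. ((\<lambda>y. f x * y) ^^ g x) 1)"
    by (intro computable_intros assms computable_comp[OF assms(1)])
  ultimately show ?thesis by simp
qed

lemma computable_bounds [computable_intros]:
  assumes "computable f"
  shows "computable (\<lambda>x. search_height (f x))" "computable (\<lambda>x. target_bound (f x))"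
    "computable (\<lambda>x. solution_bound (f x))"
  unfolding search_height_def target_bound_def solution_bound_def
  by (intro computable_intros assms)+

lemma computable_operate [computable_intros]:
  "computable f \<Longrightarrow> computable g \<Longrightarrow> computable h \<Longrightarrow> computable (\<lambda>x. operate (f x) (g x) (h x))"
  unfolding operate_def by (intro computable_intros)

lemma computable_read_letter [computable_intros]:
  "computable f \<Longrightarrow> computable g \<Longrightarrow> computable h \<Longrightarrow> computable (\<lambda>x. read_letter (f x) (g x) (h x))"
  unfolding read_letter_def Let_def by (intro computable_intros)

lemma computable_successful [computable_intros]:
  "computable f \<Longrightarrow> computable (\<lambda>x. successful (f x))"
  unfolding successful_def by (intro computable_intros)

lemma computable_accepts: "computable accepts"
  unfolding accepts_def[abs_def] by (intro computable_intros)

lemma integer_point: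
  assumes "\<And>i. i < k \<Longrightarrow> \<bar>z i\<bar> \<le> int B"
  shows "\<exists>u v. u \<le> code_bound B k \<and> v \<le> code_bound B k \<and> (\<forall>i<k. point (u, v) i = of_int (z i))"
proof -
  obtain u where u: "u \<le> code_bound B k" "\<forall>i<k. entry u i = nat (z i)"
    using entries_exist[of k "\<lambda>i. nat (z i)" B] assms by fastforce
  obtain v where v: "v \<le> code_bound B k" "\<forall>i<k. entry v i = nat (- z i)"
    using entries_exist[of k "\<lambda>i. nat (- z i)" B] assms by fastforce
  have "point (u, v) i = of_int (z i)" if "i < k" for i
    using u(2) v(2) that by (simp add: point_def val_def)
  then show ?thesis using u(1) v(1) by blast
qed

text \<open>
  The stack machine meets the terms in reverse order, which permutes the coordinates of \<open>\<real>\<^sup>n\<close>.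
\<close>

lemma onto_rev: "onto (rev ts) \<longleftrightarrow> onto ts"
proof -
  have "onto (rev ts)" if onto: "onto ts" for ts
    unfolding onto_def
  proof
    fix y
    obtain x where "solves ts (\<lambda>j. y (length ts - Suc j)) x" using onto unfolding onto_def by blast
    then have "solves (rev ts) y x" by (auto simp: solves_def rev_nth)
    then show "\<exists>x. solves (rev ts) y x" by blast
  qed
  from this[of ts] this[of "rev ts"] show ?thesis by auto
qed

lemma accepts_encode_instance:
  "accepts (rev (encode_instance m ts)) \<longleftrightarrow>
     1 \<le> m \<and> 1 \<le> length ts \<and> (\<forall>t\<in>set ts. vars t \<subseteq> {1..m}) \<and> onto ts"
proof -
  let ?w = "encode_instance m ts"
  define K where "K = Suc (enc (rev ?w))"
  define N where "N = K * grow K K"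
  have len: "m + (\<Sum>t\<leftarrow>ts. Suc (length (encode_term t))) < K"
    using length_le_enc[of "rev ?w"] by (simp add: K_def encode_instance_def length_concat comp_def)
  have "length ts \<le> (\<Sum>t\<leftarrow>ts. Suc (length (encode_term t)))" by (induction ts) auto
  with len have Kn: "length (rev ts) + Suc m \<le> K" by simp
  have K1: "1 \<le> K" by (simp add: K_def)
  have fits: "fits m K (rev ts)" if "\<forall>t\<in>set ts. vars t \<subseteq> {1..m}"
    unfolding fits_def
  proof (intro ballI conjI)
    fix t assume "t \<in> set (rev ts)"
    then have t: "t \<in> set ts" by simp
    then show "vars t \<subseteq> {..m}" using that by fastforce
    have "Suc (length (encode_term t)) \<le> (\<Sum>t\<leftarrow>ts. Suc (length (encode_term t)))"
      using member_le_sum_list[of "Suc (length (encode_term t))" "map (\<lambda>t. Suc (length (encode_term t))) ts"] t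
      by auto
    with len show "length (encode_term t) < K" by simp
  qed
  let ?E1 = "target_bound K" and ?B2 = "solution_bound K"
  let ?E2 = "Suc (code_bound ?B2 K)"
  let ?cond = "1 \<le> m \<and> 1 \<le> length ts \<and> (\<forall>t\<in>set ts. vars t \<subseteq> {1..m})"
  have acc: "accepts (rev ?w) \<longleftrightarrow> (\<forall>p<?E1. \<forall>q<?E1. \<exists>u<?E2. \<exists>v<?E2. \<exists>d<Suc ?B2. 1 \<le> d \<and>
      ?cond \<and> solves (rev ts) (\<lambda>j. real d * point (p, q) j) (point (u, v)))"
    unfolding accepts_def K_def[symmetric] run_eq_fold[symmetric] successful_encode_instance
    by (simp only: conj_assoc)
  have E1: "0 < ?E1" by (simp add: target_bound_def)
  show ?thesis
  proof
    assume "accepts (rev ?w)"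
    note all = this[unfolded acc, rule_format]
    from all[OF E1 E1] have cond: ?cond by blast
    have "onto (rev ts)"
    proof (rule onto_if_integral_solutions[OF fits K1 Kn N_def])
      show "\<forall>t\<in>set ts. vars t \<subseteq> {1..m}" using cond by blast
      fix y :: "nat \<Rightarrow> int" assume y: "\<And>j. j < length (rev ts) \<Longrightarrow> \<bar>y j\<bar> \<le> int (N ^ K)"
      \<comment> \<open>coordinates beyond the last term are not bounded by assumption, so they are set to 0\<close>
      define z where "z = (\<lambda>j. if j < length (rev ts) then y j else 0)"
      have "\<bar>z j\<bar> \<le> int (search_height K)" for j
        using y by (auto simp: z_def search_height_def N_def)
      then obtain p q where pq: "p < ?E1" "q < ?E1" "\<forall>j<K. point (p, q) j = of_int (z j)"
        using integer_point[of K z "search_height K"] by (auto simp: target_bound_def less_Suc_eq_le)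
      obtain u v d where "1 \<le> d" "solves (rev ts) (\<lambda>j. real d * point (p, q) j) (point (u, v))"
        using all[OF pq(1,2)] by blast
      moreover have "point (p, q) j = of_int (y j)" if "j < length (rev ts)" for j
        using pq(3) that Kn by (simp add: z_def)
      ultimately have "1 \<le> d \<and> solves (rev ts) (\<lambda>j. real d * of_int (y j)) (point (u, v))"
        by (simp add: solves_def)
      then show "\<exists>x d. 1 \<le> d \<and> solves (rev ts) (\<lambda>j. real d * of_int (y j)) x" by blast
    qed
    with cond show "1 \<le> m \<and> 1 \<le> length ts \<and> (\<forall>t\<in>set ts. vars t \<subseteq> {1..m}) \<and> onto ts"
      by (simp add: onto_rev)
  next
    assume "1 \<le> m \<and> 1 \<le> length ts \<and> (\<forall>t\<in>set ts. vars t \<subseteq> {1..m}) \<and> onto ts"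
    then have cond: ?cond and onto: "onto (rev ts)" by (simp_all add: onto_rev)
    show "accepts (rev ?w)"
      unfolding acc
    proof (intro allI impI)
      fix p q assume pq: "p < ?E1" "q < ?E1"
      define y where "y = (\<lambda>j. int (entry p j) - int (entry q j))"
      have y: "\<bar>y j\<bar> \<le> int ?E1" for j
        using entry_le[of p j] entry_le[of q j] pq unfolding y_def by linarith
      have vars: "\<forall>t\<in>set ts. vars t \<subseteq> {1..m}" and "1 \<le> ?E1" using cond E1 by simp_all
      from onto_imp_small_solution[where y = y, OF fits[OF vars] K1 Kn N_def onto y this(2)]
      obtain x :: "nat \<Rightarrow> int" and d
        where xd: "1 \<le> d" "d \<le> N ^ K * ?E1" "\<forall>i\<le>m. \<bar>x i\<bar> \<le> int (N ^ K * ?E1)"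
          "solves (rev ts) (\<lambda>j. real d * of_int (y j)) (\<lambda>i. of_int (x i))" by blast
      have B2: "N ^ K * ?E1 = ?B2" by (simp add: solution_bound_def search_height_def N_def)
      \<comment> \<open>likewise for the variables beyond the last one\<close>
      define z where "z = (\<lambda>i. if i \<le> m then x i else 0)"
      have "\<bar>z i\<bar> \<le> int ?B2" for i
        using xd(3) by (simp add: z_def B2)
      then obtain u v where uv: "u < ?E2" "v < ?E2" "\<forall>i<K. point (u, v) i = of_int (z i)"
        using integer_point[of K z ?B2] by (auto simp: less_Suc_eq_le)
      have "point (u, v) i = of_int (x i)" if "i \<le> m" for i
        using uv(3) that Kn by (simp add: z_def)
      moreover have "point (p, q) j = of_int (y j)" for j
        by (simp add: point_def val_def y_def)
      ultimately have "solves (rev ts) (\<lambda>j. real d * point (p, q) j) (point (u, v))"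
        using xd(4) cond by (subst solves_cong[OF fits, of _ "\<lambda>j. real d * of_int (y j)" _ "\<lambda>i. of_int (x i)"]) auto
      then show "\<exists>u<?E2. \<exists>v<?E2. \<exists>d<Suc ?B2. 1 \<le> d \<and>
          ?cond \<and> solves (rev ts) (\<lambda>j. real d * point (p, q) j) (point (u, v))"
        using uv(1,2) xd(1,2) cond B2 by (metis less_Suc_eq_le)
    qed
  qed
qed

theorem theorem1p1:
  "turing_decidable
     {encode_instance m ts | m ts.
        1 \<le> m \<and> 1 \<le> length ts \<and> (\<forall>t\<in>set ts. vars t \<subseteq> {1..m}) \<and>
        l_isomorphic (l_generated (free_lgroup m) (term_fun m ` set ts))
                     (free_lgroup (length ts))}"
proof -
  have "{encode_instance m ts | m ts.
        1 \<le> m \<and> 1 \<le> length ts \<and> (\<forall>t\<in>set ts. vars t \<subseteq> {1..m}) \<and>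
        l_isomorphic (l_generated (free_lgroup m) (term_fun m ` set ts))
                     (free_lgroup (length ts))} = {w. accepts (rev w)}" (is "?L = _")
  proof (rule equalityI; rule subsetI)
    fix w assume "w \<in> ?L"
    then show "w \<in> {w. accepts (rev w)}"
      using isomorphic_iff_onto accepts_encode_instance by blast
  next
    fix w assume w: "w \<in> {w. accepts (rev w)}"
    have "0 < target_bound K" for K by (simp add: target_bound_def)
    with w obtain par where "successful (fold (read_letter par) (rev w) initial_state)"
      unfolding accepts_def by blast
    then have "successful (run par w initial_state)" by (simp add: run_eq_fold)
    then obtain m ts where "w = encode_instance m ts"
      using successful_imp_encode_instance by blast
    then show "w \<in> ?L"
      using w isomorphic_iff_onto accepts_encode_instance by blast
  qed
  then show ?thesis using turing_decidable_computable[OF computable_accepts] by simp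
qed

end
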